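(* Let $A\in\mathbb C^{n\times n}$, let $f$ be a scalar function such that $f(A)$ is defined, and let $\mathcal W\subset\mathbb C$ be a compact set containing the numerical range $\mathcal W(A)$. Assume that there are constants $C>0$ and $0\le q<1$ such that $$\min_{p_s\in\Pi_s}\max_{z\in\mathcal W}|f(z)-p_s(z)|\le Cq^s\qquad\text{for all } s,$$ where $\Pi_s$ is the set of all polynomials of degree $\le s$. Let $d$ be a positive integer, let $V_1,\dots,V_m$ be the color classes of a distance-$d$ coloring of the directed graph $G(A)$, let $v_\ell=\sum_{i\in V_\ell}e_i$, and let $\mathcal T(f(A))=\sum_{\ell=1}^m v_\ell^Hf(A)v_\ell$. Then, with $\varepsilon=Cq^d$, $$|\mathrm{tr}(f(A))-\mathcal T(f(A))|\le 2Kn\,\varepsilon,$$ where $K=1$ when $A$ is normal and $K=1+\sqrt2$ otherwise.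
   Context: The numerical range is $\mathcal W(A)=\{x^HAx:\|x\|_2=1\}$. The directed graph $G(A)$ of $A$ has vertices $V=\{1,\dots,n\}$ and edges $\{(i,j): a_{ij}\ne0,\ i\ne j\}$; $\mathrm d(i,j)$ is the length of a shortest path from $i$ to $j$ in $G(A)$ ($\infty$ if there is none). A distance-$d$ coloring of $G(A)$ is a mapping $\mathrm{col}:V\to\{1,\dots,m\}$ such that $\mathrm{col}(i)\ne\mathrm{col}(j)$ for all $i\ne j$ with $\mathrm d(i,j)\le d$; its color classes are $V_\ell=\{i:\mathrm{col}(i)=\ell\}$. $e_i$ is the $i$th canonical unit vector. $f(A)$ is the usual matrix function: the polynomial in $A$ interpolating $f$ on the spectrum of $A$ in the Hermite sense (with the required derivatives of $f$ assumed to exist). *)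

theory Defs
  imports
    "HOL-Analysis.Analysis"
    "HOL-Computational_Algebra.Polynomial"
    "Graph_Theory.Shortest_Path"
begin

section \<open>Complex matrices\<close>

definition conj_transpose :: "complex^'n^'m \<Rightarrow> complex^'m^'n" where
  "conj_transpose A = (\<chi> i j. cnj (A $ j $ i))"

definition normal_matrix :: "complex^'n^'n \<Rightarrow> bool" where
  "normal_matrix A \<longleftrightarrow> conj_transpose A ** A = A ** conj_transpose A"

text \<open>\<open>quad_form A x\<close> is \<open>x\<^sup>H A x\<close>.  The library inner product \<open>\<bullet>\<close> on \<open>complex^'n\<close> is
  real-valued and cannot be used here.\<close>

definition quad_form :: "complex^'n^'n \<Rightarrow> complex^'n \<Rightarrow> complex" where
  "quad_form A x = (\<Sum>i\<in>UNIV. cnj (x $ i) * (A *v x) $ i)"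

definition numerical_range :: "complex^'n^'n \<Rightarrow> complex set" where
  "numerical_range A = {quad_form A x | x. norm x = 1}"

section \<open>Matrix functions\<close>

primrec matrix_power :: "complex^'n^'n \<Rightarrow> nat \<Rightarrow> complex^'n^'n" where
  "matrix_power A 0 = mat 1"
| "matrix_power A (Suc k) = A ** matrix_power A k"

text \<open>\<open>mat c\<close> is the scalar matrix with diagonal entries \<open>c\<close>.\<close>

definition poly_mat :: "complex poly \<Rightarrow> complex^'n^'n \<Rightarrow> complex^'n^'n" where
  "poly_mat p A = (\<Sum>k\<le>degree p. mat (coeff p k) ** matrix_power A k)"

definition mat_spectrum :: "complex^'n^'n \<Rightarrow> complex set" where
  "mat_spectrum A = {z. \<exists>x. x \<noteq> 0 \<and> A *v x = z *s x}"

definition minimal_poly :: "complex^'n^'n \<Rightarrow> complex poly" where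
  "minimal_poly A = (THE p. lead_coeff p = 1 \<and> poly_mat p A = 0 \<and>
     (\<forall>q. q \<noteq> 0 \<and> poly_mat q A = 0 \<longrightarrow> degree p \<le> degree q))"

text \<open>The index of an eigenvalue (the size of its largest Jordan block) is its multiplicity as a
  root of the minimal polynomial.\<close>

definition eigenvalue_index :: "complex^'n^'n \<Rightarrow> complex \<Rightarrow> nat" where
  "eigenvalue_index A z = order z (minimal_poly A)"

text \<open>Existence of the complex derivatives of \<open>f\<close> at the single point \<open>z\<close> up to the given order.
  The derivative of order \<open>Suc k\<close> at \<open>z\<close> requires those of order at most \<open>k\<close> to exist in a
  neighbourhood of \<open>z\<close>; order 0 requires nothing.\<close>

primrec derivs_exist :: "nat \<Rightarrow> (complex \<Rightarrow> complex) \<Rightarrow> complex \<Rightarrow> bool" where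
  "derivs_exist 0 f z \<longleftrightarrow> True"
| "derivs_exist (Suc k) f z \<longleftrightarrow>
     (\<forall>\<^sub>F w in nhds z. derivs_exist k f w) \<and> (deriv ^^ k) f field_differentiable (at z)"

definition defined_on_spectrum :: "(complex \<Rightarrow> complex) \<Rightarrow> complex^'n^'n \<Rightarrow> bool" where
  "defined_on_spectrum f A \<longleftrightarrow>
     (\<forall>z\<in>mat_spectrum A. derivs_exist (eigenvalue_index A z - 1) f z)"

definition interpolates_on_spectrum ::
    "complex poly \<Rightarrow> (complex \<Rightarrow> complex) \<Rightarrow> complex^'n^'n \<Rightarrow> bool" where
  "interpolates_on_spectrum p f A \<longleftrightarrow>
     (\<forall>z\<in>mat_spectrum A. \<forall>j<eigenvalue_index A z. poly ((pderiv ^^ j) p) z = (deriv ^^ j) f z)"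

text \<open>The degree bound makes the Hermite interpolation polynomial unique.\<close>

definition hermite_poly :: "(complex \<Rightarrow> complex) \<Rightarrow> complex^'n^'n \<Rightarrow> complex poly" where
  "hermite_poly f A =
     (THE p. degree p < degree (minimal_poly A) \<and> interpolates_on_spectrum p f A)"

text \<open>Meaningful only if \<open>defined_on_spectrum f A\<close>.\<close>

definition matrix_fun :: "(complex \<Rightarrow> complex) \<Rightarrow> complex^'n^'n \<Rightarrow> complex^'n^'n" where
  "matrix_fun f A = poly_mat (hermite_poly f A) A"

section \<open>Polynomial approximation\<close>

text \<open>Infimum and supremum in the extended reals, so that the expression is meaningful without
  boundedness of \<open>f\<close> on \<open>W\<close>; for continuous \<open>f\<close> and compact nonempty \<open>W\<close> both are attained.\<close>

definition best_approx_error :: "(complex \<Rightarrow> complex) \<Rightarrow> complex set \<Rightarrow> nat \<Rightarrow> ereal" where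
  "best_approx_error f W s =
     (INF p\<in>{p :: complex poly. degree p \<le> s}. SUP z\<in>W. ereal (cmod (f z - poly p z)))"

section \<open>Graph colorings and the trace estimator\<close>

definition matrix_digraph :: "complex^'n^'n \<Rightarrow> ('n, 'n \<times> 'n) pre_digraph" where
  "matrix_digraph A =
     \<lparr>verts = UNIV, arcs = {(i, j). A $ i $ j \<noteq> 0 \<and> i \<noteq> j}, tail = fst, head = snd\<rparr>"

lemma wf_digraph_matrix_digraph: "wf_digraph (matrix_digraph A)"
  by unfold_locales (auto simp: matrix_digraph_def)

text \<open>Length of a shortest directed path: the shortest-path cost \<open>\<mu>\<close> for unit arc weights, which
  is \<open>\<infinity>\<close> if there is no path.\<close>

definition graph_dist :: "complex^'n^'n \<Rightarrow> 'n \<Rightarrow> 'n \<Rightarrow> ereal" where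
  "graph_dist A i j = wf_digraph.\<mu> (matrix_digraph A) (\<lambda>_. 1) i j"

definition distance_coloring :: "nat \<Rightarrow> complex^'n^'n \<Rightarrow> nat \<Rightarrow> ('n \<Rightarrow> nat) \<Rightarrow> bool" where
  "distance_coloring d A m col \<longleftrightarrow>
     range col \<subseteq> {1..m} \<and>
     (\<forall>i j. i \<noteq> j \<and> graph_dist A i j \<le> ereal (real d) \<longrightarrow> col i \<noteq> col j)"

definition color_class :: "('n \<Rightarrow> nat) \<Rightarrow> nat \<Rightarrow> 'n set" where
  "color_class col l = {i. col i = l}"

definition probing_vector :: "('n::finite \<Rightarrow> nat) \<Rightarrow> nat \<Rightarrow> complex^'n" where
  "probing_vector col l = (\<Sum>i\<in>color_class col l. axis i 1)"

definition probing_trace :: "('n::finite \<Rightarrow> nat) \<Rightarrow> nat \<Rightarrow> complex^'n^'n \<Rightarrow> complex" where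
  "probing_trace col m M = (\<Sum>l=1..m. quad_form M (probing_vector col l))"

end

theory Submission
  imports Defs "HOL-Complex_Analysis.Complex_Analysis"
    "HOL-Computational_Algebra.Fundamental_Theorem_Algebra"
    "HOL-Computational_Algebra.Field_as_Ring"
    "HOL-Computational_Algebra.Polynomial_Factorial"
begin

text \<open>If \<open>p\<close> has degree at most \<open>d\<close>, then \<open>p(A)\<close> vanishes at all \<open>(i, j)\<close> with \<open>i \<noteq> j\<close> of equal
  color, so the estimator is exact for \<open>p(A)\<close> and only \<open>E = (f - p)(A)\<close> contributes to the error.
  Here \<open>E\<close> is the limit of the matrices \<open>(p\<^sub>s - p)(A)\<close>, where \<open>p\<^sub>s\<close> approximates \<open>f\<close> on \<open>W(A)\<close>: an
  eigenvalue of index at least 2 is an interior point of \<open>W(A)\<close>, so there the derivatives of \<open>p\<^sub>s\<close>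
  converge as well.  The trace of \<open>E\<close> is at most \<open>n \<epsilon>\<close>, being a sum of eigenvalues, and the estimate
  for \<open>E\<close> is at most \<open>n\<close> times its norm.  For normal \<open>A\<close> this norm is at most \<open>\<epsilon>\<close>.  In general the
  weak form \<open>\<parallel>p(A)\<parallel> \<le> 3 max \<bar>p\<bar>\<close> of the Crouzeix--Palencia theorem suffices, because
  \<open>1 + 3 \<le> 2 (1 + \<surd>2)\<close>; it follows from the Crouzeix--Palencia argument with the trivial bound 3
  on the Cauchy transform of \<open>cnj f\<close> in place of the sharp bound 1.\<close>

unbundle no fps_syntax

section \<open>The Hermitian inner product\<close>

text \<open>The Crouzeix--Palencia argument closes on itself. If K is the best constant in the bound
  for polynomials, the bound 3 on the Cauchy transform yields K^4 <= 2 K^3 + 3 K^2, that is, (K -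
  3)(K + 1) <= 0 for K > 0; the sharp bound 1, obtained from boundary values of the transform, would
  yield 1 + sqrt 2. The argument needs K to be finite beforehand, and a bound on the numerical range
  alone gives no easy control of a polynomial at the eigenvalues. Hence K refers to a compact convex
  neighbourhood, which is shrunk at the end.

  No integral of matrices occurs: the contour is a polygon around the neighbourhood, and all
  integrals are finite Riemann sums whose error \<eta> tends to 0. Their summands contain
  1/(\<sigma> - z), which is not a polynomial, so a small functional calculus for uniform limits of
  polynomials carries the constant K over to them.\<close>

definition hinner :: "complex^'n \<Rightarrow> complex^'n \<Rightarrow> complex" where
  "hinner x y = (\<Sum>i\<in>UNIV. cnj (x $ i) * y $ i)"

lemma quad_form_hinner: "quad_form M x = hinner x (M *v x)"
  by (simp add: quad_form_def hinner_def)

lemma hinner_add_left: "hinner (x + y) z = hinner x z + hinner y z"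
  by (simp add: hinner_def sum.distrib algebra_simps)

lemma hinner_add_right: "hinner x (y + z) = hinner x y + hinner x z"
  by (simp add: hinner_def sum.distrib algebra_simps)

lemma hinner_diff_left: "hinner (x - y) z = hinner x z - hinner y z"
  by (simp add: hinner_def sum_subtractf algebra_simps)

lemma hinner_diff_right: "hinner x (y - z) = hinner x y - hinner x z"
  by (simp add: hinner_def sum_subtractf algebra_simps)

lemma hinner_scale_left: "hinner (c *s x) y = cnj c * hinner x y"
  by (simp add: hinner_def sum_distrib_left algebra_simps)

lemma hinner_scale_right: "hinner x (c *s y) = c * hinner x y"
  by (simp add: hinner_def sum_distrib_left algebra_simps)

lemma hinner_zero_right [simp]: "hinner x 0 = 0"
  by (simp add: hinner_def)

lemma hinner_sum_right: "hinner x (\<Sum>i\<in>I. f i) = (\<Sum>i\<in>I. hinner x (f i))"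
  by (induction I rule: infinite_finite_induct) (simp_all add: hinner_add_right)

lemma cnj_hinner: "cnj (hinner x y) = hinner y x"
  by (simp add: hinner_def cnj_sum mult.commute)

lemmas hinner_simps = hinner_add_left hinner_add_right hinner_diff_left hinner_diff_right
  hinner_scale_left hinner_scale_right

lemma hinner_self: "hinner x x = of_real ((norm x)\<^sup>2)"
proof -
  have "(norm x)\<^sup>2 = (\<Sum>i\<in>UNIV. (cmod (x $ i))\<^sup>2)"
    by (simp add: norm_vec_def L2_set_def sum_nonneg)
  then show ?thesis
    by (simp add: hinner_def complex_norm_square mult.commute del: of_real_power)
qed

lemma norm_hinner_le: "cmod (hinner x y) \<le> norm x * norm y"
proof -
  have "cmod (hinner x y) \<le> (\<Sum>i\<in>UNIV. cmod (x $ i) * cmod (y $ i))"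
    unfolding hinner_def by (rule order_trans[OF norm_sum]) (simp add: norm_mult)
  also have "\<dots> \<le> norm x * norm y"
    unfolding norm_vec_def using L2_set_mult_ineq[of "\<lambda>i. cmod (x $ i)" "\<lambda>i. cmod (y $ i)" UNIV] by simp
  finally show ?thesis .
qed

lemma norm_scale: "norm (c *s (x :: complex^'n)) = cmod c * norm x"
  by (simp add: norm_vec_def norm_mult L2_set_right_distrib)

section \<open>Scalar matrices and adjoints\<close>

lemma scaled_matrix_vector_mult: "(mat c ** M) *v x = c *s (M *v (x :: complex^'n))"
  by (simp add: vec_eq_iff matrix_vector_mult_def matrix_matrix_mult_def mat_def if_distrib
      if_distribR sum.delta' sum_distrib_left mult.assoc cong: if_cong)

lemma scaled_matrix_nth: "(mat c ** (M :: complex^'n^'m)) $ i $ j = c * M $ i $ j"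
  by (simp add: matrix_matrix_mult_def mat_def if_distrib if_distribR sum.delta' cong: if_cong)

lemma mat_scale_commute: "M ** mat c = mat c ** (M :: complex^'n^'n)"
  by (simp add: vec_eq_iff matrix_matrix_mult_def mat_def if_distrib if_distribR sum.delta
      sum.delta' mult.commute cong: if_cong)

lemma mat_vector_mult: "mat c *v (x :: complex^'n) = c *s x"
  by (simp add: vec_eq_iff matrix_vector_mult_def mat_def if_distrib
      if_distribR sum.delta' cong: if_cong)

lemma vector_scale_commute: "(M :: complex^'n^'m) *v (c *s x) = c *s (M *v x)"
  by (simp add: vec_eq_iff matrix_vector_mult_def sum_distrib_left mult.left_commute)

lemma conj_transpose_hinner: "hinner (conj_transpose M *v x) y = hinner x (M *v y)"
proof -
  have "hinner (conj_transpose M *v x) y = (\<Sum>i\<in>UNIV. \<Sum>j\<in>UNIV. cnj (x $ j) * M $ j $ i * y $ i)"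
    by (simp add: hinner_def conj_transpose_def matrix_vector_mult_def sum_distrib_right
        sum_distrib_left algebra_simps)
  also have "\<dots> = (\<Sum>j\<in>UNIV. \<Sum>i\<in>UNIV. cnj (x $ j) * M $ j $ i * y $ i)"
    by (rule sum.swap)
  also have "\<dots> = hinner x (M *v y)"
    by (simp add: hinner_def matrix_vector_mult_def sum_distrib_left algebra_simps)
  finally show ?thesis .
qed

lemma conj_transpose_hinner': "hinner (M *v x) y = hinner x (conj_transpose M *v y)"
  by (metis conj_transpose_hinner cnj_hinner)

lemma conj_transpose_conj_transpose [simp]: "conj_transpose (conj_transpose M) = M"
  by (simp add: conj_transpose_def vec_eq_iff)

lemma conj_transpose_add: "conj_transpose (M + N) = conj_transpose M + conj_transpose N"
  by (simp add: conj_transpose_def vec_eq_iff)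

lemma conj_transpose_zero [simp]: "conj_transpose 0 = 0"
  by (simp add: conj_transpose_def vec_eq_iff)

lemma conj_transpose_sum: "conj_transpose (\<Sum>i\<in>I. f i) = (\<Sum>i\<in>I. conj_transpose (f i))"
  by (induction I rule: infinite_finite_induct) (simp_all add: conj_transpose_add)

lemma conj_transpose_mult: "conj_transpose (M ** N) = conj_transpose N ** conj_transpose M"
  by (simp add: conj_transpose_def vec_eq_iff matrix_matrix_mult_def mult.commute)

lemma conj_transpose_mat: "conj_transpose (mat c) = mat (cnj c)"
  by (simp add: conj_transpose_def vec_eq_iff mat_def)

section \<open>The spectral norm\<close>

definition mat_norm :: "complex^'n^'n \<Rightarrow> real" where
  "mat_norm M = onorm ((*v) M)"

lemma mat_norm_bound: "norm (M *v x) \<le> mat_norm M * norm x"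
  unfolding mat_norm_def by (rule onorm) auto

lemma mat_norm_nonneg [simp]: "0 \<le> mat_norm M"
  unfolding mat_norm_def by (rule onorm_pos_le) auto

lemma mat_norm_le: "(\<And>x. norm (M *v x) \<le> b * norm x) \<Longrightarrow> mat_norm M \<le> b"
  unfolding mat_norm_def by (rule onorm_le)

lemma mat_norm_le_hinner:
  fixes M :: "complex^'n^'n"
  assumes b: "\<And>x y. norm x = 1 \<Longrightarrow> norm y = 1 \<Longrightarrow> cmod (hinner y (M *v x)) \<le> b"
  shows "mat_norm M \<le> b"
proof (rule mat_norm_le)
  fix x
  define y where "y = M *v x"
  show "norm (M *v x) \<le> b * norm x"
  proof (cases "x = 0 \<or> y = 0")
    case True
    \<comment> \<open>Nonnegativity of \<open>b\<close> comes from testing the hypothesis on a unit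
      vector.\<close>
    obtain e :: "complex^'n" where "norm e = 1"
      using vector_choose_size[of 1] by auto
    then have "0 \<le> b" using b[of e e] norm_ge_zero order_trans by blast
    with True show ?thesis by (auto simp: y_def)
  next
    case False
    define u v where "u = complex_of_real (inverse (norm x)) *s x"
      and "v = complex_of_real (inverse (norm y)) *s y"
    have "norm u = 1" "norm v = 1" using False by (simp_all add: u_def v_def norm_scale norm_inverse)
    moreover have "hinner v (M *v u) = of_real (inverse (norm y) * inverse (norm x) * (norm y)\<^sup>2)"
      by (simp add: u_def v_def hinner_simps vector_scale_commute flip: y_def)
         (simp add: hinner_self)
    ultimately have "cmod (of_real (inverse (norm y) * inverse (norm x) * (norm y)\<^sup>2)) \<le> b"
      using b[of u v] by simp
    then have "inverse (norm y) * inverse (norm x) * (norm y)\<^sup>2 \<le> b"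
      unfolding norm_of_real by linarith
    then show ?thesis
      using False by (simp add: field_simps power2_eq_square flip: y_def)
  qed
qed

lemma mat_norm_add: "mat_norm (M + N) \<le> mat_norm M + mat_norm N"
proof (rule mat_norm_le)
  fix x
  show "norm ((M + N) *v x) \<le> (mat_norm M + mat_norm N) * norm x"
    using norm_triangle_ineq[of "M *v x" "N *v x"] mat_norm_bound[of M x] mat_norm_bound[of N x]
    by (simp add: algebra_simps)
qed

lemma mat_norm_mult: "mat_norm (M ** N) \<le> mat_norm M * mat_norm N"
proof (rule mat_norm_le)
  fix x
  have "norm (M *v (N *v x)) \<le> mat_norm M * (mat_norm N * norm x)"
    by (rule order_trans[OF mat_norm_bound]) (intro mult_left_mono mat_norm_bound mat_norm_nonneg)
  then show "norm ((M ** N) *v x) \<le> mat_norm M * mat_norm N * norm x"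
    by (simp add: matrix_vector_mul_assoc mult.assoc)
qed

lemma mat_norm_scale_le: "mat_norm (mat c ** M) \<le> cmod c * mat_norm M"
proof (rule mat_norm_le)
  fix x
  show "norm ((mat c ** M) *v x) \<le> cmod c * mat_norm M * norm x"
    using mat_norm_bound[of M x]
    by (simp add: scaled_matrix_vector_mult norm_scale mult.assoc mult_left_mono)
qed

lemma mat_norm_minus: "mat_norm (M - N) = mat_norm (N - M)"
proof -
  have "mat_norm (M - N) \<le> mat_norm (N - M)" for M N :: "complex^'n^'n"
  proof (rule mat_norm_le)
    fix x
    have "(M - N) *v x = - ((N - M) *v x)" by (simp add: algebra_simps)
    then show "norm ((M - N) *v x) \<le> mat_norm (N - M) * norm x"
      using mat_norm_bound[of "N - M" x] by simp
  qed
  then show ?thesis by (meson order_antisym)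
qed

lemma mat_norm_diff: "mat_norm M \<le> mat_norm (M - N) + mat_norm N"
  using mat_norm_add[of "M - N" N] by simp

lemma norm_quad_form_le: "cmod (quad_form M x) \<le> mat_norm M * (norm x)\<^sup>2"
proof -
  have "cmod (quad_form M x) \<le> norm x * (mat_norm M * norm x)"
    unfolding quad_form_hinner
    by (rule order_trans[OF norm_hinner_le]) (intro mult_left_mono mat_norm_bound norm_ge_zero)
  then show ?thesis by (simp add: power2_eq_square algebra_simps)
qed

lemma mat_norm_conj_transpose: "mat_norm (conj_transpose M) = mat_norm M"
proof -
  have "mat_norm (conj_transpose M) \<le> mat_norm M" for M :: "complex^'n^'n"
  proof (rule mat_norm_le_hinner)
    fix x y :: "complex^'n"
    assume "norm x = 1" "norm y = 1"
    then show "cmod (hinner y (conj_transpose M *v x)) \<le> mat_norm M"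
      using norm_hinner_le[of "M *v y" x] mat_norm_bound[of M y]
      by (simp flip: conj_transpose_hinner')
  qed
  from this[of M] this[of "conj_transpose M"] show ?thesis by simp
qed

text \<open>The half of the C*-identity that is not submultiplicativity. Applied twice, it turns the
  fourth power of the norm of X into the norm of \<open>X ** Y ** (X ** Y)\<close>, Y the adjoint of
  X, in the Crouzeix--Palencia step.\<close>

lemma mat_norm_square_le: "(mat_norm M)\<^sup>2 \<le> mat_norm (conj_transpose M ** M)"
proof -
  let ?b = "mat_norm (conj_transpose M ** M)"
  have "mat_norm M \<le> sqrt ?b"
  proof (rule mat_norm_le)
    fix x
    have "complex_of_real ((norm (M *v x))\<^sup>2) = hinner x ((conj_transpose M ** M) *v x)"
      unfolding hinner_self[symmetric] by (simp add: conj_transpose_hinner' matrix_vector_mul_assoc)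
    then have "(norm (M *v x))\<^sup>2 = cmod (hinner x ((conj_transpose M ** M) *v x))"
      by (metis abs_of_nonneg norm_of_real zero_le_power2)
    also have "\<dots> \<le> ?b * (norm x)\<^sup>2"
      using norm_quad_form_le[of "conj_transpose M ** M" x] by (simp add: quad_form_hinner)
    also have "\<dots> = (sqrt ?b * norm x)\<^sup>2" by (simp add: power_mult_distrib)
    finally show "norm (M *v x) \<le> sqrt ?b * norm x"
      by (rule power2_le_imp_le) simp
  qed
  then show ?thesis
    using mat_norm_nonneg[of M] by (simp add: real_le_rsqrt sqrt_ge_absD)
qed

lemma norm_entry_le: "cmod (M $ i $ j) \<le> mat_norm M"
proof -
  have "cmod (M $ i $ j) = cmod ((M *v axis j 1) $ i)" by (simp add: matrix_vector_mult_def axis_def if_distrib sum.delta cong: if_cong)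
  also have "\<dots> \<le> norm (M *v axis j 1)" by (rule Finite_Cartesian_Product.norm_nth_le)
  also have "\<dots> \<le> mat_norm M" using mat_norm_bound[of M "axis j 1"] by simp
  finally show ?thesis .
qed

section \<open>Polynomials of a matrix\<close>

lemma poly_mat_altdef:
  assumes "degree p \<le> N"
  shows "poly_mat p A = (\<Sum>k\<le>N. mat (coeff p k) ** matrix_power A k)"
  unfolding poly_mat_def
  by (rule sum.mono_neutral_left) (use assms in \<open>auto simp: coeff_eq_0\<close>)

lemma mat_add: "mat (a + b) = mat a + (mat b :: complex^'n^'n)"
  by (simp add: mat_def vec_eq_iff)

lemma mat_mult: "mat (a * b) = mat a ** (mat b :: complex^'n^'n)"
  by (simp add: vec_eq_iff scaled_matrix_nth) (simp add: mat_def)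

lemma matrix_add_rdistrib: "(B + C) ** A = B ** A + C ** (A :: complex^'n^'n)"
  by (simp add: matrix_matrix_mult_def vec_eq_iff sum.distrib algebra_simps)

lemma matrix_mult_sum_right: "A ** (\<Sum>i\<in>I. f i) = (\<Sum>i\<in>I. A ** (f i :: complex^'n^'n))"
  by (induction I rule: infinite_finite_induct) (simp_all add: matrix_add_ldistrib)

lemma matrix_diff_ldistrib: "A ** (B - C) = A ** B - A ** (C :: complex^'n^'n)"
  by (simp add: matrix_matrix_mult_def vec_eq_iff sum_subtractf algebra_simps)

lemma matrix_diff_rdistrib: "(B - C) ** A = B ** A - C ** (A :: complex^'n^'n)"
  by (simp add: matrix_matrix_mult_def vec_eq_iff sum_subtractf algebra_simps)

lemma poly_mat_0 [simp]: "poly_mat 0 A = 0"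
  by (simp add: poly_mat_def)

lemma poly_mat_pCons: "poly_mat (pCons a p) A = mat a + A ** poly_mat p A"
proof -
  have "poly_mat (pCons a p) A = (\<Sum>k\<le>Suc (degree p). mat (coeff (pCons a p) k) ** matrix_power A k)"
    by (rule poly_mat_altdef) (simp add: degree_pCons_le)
  also have "\<dots> = mat a + (\<Sum>k\<le>degree p. mat (coeff p k) ** (A ** matrix_power A k))"
    by (simp add: sum.atMost_Suc_shift del: sum.atMost_Suc)
  also have "(\<Sum>k\<le>degree p. mat (coeff p k) ** (A ** matrix_power A k))
      = (\<Sum>k\<le>degree p. A ** (mat (coeff p k) ** matrix_power A k))"
    by (intro sum.cong refl) (metis matrix_mul_assoc mat_scale_commute)
  also have "\<dots> = A ** poly_mat p A"
    unfolding poly_mat_def by (simp add: matrix_mult_sum_right)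
  finally show ?thesis .
qed

lemma poly_mat_1 [simp]: "poly_mat 1 A = mat 1"
  by (simp add: one_pCons poly_mat_pCons)

lemma poly_mat_add: "poly_mat (p + q) A = poly_mat p A + poly_mat q A"
proof (induction p arbitrary: q)
  case (pCons a p)
  show ?case by (cases q) (simp add: poly_mat_pCons pCons mat_add matrix_add_ldistrib)
qed simp

lemma poly_mat_smult: "poly_mat (smult c p) A = mat c ** poly_mat p A"
  by (induction p)
    (simp_all add: poly_mat_pCons mat_mult matrix_add_ldistrib matrix_mul_assoc mat_scale_commute[of A])

lemma poly_mat_minus: "poly_mat (- p) A = - poly_mat p A"
proof -
  have "poly_mat (- p) A + poly_mat p A = 0" by (simp flip: poly_mat_add)
  then show ?thesis by (simp add: eq_neg_iff_add_eq_0)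
qed

lemma poly_mat_diff: "poly_mat (p - q) A = poly_mat p A - poly_mat q A"
  using poly_mat_add[of p "- q" A] by (simp add: poly_mat_minus)

lemma poly_mat_mult: "poly_mat (p * q) A = poly_mat p A ** poly_mat q A"
  by (induction p)
    (simp_all add: poly_mat_pCons poly_mat_add poly_mat_smult matrix_add_rdistrib matrix_mul_assoc)

lemma poly_mat_sum: "poly_mat (\<Sum>i\<in>I. f i) A = (\<Sum>i\<in>I. poly_mat (f i) A)"
  by (induction I rule: infinite_finite_induct) (simp_all add: poly_mat_add)

lemma poly_mat_commute: "poly_mat p A ** poly_mat q A = poly_mat q A ** poly_mat p A"
  by (simp add: mult.commute flip: poly_mat_mult)

lemma poly_mat_linear: "poly_mat [:- z, 1:] A = A - mat z"
  by (simp add: poly_mat_pCons) (simp add: mat_def vec_eq_iff)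

lemma poly_mat_eigenvector:
  assumes "A *v x = z *s x"
  shows "poly_mat p A *v x = poly p z *s x"
proof (induction p)
  case (pCons a p)
  have "poly_mat (pCons a p) A *v x = a *s x + A *v (poly_mat p A *v x)"
    by (simp add: poly_mat_pCons mat_vector_mult matrix_vector_mult_add_rdistrib matrix_vector_mul_assoc)
  also have "\<dots> = a *s x + (poly p z * z) *s x"
    by (simp add: pCons vector_scale_commute assms)
  finally show ?case by (simp add: vector_sadd_rdistrib mult.commute)
qed (simp add: vec_eq_iff)

section \<open>The minimal polynomial\<close>

lemma poly_mat_monom: "poly_mat (monom c k) A = mat c ** matrix_power A k"
proof (induction k)
  case (Suc k)
  then show ?case
    by (simp add: monom_Suc poly_mat_pCons) (metis matrix_mul_assoc mat_scale_commute)
qed (simp add: monom_0 poly_mat_pCons)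

lemma mat_of_real_mult: "mat (complex_of_real r) ** M = r *\<^sub>R M"
  by (simp add: vec_eq_iff scaled_matrix_nth) (simp add: scaleR_conv_of_real)

text \<open>Counting over the reals: the powers with exponents up to the real dimension N of the
  matrix space are N + 1 matrices, hence linearly dependent unless two of them coincide. In the
  latter case a difference of two monomials annihilates A.\<close>

lemma ex_annihilating_poly: "\<exists>p. p \<noteq> 0 \<and> poly_mat p (A :: complex^'n^'n) = 0"
proof -
  define N where "N = DIM(complex^'n^'n)"
  define f where "f = matrix_power A"
  show ?thesis
  proof (cases "inj_on f {..N}")
    case True
    then have "card (f ` {..N}) > DIM(complex^'n^'n)" by (simp add: card_image N_def)
    then have "dependent (f ` {..N})" by (intro dependent_biggerset) simp
    then obtain u where u: "\<exists>v\<in>f ` {..N}. u v \<noteq> 0" "(\<Sum>v\<in>f ` {..N}. u v *\<^sub>R v) = 0"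
      by (subst (asm) dependent_finite) auto
    define p where "p = (\<Sum>k\<le>N. monom (complex_of_real (u (f k))) k)"
    have "poly_mat p A = (\<Sum>k\<le>N. u (f k) *\<^sub>R f k)"
      by (simp add: p_def poly_mat_sum poly_mat_monom mat_of_real_mult flip: f_def)
    also have "\<dots> = 0" using u(2) by (simp add: sum.reindex[OF True])
    finally have "poly_mat p A = 0" .
    moreover have "p \<noteq> 0"
    proof -
      obtain k where k: "k \<le> N" "u (f k) \<noteq> 0" using u(1) by auto
      then have "coeff p k = of_real (u (f k))"
        by (simp add: p_def coeff_sum sum.delta' if_distrib cong: if_cong)
      with k show ?thesis by (metis coeff_0 of_real_eq_0_iff)
    qed
    ultimately show ?thesis by blast
  next
    case False
    then obtain k l where kl: "k \<noteq> l" "f k = f l" by (auto simp: inj_on_def)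
    have "poly_mat (monom 1 k - monom 1 l) A = 0"
      using kl by (simp add: poly_mat_diff poly_mat_monom flip: f_def)
    moreover have "monom 1 k - monom 1 l \<noteq> (0 :: complex poly)"
      using kl(1) by (simp add: monom_eq_iff' )
    ultimately show ?thesis by blast
  qed
qed

text \<open>Justifies the definite description. An annihilator of least degree is normalised; two
  monic ones of that degree differ by an annihilator of smaller degree, which must be 0.\<close>

lemma minimal_poly_spec:
  fixes A :: "complex^'n^'n"
  shows "lead_coeff (minimal_poly A) = 1 \<and> poly_mat (minimal_poly A) A = 0 \<and>
     (\<forall>q. q \<noteq> 0 \<and> poly_mat q A = 0 \<longrightarrow> degree (minimal_poly A) \<le> degree q)"
  unfolding minimal_poly_def
proof (rule theI')
  obtain p where p: "p \<noteq> 0" "poly_mat p A = 0"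
    and min: "\<And>q. q \<noteq> 0 \<and> poly_mat q A = 0 \<Longrightarrow> degree p \<le> degree q"
    using ex_has_least_nat[of "\<lambda>p. p \<noteq> 0 \<and> poly_mat p A = 0" _ degree] ex_annihilating_poly[of A]
    by blast
  define p' where "p' = smult (inverse (lead_coeff p)) p"
  have p': "lead_coeff p' = 1" "poly_mat p' A = 0" "degree p' = degree p"
    using p by (simp_all add: p'_def poly_mat_smult)
  show "\<exists>!p. lead_coeff p = 1 \<and> poly_mat p A = 0 \<and>
     (\<forall>q. q \<noteq> 0 \<and> poly_mat q A = 0 \<longrightarrow> degree p \<le> degree q)"
  proof (rule ex1I[of _ p'])
    show "lead_coeff p' = 1 \<and> poly_mat p' A = 0 \<and>
       (\<forall>q. q \<noteq> 0 \<and> poly_mat q A = 0 \<longrightarrow> degree p' \<le> degree q)"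
      using p' min by auto
    fix r assume r: "lead_coeff r = 1 \<and> poly_mat r A = 0 \<and>
       (\<forall>q. q \<noteq> 0 \<and> poly_mat q A = 0 \<longrightarrow> degree r \<le> degree q)"
    show "r = p'"
    proof (rule ccontr)
      assume neq: "r \<noteq> p'"
      have "r \<noteq> 0" "p' \<noteq> 0" using r p' by auto
      then have deg: "degree r = degree p'"
        using r p' min by (metis order_antisym)
      have "poly_mat (r - p') A = 0" using r p' by (simp add: poly_mat_diff)
      moreover have "degree (r - p') < degree p'"
      proof -
        have "degree (r - p') \<le> degree p'" by (intro degree_diff_le) (simp_all add: deg)
        moreover have "coeff (r - p') (degree p') = 0" using deg r p' by simp
        moreover have "coeff (r - p') (degree (r - p')) \<noteq> 0"
          using neq by (simp del: coeff_diff)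
        ultimately show ?thesis by (cases "degree (r - p') = degree p'") auto
      qed
      ultimately show False using min[of "r - p'"] p'(3) neq by auto
    qed
  qed
qed

lemma minimal_poly_nonzero: "minimal_poly A \<noteq> 0"
  using minimal_poly_spec[of A] by auto

lemma poly_mat_minimal_poly [simp]: "poly_mat (minimal_poly A) A = 0"
  using minimal_poly_spec[of A] by auto

lemma poly_mat_neq_0: "q \<noteq> 0 \<Longrightarrow> degree q < degree (minimal_poly A) \<Longrightarrow> poly_mat q A \<noteq> 0"
  using minimal_poly_spec[of A] by (meson not_le)

lemma ex_vector_mult_neq_0: "M \<noteq> 0 \<Longrightarrow> \<exists>x. M *v x \<noteq> (0 :: complex^'n)"
  by (metis matrix_eq matrix_vector_mult_0)

lemma poly_mat_eq_0_iff: "poly_mat q A = 0 \<longleftrightarrow> minimal_poly A dvd q"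
proof
  assume q: "poly_mat q A = 0"
  let ?m = "minimal_poly A"
  have "poly_mat (q mod ?m) A = 0"
    using q by (simp add: minus_div_mult_eq_mod [symmetric] poly_mat_diff poly_mat_mult)
  moreover have "q mod ?m = 0 \<or> degree (q mod ?m) < degree ?m"
    by (rule degree_mod_less) (rule minimal_poly_nonzero)
  ultimately have "q mod ?m = 0"
    using minimal_poly_spec[of A] by (meson not_less)
  then show "?m dvd q" by (simp add: dvd_eq_mod_eq_0)
qed (auto simp: poly_mat_mult)

text \<open>For a root z, split off its linear factor. The cofactor q has smaller degree, so q(A) is
  nonzero by minimality, and every nonzero vector in its range is an eigenvector for z.\<close>

lemma mat_spectrum_iff: "z \<in> mat_spectrum A \<longleftrightarrow> poly (minimal_poly A) z = 0"
proof
  assume "z \<in> mat_spectrum A"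
  then obtain x where x: "x \<noteq> 0" "A *v x = z *s x" by (auto simp: mat_spectrum_def)
  have "poly (minimal_poly A) z *s x = 0"
    using poly_mat_eigenvector[OF x(2), of "minimal_poly A"] by simp
  then show "poly (minimal_poly A) z = 0" using x(1) by (simp add: vector_mul_eq_0)
next
  assume "poly (minimal_poly A) z = 0"
  then obtain q where q: "minimal_poly A = [:-z, 1:] * q" by (auto simp: poly_eq_0_iff_dvd)
  have "q \<noteq> 0" using minimal_poly_nonzero[of A] q by auto
  then have "degree (minimal_poly A) = Suc (degree q)"
    unfolding q by (subst degree_mult_eq) auto
  then have "degree q < degree (minimal_poly A)" by linarith
  then obtain x where x: "poly_mat q A *v x \<noteq> 0"
    using ex_vector_mult_neq_0[OF poly_mat_neq_0[OF \<open>q \<noteq> 0\<close>]] by blast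
  have "poly_mat [:-z, 1:] A *v (poly_mat q A *v x) = 0"
    by (simp only: matrix_vector_mul_assoc flip: poly_mat_mult q) simp
  then have "A *v (poly_mat q A *v x) = z *s (poly_mat q A *v x)"
    by (simp add: poly_mat_linear matrix_vector_mult_diff_rdistrib mat_vector_mult)
  with x show "z \<in> mat_spectrum A" by (auto simp: mat_spectrum_def)
qed

section \<open>Factorization of the minimal polynomial over the spectrum\<close>

lemma finite_mat_spectrum [simp]: "finite (mat_spectrum A)"
proof -
  have "mat_spectrum A = {z. poly (minimal_poly A) z = 0}" by (auto simp: mat_spectrum_iff)
  then show ?thesis using poly_roots_finite[OF minimal_poly_nonzero[of A]] by simp
qed

lemma linear_poly_coprime: "z \<noteq> w \<Longrightarrow> coprime [:- z, 1:] [:- w, 1 :: complex:]"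
proof (rule coprimeI)
  fix c assume "z \<noteq> w" "c dvd [:- z, 1:]" "c dvd [:- w, 1:]"
  then have "c dvd [:- w, 1:] - [:- z, 1:]" by (rule_tac dvd_diff)
  then have "c dvd [:z - w:]" by simp
  moreover have "[:z - w:] dvd 1" using \<open>z \<noteq> w\<close> by (simp add: is_unit_pCons_iff)
  ultimately show "c dvd 1" by (rule dvd_trans)
qed

lemma prod_linear_powers_dvd:
  fixes q :: "complex poly"
  assumes "finite S" "\<And>z. z \<in> S \<Longrightarrow> [:- z, 1:] ^ n z dvd q"
  shows "(\<Prod>z\<in>S. [:- z, 1:] ^ n z) dvd q"
  using assms
proof (induction S rule: finite_induct)
  case (insert z S)
  have "coprime ([:- z, 1:] ^ n z) (\<Prod>w\<in>S. [:- w, 1:] ^ n w)"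
  proof (rule prod_coprime_right)
    fix w assume "w \<in> S"
    then have "z \<noteq> w" using insert.hyps by auto
    then show "coprime ([:- z, 1:] ^ n z) ([:- w, 1:] ^ n w)"
      by (intro coprime_power_left_iff[THEN iffD2] coprime_power_right_iff[THEN iffD2] disjI1 linear_poly_coprime)
  qed
  then show ?case using insert by (simp add: divides_mult)
qed simp

lemma minimal_poly_decompose:
  "minimal_poly A = (\<Prod>z\<in>mat_spectrum A. [:- z, 1:] ^ eigenvalue_index A z)"
proof -
  have "mat_spectrum A = {z. poly (minimal_poly A) z = 0}" by (auto simp: mat_spectrum_iff)
  then show ?thesis
    using complex_poly_decompose[of "minimal_poly A"] minimal_poly_spec[of A]
    by (simp add: eigenvalue_index_def)
qed

section \<open>Hermite interpolation\<close>

lemma linear_power_dvd_higher_pderiv: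
  fixes p :: "complex poly"
  shows "[:- z, 1:] ^ (k + j) dvd p \<Longrightarrow> [:- z, 1:] ^ k dvd (pderiv ^^ j) p"
proof (induction j arbitrary: p)
  case (Suc j)
  from Suc.prems obtain q where p: "p = [:- z, 1:] ^ Suc (k + j) * q"
    unfolding add_Suc_right by (rule dvdE)
  then have "[:- z, 1:] ^ (k + j) dvd pderiv p"
    unfolding p pderiv_mult[of "_ ^ _"] pderiv_power_Suc
    by (intro dvd_add dvd_mult[of _ _ q] dvd_mult2[of _ _ "pderiv _"] dvd_smult dvd_refl
        dvd_mult2[OF le_imp_power_dvd]) simp
  then have "[:- z, 1:] ^ k dvd (pderiv ^^ j) (pderiv p)" by (rule Suc.IH)
  then show ?case by (simp add: funpow_swap1)
qed simp

lemma higher_pderiv_linear_power_mult: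
  "poly ((pderiv ^^ k) ([:- z, 1:] ^ k * q)) z = fact k * poly q (z :: complex)"
proof (induction k arbitrary: q)
  case (Suc k)
  have "pderiv ([:- z, 1:] ^ Suc k * q)
      = [:- z, 1:] ^ k * (smult (of_nat (Suc k)) q + [:- z, 1:] * pderiv q)"
    by (simp only: pderiv_mult pderiv_power_Suc) (simp add: pderiv_pCons algebra_simps)
  then show ?case
    by (simp only: funpow_Suc_right o_apply Suc.IH) (simp add: algebra_simps)
qed simp

lemma higher_pderiv_zero_iff:
  "(\<forall>j<k. poly ((pderiv ^^ j) p) z = 0) \<longleftrightarrow> [:- z, 1:] ^ k dvd (p :: complex poly)"
proof
  assume dvd: "[:- z, 1:] ^ k dvd p"
  show "\<forall>j<k. poly ((pderiv ^^ j) p) z = 0"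
  proof safe
    fix j assume "j < k"
    then have "[:- z, 1:] ^ (1 + j) dvd p"
      by (intro dvd_trans[OF le_imp_power_dvd dvd]) simp
    then have "[:- z, 1:] ^ 1 dvd (pderiv ^^ j) p" by (rule linear_power_dvd_higher_pderiv)
    then show "poly ((pderiv ^^ j) p) z = 0" by (simp add: poly_eq_0_iff_dvd)
  qed
next
  show "\<forall>j<k. poly ((pderiv ^^ j) p) z = 0 \<Longrightarrow> [:- z, 1:] ^ k dvd p"
  proof (induction k)
    case (Suc k)
    then obtain q where q: "p = [:- z, 1:] ^ k * q" by auto
    then have "poly q z = 0" using Suc.prems higher_pderiv_linear_power_mult[of k z q] by auto
    then show ?case
      unfolding q power_Suc2 by (intro mult_dvd_mono dvd_refl) (simp add: poly_eq_0_iff_dvd)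
  qed simp
qed

lemma higher_pderiv_diff: "(pderiv ^^ n) (p - q) = (pderiv ^^ n) p - (pderiv ^^ n) (q :: complex poly)"
  by (induction n arbitrary: p q) (simp_all add: pderiv_diff del: funpow.simps add: funpow_Suc_right)

text \<open>Induction on the number of prescribed derivatives. The correction term
  \<open>smult a ([:- z, 1:] ^ k * U)\<close> leaves the derivatives below order k at z unchanged,
  adjusts the one of order k by a k! U(z), and keeps the zeros on S because U has them.\<close>

lemma ex_poly_local_jet:
  fixes c :: "nat \<Rightarrow> complex"
  assumes "finite S" "z \<notin> S"
  shows "\<exists>p. (\<forall>j<k. poly ((pderiv ^^ j) p) z = c j) \<and> (\<forall>w\<in>S. [:- w, 1:] ^ n w dvd p)"
proof (induction k)
  case 0
  show ?case by (rule exI[of _ 0]) simp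
next
  case (Suc k)
  then obtain p where p: "\<And>j. j < k \<Longrightarrow> poly ((pderiv ^^ j) p) z = c j"
    "\<And>w. w \<in> S \<Longrightarrow> [:- w, 1:] ^ n w dvd p" by blast
  define U where "U = (\<Prod>w\<in>S. [:- w, 1:] ^ n w)"
  have U: "poly U z \<noteq> 0" using assms by (auto simp: U_def poly_prod prod_zero_iff)
  define a where "a = (c k - poly ((pderiv ^^ k) p) z) / (fact k * poly U z)"
  let ?p = "p + smult a ([:- z, 1:] ^ k * U)"
  have "poly ((pderiv ^^ j) ?p) z = c j" if "j < Suc k" for j
  proof (cases "j = k")
    case True
    then show ?thesis using U
      by (simp add: higher_pderiv_add higher_pderiv_smult higher_pderiv_linear_power_mult a_def)
  next
    case False
    then have "poly ((pderiv ^^ j) ([:- z, 1:] ^ k * U)) z = 0"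
      using higher_pderiv_zero_iff[of k "[:- z, 1:] ^ k * U" z] that by simp
    then show ?thesis using p(1)[of j] False that
      by (simp add: higher_pderiv_add higher_pderiv_smult)
  qed
  moreover have "[:- w, 1:] ^ n w dvd ?p" if "w \<in> S" for w
  proof -
    have "[:- w, 1:] ^ n w dvd U" unfolding U_def using assms that by (intro dvd_prodI) auto
    then show ?thesis using p(2)[OF that] by (intro dvd_add dvd_smult dvd_mult) auto
  qed
  ultimately show ?case by blast
qed

text \<open>The local solutions can simply be added, since the one for z vanishes to order
  \<open>n w\<close> at every other node w.\<close>

lemma ex_hermite_interpolant:
  fixes c :: "complex \<Rightarrow> nat \<Rightarrow> complex"
  assumes "finite S"
  shows "\<exists>p. \<forall>z\<in>S. \<forall>j<n z. poly ((pderiv ^^ j) p) z = c z j"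
proof -
  have "\<exists>p. (\<forall>j<n z. poly ((pderiv ^^ j) p) z = c z j) \<and> (\<forall>w\<in>S - {z}. [:- w, 1:] ^ n w dvd p)" for z
    by (rule ex_poly_local_jet) (use assms in auto)
  then obtain p where p: "\<And>z j. j < n z \<Longrightarrow> poly ((pderiv ^^ j) (p z)) z = c z j"
    "\<And>z w. w \<in> S - {z} \<Longrightarrow> [:- w, 1:] ^ n w dvd p z" by metis
  have "poly ((pderiv ^^ j) (\<Sum>w\<in>S. p w)) z = c z j" if "z \<in> S" "j < n z" for z j
  proof -
    have "poly ((pderiv ^^ j) (\<Sum>w\<in>S. p w)) z = (\<Sum>w\<in>S. poly ((pderiv ^^ j) (p w)) z)"
      by (simp add: higher_pderiv_sum poly_sum)
    also have "\<dots> = (\<Sum>w\<in>S. if w = z then c z j else 0)"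
      using that p by (intro sum.cong refl) (auto simp: higher_pderiv_zero_iff[symmetric])
    finally show ?thesis using that assms by simp
  qed
  then show ?thesis by blast
qed

lemma minimal_poly_dvd_diff_of_same_jets:
  assumes "\<And>z j. z \<in> mat_spectrum A \<Longrightarrow> j < eigenvalue_index A z \<Longrightarrow>
    poly ((pderiv ^^ j) p) z = poly ((pderiv ^^ j) q) z"
  shows "minimal_poly A dvd p - q"
  unfolding minimal_poly_decompose
proof (rule prod_linear_powers_dvd)
  fix z assume "z \<in> mat_spectrum A"
  then show "[:- z, 1:] ^ eigenvalue_index A z dvd p - q"
    using assms by (subst higher_pderiv_zero_iff[symmetric]) (simp add: higher_pderiv_diff)
qed simp

lemma degree_minimal_poly_pos: "degree (minimal_poly A) > 0"
proof (rule ccontr)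
  let ?m = "minimal_poly A"
  assume "\<not> degree ?m > 0"
  then have "degree ?m = 0" unfolding not_gr_zero .
  then obtain c where c: "?m = [:c:]" by (rule degree_eq_zeroE)
  have "c = 1" using minimal_poly_spec[of A] unfolding c by simp
  then have "?m = 1" unfolding c by (simp add: pCons_one)
  then have "poly_mat 1 A = 0" using poly_mat_minimal_poly[of A] by metis
  then show False by (simp add: vec_eq_iff mat_def split: if_splits)
qed

text \<open>An arbitrary interpolant is reduced modulo the minimal polynomial, which vanishes to the
  order of the index at each eigenvalue. Two solutions differ by a multiple of the minimal
  polynomial of smaller degree, so the description in \<open>hermite_poly\<close> is
  legitimate.\<close>

lemma hermite_poly_interpolates: "interpolates_on_spectrum (hermite_poly f A) f A"
proof -
  let ?m = "minimal_poly A"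
  have deg: "degree ?m > 0" by (rule degree_minimal_poly_pos)
  from ex_hermite_interpolant[OF finite_mat_spectrum, where n = "eigenvalue_index A"
      and c = "\<lambda>z j. (deriv ^^ j) f z"]
  obtain q where q: "\<forall>z\<in>mat_spectrum A. \<forall>j<eigenvalue_index A z.
      poly ((pderiv ^^ j) q) z = (deriv ^^ j) f z" ..
  define p where "p = q mod ?m"
  have "\<exists>!p. degree p < degree ?m \<and> interpolates_on_spectrum p f A"
  proof (rule ex1I[of _ p])
    have "poly ((pderiv ^^ j) p) z = poly ((pderiv ^^ j) q) z"
      if "z \<in> mat_spectrum A" "j < eigenvalue_index A z" for z j
    proof -
      have "[:- z, 1:] ^ eigenvalue_index A z dvd ?m"
        unfolding eigenvalue_index_def by (rule order_1)
      also have "?m dvd q - p" unfolding p_def by (simp add: minus_mod_eq_mult_div)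
      finally have "\<forall>j<eigenvalue_index A z. poly ((pderiv ^^ j) (q - p)) z = 0"
        by (subst higher_pderiv_zero_iff)
      then show ?thesis using that by (simp add: higher_pderiv_diff)
    qed
    moreover have "degree p < degree ?m"
      using degree_mod_less[OF minimal_poly_nonzero, of q A] deg by (auto simp: p_def)
    ultimately show "degree p < degree ?m \<and> interpolates_on_spectrum p f A"
      using q by (simp add: interpolates_on_spectrum_def)
    fix r assume r: "degree r < degree ?m \<and> interpolates_on_spectrum r f A"
    have "?m dvd r - p"
      using r \<open>degree p < degree ?m \<and> interpolates_on_spectrum p f A\<close>
      by (intro minimal_poly_dvd_diff_of_same_jets) (simp add: interpolates_on_spectrum_def)
    moreover have "degree (r - p) < degree ?m"
      using r \<open>degree p < degree ?m\<close> by (intro degree_diff_less) auto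
    ultimately have "r - p = 0"
      using dvd_imp_degree_le[of ?m "r - p"] by linarith
    then show "r = p" by simp
  qed
  from theI'[OF this] show ?thesis by (simp add: hermite_poly_def)
qed

section \<open>Convergence of matrix polynomials from convergence of jets\<close>

lemma mat_norm_0 [simp]: "mat_norm 0 = 0"
  by (rule antisym[OF mat_norm_le]) auto

lemma mat_norm_sum: "mat_norm (\<Sum>i\<in>I. f i) \<le> (\<Sum>i\<in>I. mat_norm (f i))"
  by (induction I rule: infinite_finite_induct)
    (auto intro: order_trans[OF mat_norm_add])

text \<open>Modulo the minimal polynomial, \<open>r s\<close> is the combination of the finitely
  many Hermite basis polynomials \<open>h z j\<close> whose coefficients are its jets on the
  spectrum. Hence its value at A depends linearly on these jets.\<close>

lemma poly_mat_tendsto_zero: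
  assumes "\<And>z j. z \<in> mat_spectrum A \<Longrightarrow> j < eigenvalue_index A z \<Longrightarrow>
    (\<lambda>s. poly ((pderiv ^^ j) (r s)) z) \<longlonglongrightarrow> 0"
  shows "(\<lambda>s. mat_norm (poly_mat (r s) A)) \<longlonglongrightarrow> 0"
proof -
  let ?S = "mat_spectrum A" and ?n = "eigenvalue_index A"
  have "\<exists>p. \<forall>w\<in>?S. \<forall>i<?n w. poly ((pderiv ^^ i) p) w = (if w = z \<and> i = j then 1 else 0)" for z j
    by (rule ex_hermite_interpolant) simp
  then obtain h where h: "\<And>z j w i. w \<in> ?S \<Longrightarrow> i < ?n w \<Longrightarrow>
      poly ((pderiv ^^ i) (h z j)) w = (if w = z \<and> i = j then 1 else 0)"
    by metis
  define q where "q s = (\<Sum>z\<in>?S. \<Sum>j<?n z. smult (poly ((pderiv ^^ j) (r s)) z) (h z j))" for s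
  have "minimal_poly A dvd r s - q s" for s
  proof (rule minimal_poly_dvd_diff_of_same_jets)
    fix w i assume w: "w \<in> ?S" "i < ?n w"
    have "poly ((pderiv ^^ i) (q s)) w
        = (\<Sum>z\<in>?S. \<Sum>j<?n z. if w = z then if i = j then poly ((pderiv ^^ j) (r s)) z else 0 else 0)"
      using w by (simp add: q_def higher_pderiv_sum higher_pderiv_smult poly_sum h cong: if_cong)
        (auto intro!: sum.cong)
    also have "\<dots> = (\<Sum>z\<in>?S. if w = z then \<Sum>j<?n z. if i = j then poly ((pderiv ^^ j) (r s)) z else 0 else 0)"
      by (intro sum.cong) auto
    also have "\<dots> = poly ((pderiv ^^ i) (r s)) w"
      using w by (simp add: sum.delta' sum.delta cong: if_cong)
    finally show "poly ((pderiv ^^ i) (r s)) w = poly ((pderiv ^^ i) (q s)) w" by simp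
  qed
  then have eq: "poly_mat (r s) A = poly_mat (q s) A" for s
    using poly_mat_eq_0_iff[of "r s - q s" A] by (simp add: poly_mat_diff)
  have le: "mat_norm (poly_mat (r s) A) \<le>
      (\<Sum>z\<in>?S. \<Sum>j<?n z. cmod (poly ((pderiv ^^ j) (r s)) z) * mat_norm (poly_mat (h z j) A))" for s
    unfolding eq q_def poly_mat_sum poly_mat_smult
    by (rule order_trans[OF mat_norm_sum] sum_mono mat_norm_scale_le)+
  have "(\<lambda>s. \<Sum>z\<in>?S. \<Sum>j<?n z. cmod (poly ((pderiv ^^ j) (r s)) z) * mat_norm (poly_mat (h z j) A))
      \<longlonglongrightarrow> (\<Sum>z\<in>?S. \<Sum>j<?n z. 0)"
    using assms by (intro tendsto_sum tendsto_mult_left_zero tendsto_norm_zero) auto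
  then have lim: "(\<lambda>s. \<Sum>z\<in>?S. \<Sum>j<?n z. cmod (poly ((pderiv ^^ j) (r s)) z) * mat_norm (poly_mat (h z j) A))
      \<longlonglongrightarrow> 0" by simp
  show ?thesis
    by (rule Lim_null_comparison[OF _ lim]) (rule always_eventually, use le in simp)
qed

section \<open>The trace and the spectral radius\<close>

text \<open>The quotient of the two lowest coefficients is minus the sum of the inverse roots, each
  of modulus at most \<rho>. The form of the hypothesis also excludes the root 0.\<close>

lemma norm_coeff_1_le:
  fixes p :: "complex poly"
  assumes "\<And>z. poly p z = 0 \<Longrightarrow> 1 \<le> \<rho> * cmod z" "0 \<le> \<rho>"
  shows "cmod (coeff p 1) \<le> real (degree p) * \<rho> * cmod (coeff p 0)"
  using assms(1)
proof (induction "degree p" arbitrary: p)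
  case 0
  then have "coeff p 1 = 0" by (intro coeff_eq_0) simp
  then show ?case using 0 by simp
next
  case (Suc n)
  have "\<not> constant (poly p)" using Suc.hyps(2) by (simp add: constant_degree)
  then obtain z where z: "poly p z = 0" using fundamental_theorem_of_algebra by blast
  then obtain q where q: "p = [:- z, 1:] * q" unfolding poly_eq_0_iff_dvd by (rule dvdE)
  have "q \<noteq> 0" using Suc.hyps(2) q by auto
  then have deg: "degree p = Suc (degree q)" unfolding q by (subst degree_mult_eq) auto
  have root: "\<And>w. poly q w = 0 \<Longrightarrow> 1 \<le> \<rho> * cmod w" using Suc.prems unfolding q by simp
  have IH: "cmod (coeff q 1) \<le> real (degree q) * \<rho> * cmod (coeff q 0)"
    using Suc.hyps(2) deg by (intro Suc.hyps(1) root) simp_all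
  have c0: "coeff p 0 = - z * coeff q 0" and c1: "coeff p 1 = coeff q 0 - z * coeff q 1"
    unfolding q by (simp_all add: coeff_pCons)
  have "cmod (coeff p 1) \<le> cmod (coeff q 0) + cmod z * cmod (coeff q 1)"
    unfolding c1 by (metis norm_triangle_ineq4 norm_mult)
  also have "\<dots> \<le> (\<rho> * cmod z) * cmod (coeff q 0) + cmod z * (real (degree q) * \<rho> * cmod (coeff q 0))"
    using mult_right_mono[OF Suc.prems[OF z] norm_ge_zero[of "coeff q 0"]]
      mult_left_mono[OF IH norm_ge_zero[of z]] by simp
  also have "\<dots> = real (degree p) * \<rho> * cmod (coeff p 0)"
    unfolding deg c0 by (simp add: norm_mult algebra_simps)
  finally show ?case .
qed

text \<open>The roots of \<open>det (1 + z M)\<close> are the numbers \<open>-1/\<lambda>\<close> for the nonzero eigenvalues \<open>\<lambda>\<close>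
  of \<open>M\<close>, and its linear coefficient is the trace.\<close>

definition reversed_char_poly :: "complex^'n^'n \<Rightarrow> complex poly" where
  "reversed_char_poly M = det (\<chi> i j. [:if i = j then 1 else 0, M $ i $ j:])"

lemma poly_reversed_char_poly: "poly (reversed_char_poly M) z = det (mat 1 + mat z ** M)"
proof -
  have "poly (of_int k) z = of_int k" for k
    by (simp add: of_int_poly)
  then show ?thesis
    by (simp add: reversed_char_poly_def det_def poly_sum poly_prod scaled_matrix_nth)
       (simp add: mat_def)
qed

lemma degree_reversed_char_poly: "degree (reversed_char_poly (M :: complex^'n^'n)) \<le> CARD('n)"
  unfolding reversed_char_poly_def det_def
proof (rule degree_sum_le)
  show "finite {p. p permutes (UNIV :: 'n set)}" by simp
  fix p :: "'n \<Rightarrow> 'n"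
  let ?X = "\<lambda>i j. [:if i = j then 1 else 0, M $ i $ j:]"
  have "degree (\<Prod>i\<in>UNIV. ?X i (p i)) \<le> (\<Sum>i\<in>UNIV. degree (?X i (p i)))"
    using degree_prod_sum_le[of UNIV "\<lambda>i. ?X i (p i)"] by (simp add: o_def)
  also have "\<dots> \<le> (\<Sum>i\<in>(UNIV :: 'n set). 1)"
    by (intro sum_mono) simp
  finally have "degree (\<Prod>i\<in>UNIV. ?X i (p i)) \<le> CARD('n)" by simp
  moreover have "degree (of_int (sign p) * (\<Prod>i\<in>UNIV. ?X i (p i))) \<le> degree (\<Prod>i\<in>UNIV. ?X i (p i))"
    using degree_mult_le[of "of_int (sign p)" "\<Prod>i\<in>UNIV. ?X i (p i)"] by simp
  ultimately show "degree (of_int (sign p) *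
      (\<Prod>i\<in>UNIV. (\<chi> i j. ?X i j) $ i $ p i)) \<le> CARD('n)"
    by simp
qed

lemma coeff_0_reversed_char_poly: "coeff (reversed_char_poly M) 0 = 1"
  by (simp add: poly_0_coeff_0[symmetric] poly_reversed_char_poly det_I)

lemma permutes_fixing_all_but_one:
  assumes "p permutes UNIV" "\<And>i. i \<noteq> a \<Longrightarrow> p i = i"
  shows "p = id"
proof
  fix i
  show "p i = id i"
  proof (cases "i = a")
    case True
    have "p a = a"
    proof (rule ccontr)
      assume "p a \<noteq> a"
      then have "p (p a) = p a" by (rule assms(2))
      then show False using assms(1) \<open>p a \<noteq> a\<close> by (metis permutes_def)
    qed
    then show ?thesis using True by simp
  qed (simp add: assms(2))
qed

text \<open>Differentiating the Leibniz formula at 0 leaves one entry of M, in row a, and Kronecker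
  deltas in all other rows. A permutation that fixes every point but a is the identity, so only the
  diagonal entries survive.\<close>

lemma coeff_1_reversed_char_poly: "coeff (reversed_char_poly (M :: complex^'n^'n)) 1 = trace M"
proof -
  let ?X = "\<lambda>i j. [:if i = j then 1 else 0, M $ i $ j:]"
  have "coeff (reversed_char_poly M) 1 = poly (pderiv (reversed_char_poly M)) 0"
    by (simp add: poly_0_coeff_0 coeff_pderiv)
  also have "\<dots> = (\<Sum>p\<in>{p. p permutes (UNIV :: 'n set)}.
      of_int (sign p) * (\<Sum>a\<in>UNIV. (\<Prod>i\<in>UNIV - {a}. poly (?X i (p i)) 0) * M $ a $ p a))"
    by (simp add: reversed_char_poly_def det_def higher_pderiv_sum[where n = 1, simplified] pderiv_smult pderiv_prod poly_sum
        poly_prod pderiv_pCons of_int_poly pderiv_singleton mult.commute)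
  also have "\<dots> = (\<Sum>p\<in>{p. p permutes (UNIV :: 'n set)}. if p = id then trace M else 0)"
  proof (rule sum.cong)
    fix p :: "'n \<Rightarrow> 'n" assume p: "p \<in> {p. p permutes UNIV}"
    show "of_int (sign p) * (\<Sum>a\<in>UNIV. (\<Prod>i\<in>UNIV - {a}. poly (?X i (p i)) 0) * M $ a $ p a)
        = (if p = id then trace M else 0)"
    proof (cases "p = id")
      case True
      then show ?thesis by (simp add: sign_id trace_def)
    next
      case False
      have zero: "(\<Prod>i\<in>UNIV - {a}. poly (?X i (p i)) 0) = 0" for a
      proof -
        obtain i where "i \<noteq> a" "p i \<noteq> i"
          using False p permutes_fixing_all_but_one[of p a] by auto
        then show ?thesis by (intro prod_zero) (auto intro!: bexI[of _ i])
      qed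
      show ?thesis using False by (simp only: zero mult_zero_left mult_zero_right sum.neutral_const if_False)
    qed
  qed simp
  also have "\<dots> = trace M"
    by (simp add: sum.delta permutes_id finite_permutations)
  finally show ?thesis .
qed

lemma norm_trace_le:
  fixes M :: "complex^'n^'n"
  assumes "\<And>\<mu> x. x \<noteq> 0 \<Longrightarrow> M *v x = \<mu> *s x \<Longrightarrow> cmod \<mu> \<le> \<rho>" "0 \<le> \<rho>"
  shows "cmod (trace M) \<le> real CARD('n) * \<rho>"
proof -
  have "1 \<le> \<rho> * cmod z" if "poly (reversed_char_poly M) z = 0" for z
  proof -
    let ?B = "mat 1 + mat z ** M"
    have "det ?B = 0" using that by (simp add: poly_reversed_char_poly)
    then have "\<nexists>B. B ** ?B = mat 1" by (metis invertible_det_nz invertible_left_inverse)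
    then obtain x where x: "x \<noteq> 0" "?B *v x = 0" by (auto simp: matrix_left_invertible_ker)
    then have eq: "x + z *s (M *v x) = 0"
      by (simp add: matrix_vector_mult_add_rdistrib scaled_matrix_vector_mult)
    have z: "z \<noteq> 0" using eq x(1) by auto
    have "M *v x = (- 1 / z) *s x"
    proof -
      have "x = - (z *s (M *v x))" using eq by (simp add: add_eq_0_iff2)
      then have "(- 1 / z) *s x = (- 1 / z) *s (- (z *s (M *v x)))" by simp
      also have "\<dots> = M *v x" using z by (simp add: vec_eq_iff)
      finally show ?thesis by simp
    qed
    from assms(1)[OF x(1) this] show ?thesis using z by (simp add: norm_divide field_simps)
  qed
  from norm_coeff_1_le[of "reversed_char_poly M", OF this assms(2)]
  have "cmod (trace M) \<le> real (degree (reversed_char_poly M)) * \<rho>"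
    by (simp add: coeff_0_reversed_char_poly coeff_1_reversed_char_poly flip: One_nat_def)
  also have "\<dots> \<le> real CARD('n) * \<rho>"
    using degree_reversed_char_poly[of M] assms(2) by (intro mult_right_mono) auto
  finally show ?thesis .
qed

text \<open>Linear factors are stripped from an annihilator of x until the remaining factor r no
  longer kills x; then r(A) x is an eigenvector. The form r(A) x matters: if x is an eigenvector of
  a matrix that commutes with A, so is r(A) x, for the same eigenvalue.\<close>

lemma ex_cyclic_eigenvector:
  assumes "x \<noteq> 0"
  shows "\<exists>r z. poly_mat r A *v x \<noteq> 0 \<and> A *v (poly_mat r A *v x) = z *s (poly_mat r A *v x)"
proof -
  have "\<exists>r z. poly_mat r A *v x \<noteq> 0 \<and> A *v (poly_mat r A *v x) = z *s (poly_mat r A *v x)"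
    if "q \<noteq> 0" "poly_mat q A *v x = 0" for q
    using that
  proof (induction "degree q" arbitrary: q)
    case 0
    then obtain c where "q = [:c:]" by (metis degree_eq_zeroE)
    with 0 have "c \<noteq> 0" "c *s x = 0" by (auto simp: poly_mat_pCons mat_vector_mult)
    then show ?case using assms by (simp add: vector_mul_eq_0)
  next
    case (Suc n)
    have "\<not> constant (poly q)" using Suc.hyps(2) by (simp add: constant_degree)
    then obtain z where "poly q z = 0" using fundamental_theorem_of_algebra by blast
    then obtain r where r: "q = [:- z, 1:] * r" unfolding poly_eq_0_iff_dvd by (rule dvdE)
    show ?case
    proof (cases "poly_mat r A *v x = 0")
      case True
      have "r \<noteq> 0" using Suc.prems r by auto
      moreover have "degree q = Suc (degree r)"
        using \<open>r \<noteq> 0\<close> unfolding r by (subst degree_mult_eq) auto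
      ultimately show ?thesis using Suc.hyps True by simp
    next
      case False
      have "(A - mat z) *v (poly_mat r A *v x) = 0"
        using Suc.prems(2) unfolding r poly_mat_mult poly_mat_linear
        by (simp only: matrix_vector_mul_assoc)
      then have "A *v (poly_mat r A *v x) = z *s (poly_mat r A *v x)"
        by (simp add: matrix_vector_mult_diff_rdistrib mat_vector_mult)
      then show ?thesis using False by blast
    qed
  qed
  from this[OF minimal_poly_nonzero[of A]] show ?thesis by simp
qed

text \<open>The eigenvector r(A) x of A is still an eigenvector of p(A) for \<mu>, because r(A)
  commutes with p(A).\<close>

lemma eigenvalue_poly_mat:
  assumes "x \<noteq> 0" "poly_mat p A *v x = \<mu> *s x"
  shows "\<exists>z\<in>mat_spectrum A. poly p z = \<mu>"
proof -
  obtain r z where y: "poly_mat r A *v x \<noteq> 0" "A *v (poly_mat r A *v x) = z *s (poly_mat r A *v x)"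
    using ex_cyclic_eigenvector[OF assms(1)] by blast
  let ?y = "poly_mat r A *v x"
  have "poly p z *s ?y = poly_mat p A *v ?y"
    using poly_mat_eigenvector[OF y(2)] by simp
  also have "\<dots> = poly_mat r A *v (poly_mat p A *v x)"
    by (simp add: matrix_vector_mul_assoc poly_mat_commute[of p])
  also have "\<dots> = \<mu> *s ?y" by (simp add: assms(2) vector_scale_commute)
  finally have "poly p z = \<mu>" using y(1) by (simp add: vector_mul_rcancel)
  moreover have "z \<in> mat_spectrum A" using y by (auto simp: mat_spectrum_def)
  ultimately show ?thesis by blast
qed

lemma norm_trace_poly_mat_le:
  fixes A :: "complex^'n^'n"
  assumes "\<And>z. z \<in> mat_spectrum A \<Longrightarrow> cmod (poly p z) \<le> b" "0 \<le> b"
  shows "cmod (trace (poly_mat p A)) \<le> real CARD('n) * b"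
  by (rule norm_trace_le) (use assms eigenvalue_poly_mat in blast)+

section \<open>Normal matrices\<close>

lemma commute_conj_transpose_poly_mat:
  assumes "normal_matrix A"
  shows "A ** conj_transpose (poly_mat p A) = conj_transpose (poly_mat p A) ** A"
proof (induction p)
  case (pCons a p)
  let ?P = "conj_transpose (poly_mat p A)" and ?B = "conj_transpose A"
  have eq: "conj_transpose (poly_mat (pCons a p) A) = mat (cnj a) + ?P ** ?B"
    by (simp add: poly_mat_pCons conj_transpose_add conj_transpose_mult conj_transpose_mat)
  have "A ** (?P ** ?B) = ?P ** (A ** ?B)" by (simp add: matrix_mul_assoc pCons.IH)
  also have "A ** ?B = ?B ** A" using assms by (simp add: normal_matrix_def)
  finally have "A ** (?P ** ?B) = (?P ** ?B) ** A" by (simp add: matrix_mul_assoc)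
  then show ?case
    by (simp add: eq matrix_add_ldistrib matrix_add_rdistrib mat_scale_commute[of A])
qed simp

lemma commute_poly_mat:
  assumes "A ** H = H ** A"
  shows "poly_mat p A ** H = H ** poly_mat p A"
proof (induction p)
  case (pCons a p)
  have "A ** poly_mat p A ** H = H ** (A ** poly_mat p A)"
    by (metis pCons.IH assms matrix_mul_assoc)
  then show ?case
    by (simp add: poly_mat_pCons matrix_add_ldistrib matrix_add_rdistrib mat_scale_commute[of H])
qed simp

lemma ex_norm_attaining_vector:
  fixes M :: "complex^'n^'n"
  shows "\<exists>x. norm x = 1 \<and> norm (M *v x) = mat_norm M"
proof -
  obtain e :: "complex^'n" where "norm e = 1" using vector_choose_size[of 1] by auto
  then have ne: "sphere (0 :: complex^'n) 1 \<noteq> {}" by auto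
  have "continuous_on (sphere 0 1) (\<lambda>x. norm (M *v x))"
    by (intro continuous_on_norm bounded_linear.continuous_on[OF matrix_vector_mul_bounded_linear] continuous_on_id)
  from continuous_attains_sup[OF compact_sphere ne this]
  obtain x where x: "norm x = 1" "\<And>y. norm y = 1 \<Longrightarrow> norm (M *v y) \<le> norm (M *v x)"
    by auto
  have "mat_norm M \<le> norm (M *v x)"
  proof (rule mat_norm_le)
    fix y
    show "norm (M *v y) \<le> norm (M *v x) * norm y"
    proof (cases "y = 0")
      case False
      have "norm (M *v (of_real (inverse (norm y)) *s y)) \<le> norm (M *v x)"
        using False by (intro x(2)) (simp add: norm_scale norm_inverse)
      also have "norm (M *v (of_real (inverse (norm y)) *s y)) = inverse (norm y) * norm (M *v y)"
        by (simp only: vector_scale_commute norm_scale norm_of_real) simp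
      finally show ?thesis using False by (simp add: field_simps)
    qed simp
  qed
  moreover have "norm (M *v x) \<le> mat_norm M" using mat_norm_bound[of M x] x(1) by simp
  ultimately show ?thesis using x(1) by (intro exI[of _ x]) simp
qed

text \<open>Replaces unitary diagonalisation. A unit vector x maximising the norm of M x is an
  eigenvector of H for the square of s. By normality H commutes with A, so this eigenspace also
  contains an eigenvector y of A, and there M acts as the scalar p(z), of modulus s.\<close>

lemma mat_norm_poly_mat_normal_le:
  fixes A :: "complex^'n^'n"
  assumes normal: "normal_matrix A" and b: "\<And>z. z \<in> mat_spectrum A \<Longrightarrow> cmod (poly p z) \<le> b"
  shows "mat_norm (poly_mat p A) \<le> b"
proof -
  define M where "M = poly_mat p A"
  define s where "s = mat_norm M"
  define H where "H = conj_transpose M ** M"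
  have H: "hinner u (H *v u) = of_real ((norm (M *v u))\<^sup>2)" for u
    unfolding hinner_self[symmetric] H_def by (simp add: conj_transpose_hinner' matrix_vector_mul_assoc)
  obtain x where x: "norm x = 1" "norm (M *v x) = s"
    using ex_norm_attaining_vector[of M] by (auto simp: s_def)
  \<comment> \<open>The equality case of Cauchy--Schwarz: H x has norm at most s^2 and inner product
    s^2 with the unit vector x.\<close>
  have "H *v x = of_real (s\<^sup>2) *s x"
  proof -
    define w where "w = H *v x"
    have "norm w \<le> s * s"
      using mat_norm_bound[of "conj_transpose M" "M *v x"] x
      by (simp add: w_def H_def mat_norm_conj_transpose s_def matrix_vector_mul_assoc)
    then have w: "(norm w)\<^sup>2 \<le> s^4" using power_mono[of "norm w" "s * s" 2]
      by (simp add: power2_eq_square power4_eq_xxxx)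
    have xw: "hinner x w = of_real (s\<^sup>2)" using H[of x] x by (simp add: w_def)
    then have wx: "hinner w x = of_real (s\<^sup>2)" using cnj_hinner[of x w] by simp
    have "complex_of_real ((norm (w - of_real (s\<^sup>2) *s x))\<^sup>2) = of_real ((norm w)\<^sup>2 - s^4)"
      unfolding hinner_self[symmetric]
      by (simp add: hinner_simps xw wx) (simp add: hinner_self x(1) power4_eq_xxxx power2_eq_square)
    then have "(norm (w - of_real (s\<^sup>2) *s x))\<^sup>2 \<le> 0"
      using w unfolding of_real_eq_iff by simp
    then show ?thesis by (simp add: w_def)
  qed
  moreover obtain r z where y: "poly_mat r A *v x \<noteq> 0" "A *v (poly_mat r A *v x) = z *s (poly_mat r A *v x)"
    using ex_cyclic_eigenvector[of x A] x(1) by fastforce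
  define y where "y = poly_mat r A *v x"
  have "A ** H = H ** A"
    unfolding H_def M_def using commute_conj_transpose_poly_mat[OF normal, of p]
      commute_poly_mat[of A A p] by (metis matrix_mul_assoc)
  then have "H *v y = poly_mat r A *v (H *v x)"
    by (simp add: y_def matrix_vector_mul_assoc commute_poly_mat)
  ultimately have "H *v y = of_real (s\<^sup>2) *s y" by (simp add: y_def vector_scale_commute)
  then have "of_real ((norm (M *v y))\<^sup>2) = complex_of_real (s\<^sup>2 * (norm y)\<^sup>2)"
    unfolding H[symmetric] by (simp add: hinner_simps hinner_self)
  then have "(norm (M *v y))\<^sup>2 = s\<^sup>2 * (norm y)\<^sup>2" unfolding of_real_eq_iff .
  moreover have "M *v y = poly p z *s y"
    unfolding M_def y_def by (rule poly_mat_eigenvector[OF y(2)])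
  ultimately have "(cmod (poly p z) * norm y)\<^sup>2 = (s * norm y)\<^sup>2"
    by (simp add: norm_scale power_mult_distrib)
  then have "cmod (poly p z) * norm y = s * norm y"
    by (simp add: s_def)
  then have "cmod (poly p z) = s" using y(1) by (simp add: y_def)
  moreover have "z \<in> mat_spectrum A" using y by (auto simp: mat_spectrum_def)
  ultimately show ?thesis using b[of z] by (simp add: s_def M_def)
qed

section \<open>Sparsity of polynomials of a matrix and probing\<close>

lemma matrix_power_walk:
  assumes "matrix_power A k $ i $ j \<noteq> 0"
  shows "\<exists>p. pre_digraph.awalk (matrix_digraph A) i p j \<and> length p \<le> k"
  using assms
proof (induction k arbitrary: i)
  case 0
  interpret wf_digraph "matrix_digraph A" by (rule wf_digraph_matrix_digraph)
  have "i = j" using 0 by (simp add: mat_def split: if_splits)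
  moreover have "i \<in> verts (matrix_digraph A)" by (simp add: matrix_digraph_def)
  ultimately have "awalk i [] j" by (simp add: awalk_Nil_iff)
  then show ?case by auto
next
  case (Suc k)
  interpret wf_digraph "matrix_digraph A" by (rule wf_digraph_matrix_digraph)
  have "(\<Sum>l\<in>UNIV. A $ i $ l * matrix_power A k $ l $ j) \<noteq> 0"
    using Suc.prems by (simp add: matrix_matrix_mult_def)
  then obtain l where l: "A $ i $ l * matrix_power A k $ l $ j \<noteq> 0"
    by (meson sum.not_neutral_contains_not_neutral)
  then obtain p where p: "awalk l p j" "length p \<le> k" using Suc.IH[of l] by auto
  show ?case
  proof (cases "i = l")
    \<comment> \<open>A diagonal entry of A is not an arc, so the walk stays where it is; hence only
      a length of at most k is claimed.\<close>
    case True
    then show ?thesis using p by (intro exI[of _ p]) simp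
  next
    case False
    then have "(i, l) \<in> arcs (matrix_digraph A)" "tail (matrix_digraph A) (i, l) = i"
      "head (matrix_digraph A) (i, l) = l"
      using l by (simp_all add: matrix_digraph_def)
    then have "awalk i ((i, l) # p) j" using p by (simp add: awalk_Cons_iff)
    then show ?thesis using p by (intro exI[of _ "(i, l) # p"]) simp
  qed
qed

lemma graph_dist_le:
  assumes "matrix_power A k $ i $ j \<noteq> 0"
  shows "graph_dist A i j \<le> ereal (real k)"
proof -
  interpret wf_digraph "matrix_digraph A" by (rule wf_digraph_matrix_digraph)
  obtain p where p: "awalk i p j" "length p \<le> k" using matrix_power_walk[OF assms] by blast
  have "graph_dist A i j \<le> ereal (awalk_cost (\<lambda>_. 1) p)"
    unfolding graph_dist_def using p(1) by (rule min_cost_le_walk_cost)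
  also have "awalk_cost (\<lambda>_. 1) p = real (length p)" by (simp add: awalk_cost_def sum_list_triv)
  finally show ?thesis using p(2) by (meson ereal_less_eq(3) of_nat_mono order_trans)
qed

lemma poly_mat_nth_eq_0:
  assumes "distance_coloring d A m col" "degree p \<le> d" "i \<noteq> j" "col i = col j"
  shows "poly_mat p A $ i $ j = 0"
proof -
  have "matrix_power A k $ i $ j = 0" if "k \<le> d" for k
  proof (rule ccontr)
    assume "matrix_power A k $ i $ j \<noteq> 0"
    then have "graph_dist A i j \<le> ereal (real k)" by (rule graph_dist_le)
    also have "\<dots> \<le> ereal (real d)" using that by simp
    finally show False using assms by (auto simp: distance_coloring_def)
  qed
  then show ?thesis using assms(2) by (simp add: poly_mat_def scaled_matrix_nth)
qed

section \<open>The probing estimator as a sum over color classes\<close>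

lemma probing_vector_nth: "probing_vector col l $ i = (if col i = l then 1 else 0)"
  by (simp add: probing_vector_def color_class_def axis_def sum.delta' if_distrib cong: if_cong)

lemma norm_probing_vector: "(norm (probing_vector col l :: complex^'n))\<^sup>2 = real (card (color_class col l))"
proof -
  have "(norm (probing_vector col l :: complex^'n))\<^sup>2 = (\<Sum>i\<in>UNIV. if col i = l then 1 else (0 :: real))"
    by (simp add: norm_vec_def L2_set_def sum_nonneg probing_vector_nth) (intro sum.cong; simp)
  then show ?thesis by (simp add: color_class_def sum.If_cases)
qed

lemma sum_card_color_class:
  assumes "range (col :: 'n::finite \<Rightarrow> nat) \<subseteq> {1..m}"
  shows "(\<Sum>l=1..m. card (color_class col l)) = CARD('n)"
proof -
  have "(\<Sum>l=1..m. card (color_class col l)) = card (\<Union>l\<in>{1..m}. color_class col l)"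
    by (rule card_UN_disjoint[symmetric]) (auto simp: color_class_def)
  also have "(\<Union>l\<in>{1..m}. color_class col l) = UNIV"
    using assms by (auto simp: color_class_def)
  finally show ?thesis by simp
qed

lemma probing_trace_poly_mat:
  assumes col: "distance_coloring d A m col" and deg: "degree p \<le> d"
  shows "probing_trace col m (poly_mat p A) = trace (poly_mat p A)"
proof -
  let ?M = "poly_mat p A"
  have "probing_trace col m ?M = (\<Sum>l=1..m. \<Sum>i\<in>UNIV. if col i = l then ?M $ i $ i else 0)"
    unfolding probing_trace_def
  proof (rule sum.cong[OF refl])
    fix l
    have "quad_form ?M (probing_vector col l)
        = (\<Sum>i\<in>UNIV. \<Sum>j\<in>UNIV. if col i = l \<and> col j = l then ?M $ i $ j else 0)"
      unfolding quad_form_def matrix_vector_mult_def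
      by (simp add: probing_vector_nth sum_distrib_left) (intro sum.cong; simp)
    also have "\<dots> = (\<Sum>i\<in>UNIV. \<Sum>j\<in>UNIV. if j = i then (if col i = l then ?M $ i $ i else 0) else 0)"
      using poly_mat_nth_eq_0[OF col deg] by (intro sum.cong) auto
    finally show "quad_form ?M (probing_vector col l) = (\<Sum>i\<in>UNIV. if col i = l then ?M $ i $ i else 0)"
      by simp
  qed
  also have "\<dots> = (\<Sum>i\<in>UNIV. \<Sum>l=1..m. if col i = l then ?M $ i $ i else 0)"
    by (rule sum.swap)
  also have "\<dots> = trace ?M"
    unfolding trace_def using col by (intro sum.cong) (auto simp: distance_coloring_def image_subset_iff)
  finally show ?thesis .
qed

lemma probing_trace_diff: "probing_trace col m (M - N) = probing_trace col m M - probing_trace col m N"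
  by (simp add: probing_trace_def quad_form_hinner matrix_vector_mult_diff_rdistrib hinner_diff_right
      sum_subtractf)

text \<open>The squared norms of the probing vectors are the sizes of the color classes, which
  partition the n vertices; thus the number m of colors does not enter.\<close>

lemma norm_probing_trace_le:
  fixes M :: "complex^'n^'n"
  assumes "range col \<subseteq> {1..m}"
  shows "cmod (probing_trace col m M) \<le> mat_norm M * real CARD('n)"
proof -
  have "cmod (probing_trace col m M) \<le> (\<Sum>l=1..m. mat_norm M * real (card (color_class col l)))"
    unfolding probing_trace_def
    by (rule order_trans[OF norm_sum]) (intro sum_mono order_trans[OF norm_quad_form_le], simp add: norm_probing_vector)
  also have "\<dots> = mat_norm M * real CARD('n)"
    by (simp add: sum_distrib_left[symmetric] sum_card_color_class[OF assms, symmetric])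
  finally show ?thesis .
qed

section \<open>The numerical range\<close>

lemma numerical_range_nonempty: "numerical_range (A :: complex^'n^'n) \<noteq> {}"
  using vector_choose_size[of 1, where ?'a = "complex^'n"] by (auto simp: numerical_range_def)

lemma compact_numerical_range: "compact (numerical_range (A :: complex^'n^'n))"
proof -
  have "numerical_range A = quad_form A ` sphere 0 1" by (auto simp: numerical_range_def)
  moreover have "continuous_on (sphere 0 1) (quad_form A)"
    unfolding quad_form_def[abs_def] matrix_vector_mult_def by (simp) (intro continuous_intros)
  ultimately show ?thesis by (simp add: compact_continuous_image)
qed

lemma quad_form_scale: "quad_form A (c *s x) = of_real ((cmod c)\<^sup>2) * quad_form A x"
  by (simp add: quad_form_hinner vector_scale_commute hinner_simps complex_norm_square del: of_real_power)

lemma quad_form_mem_numerical_range: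
  assumes "x \<noteq> 0"
  shows "quad_form A x / of_real ((norm x)\<^sup>2) \<in> numerical_range A"
proof -
  let ?u = "of_real (inverse (norm x)) *s x"
  have "norm ?u = 1" using assms by (simp add: norm_scale norm_inverse)
  moreover have "quad_form A ?u = quad_form A x / of_real ((norm x)\<^sup>2)"
    using assms by (simp only: quad_form_scale norm_of_real)
      (simp add: field_simps power2_eq_square)
  ultimately show ?thesis unfolding numerical_range_def by (metis (mono_tags, lifting) mem_Collect_eq)
qed

lemma mat_spectrum_subset_numerical_range: "mat_spectrum A \<subseteq> numerical_range A"
proof
  fix z assume "z \<in> mat_spectrum A"
  then obtain x where x: "x \<noteq> 0" "A *v x = z *s x" by (auto simp: mat_spectrum_def)
  have "quad_form A x / of_real ((norm x)\<^sup>2) = z"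
    using x by (simp add: quad_form_hinner hinner_simps hinner_self)
  then show "z \<in> numerical_range A" using quad_form_mem_numerical_range[OF x(1), of A] by simp
qed

text \<open>The Toeplitz--Hausdorff theorem.  After the affine normalisation \<open>Q\<close> sending two values \<open>a\<close>,
  \<open>b\<close> to \<open>0\<close>, \<open>1\<close>, a rotation of \<open>y\<close> makes \<open>Q\<close> real on the real plane spanned by \<open>x\<close> and \<open>y\<close>.\<close>

lemma convex_numerical_range: "convex (numerical_range (A :: complex^'n^'n))"
proof (rule convexI)
  fix a b and u v :: real
  assume a: "a \<in> numerical_range A" and b: "b \<in> numerical_range A" and uv: "0 \<le> u" "0 \<le> v" "u + v = 1"
  obtain x where x: "norm x = 1" "quad_form A x = a" using a by (auto simp: numerical_range_def)
  obtain y where y: "norm y = 1" "quad_form A y = b" using b by (auto simp: numerical_range_def)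
  show "u *\<^sub>R a + v *\<^sub>R b \<in> numerical_range A"
  proof (cases "a = b")
    case True
    then show ?thesis using a uv by (simp flip: scaleR_add_left)
  next
    case False
    define S where "S p q = (hinner p (A *v q) - a * hinner p q) / (b - a)" for p q
    have S_simps: "S (p + p') q = S p q + S p' q" "S p (q + q') = S p q + S p q'"
      "S (c *s p) q = cnj c * S p q" "S p (c *s q) = c * S p q" for p p' q q' c
      by (simp_all add: S_def hinner_simps matrix_vector_right_distrib vector_scale_commute
          diff_divide_distrib add_divide_distrib algebra_simps)
    have Sx: "S x x = 0" using x by (simp add: S_def hinner_self flip: quad_form_hinner)
    have Sy: "S y y = 1" using y False by (simp add: S_def hinner_self flip: quad_form_hinner)
    define g where "g = S x y - cnj (S y x)"
    \<comment> \<open>For \<open>y' = w *s y\<close> the imaginary part of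
      \<open>S x y' + S y' x\<close> equals that of \<open>w * g\<close>, and this \<open>w\<close>
      rotates g onto the nonnegative real axis.\<close>
    define w where "w = (if g = 0 then 1 else cnj g / of_real (cmod g))"
    have w1: "cmod w = 1" by (simp add: w_def norm_divide)
    have wg: "Im (w * g) = 0"
    proof (cases "g = 0")
      case False
      have "w * g = of_real (cmod g)"
        using False complex_norm_square[of g] by (simp add: w_def power2_eq_square field_simps)
      then show ?thesis by simp
    qed simp
    define y' where "y' = w *s y"
    have y': "norm y' = 1" using y w1 by (simp add: y'_def norm_scale)
    have Sy': "S y' y' = 1"
      using w1 Sy complex_norm_square[of w] by (simp add: y'_def S_simps mult.commute)
    define c where "c = Re (S x y' + S y' x)"
    have c: "S x y' + S y' x = of_real c"
    proof (rule complex_eqI)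
      have "Im (S x y' + S y' x) = Im (w * g)"
        by (simp add: y'_def S_simps g_def algebra_simps)
      then show "Im (S x y' + S y' x) = Im (complex_of_real c)" using wg by simp
    qed (simp add: c_def)
    define z where "z s = of_real (1 - s) *s x + of_real s *s y'" for s :: real
    have Sz: "S (z s) (z s) = of_real (s\<^sup>2 + s * (1 - s) * c)" for s
    proof -
      have "S (z s) (z s) = of_real s * of_real s + of_real (1 - s) * of_real s * (S x y' + S y' x)"
        by (simp only: z_def S_simps Sx Sy' complex_cnj_complex_of_real) (simp add: algebra_simps)
      then show ?thesis unfolding c by (simp add: power2_eq_square algebra_simps)
    qed
    \<comment> \<open>Otherwise multiples of x and y' would cancel. On diagonal arguments S is 0 at
      multiples of x and s^2 at \<open>s *s y'\<close>, so s = 0, and then x = 0.\<close>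
    have z0: "z s \<noteq> 0" for s
    proof
      assume "z s = 0"
      then have eq: "of_real (1 - s) *s x = - (of_real s *s y')" by (simp add: z_def add_eq_0_iff2)
      have "S (of_real (1 - s) *s x) (of_real (1 - s) *s x) = 0" by (simp only: S_simps Sx mult_zero_right)
      moreover have "- (of_real s *s y') = of_real (- s) *s y'" by (simp add: vec_eq_iff)
      ultimately have "S (of_real (- s) *s y') (of_real (- s) *s y') = 0" using eq by simp
      then have "s = 0" by (simp only: S_simps Sy') simp
      then show False using \<open>z s = 0\<close> x by (simp add: z_def)
    qed
    \<comment> \<open>The normalised form along the path is real by \<open>Sz\<close> and runs
      continuously from 0 to 1, so it takes the value v.\<close>
    define h where "h s = (s\<^sup>2 + s * (1 - s) * c) / (norm (z s))\<^sup>2" for s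
    have "z = (\<lambda>s. (1 - s) *\<^sub>R x + s *\<^sub>R y')"
      by (simp add: fun_eq_iff z_def vec_eq_iff scaleR_conv_of_real[where 'a = complex] left_diff_distrib)
    then have "continuous_on {0..1} z" by (simp only:) (intro continuous_intros)
    then have "continuous_on {0..1} h"
      unfolding h_def using z0 by (intro continuous_intros) simp_all
    moreover have "h 0 = 0" "h 1 = 1" by (simp_all add: h_def z_def y')
    ultimately obtain s where s: "0 \<le> s" "s \<le> 1" "h s = v"
      using IVT'[of h 0 v 1] uv by auto
    have "S (z s) (z s) = of_real (v * (norm (z s))\<^sup>2)"
      unfolding Sz using s(3) z0[of s] by (simp add: h_def field_simps)
    then have "quad_form A (z s) - a * of_real ((norm (z s))\<^sup>2) = (b - a) * of_real (v * (norm (z s))\<^sup>2)"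
      using False by (simp add: S_def quad_form_hinner hinner_self field_simps)
    then have "quad_form A (z s) / of_real ((norm (z s))\<^sup>2) = a + (b - a) * of_real v"
      using z0[of s] by (simp add: field_simps)
    also have "\<dots> = u *\<^sub>R a + v *\<^sub>R b"
    proof -
      have u: "u = 1 - v" using uv by simp
      show ?thesis unfolding u by (simp add: scaleR_conv_of_real algebra_simps)
    qed
    finally show ?thesis using quad_form_mem_numerical_range[OF z0[of s], of A] by simp
  qed
qed

text \<open>A Jordan chain of length two compresses to a Jordan block, whose numerical range is a disc
  around the eigenvalue.\<close>

lemma multiple_index_imp_interior:
  assumes "eigenvalue_index A z \<ge> 2"
  shows "z \<in> interior (numerical_range A)"
proof -
  have "[:- z, 1:] ^ 2 dvd minimal_poly A"
  proof (rule dvd_trans)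
    show "[:- z, 1:] ^ 2 dvd [:- z, 1:] ^ order z (minimal_poly A)"
      using assms unfolding eigenvalue_index_def by (rule le_imp_power_dvd)
  qed (rule order_1)
  then obtain q where q: "minimal_poly A = [:- z, 1:] ^ 2 * q" by (rule dvdE)
  let ?q = "[:- z, 1:] * q"
  have "q \<noteq> 0" using minimal_poly_nonzero[of A] unfolding q mult_eq_0_iff by blast
  have "minimal_poly A = [:- z, 1:] * ?q" unfolding q by (simp only: power2_eq_square mult.assoc)
  moreover have "?q \<noteq> 0" using \<open>q \<noteq> 0\<close> unfolding mult_eq_0_iff by simp
  moreover have "degree ([:- z, 1:] * ?q) = degree [:- z, 1:] + degree ?q"
    using \<open>?q \<noteq> 0\<close> by (rule degree_mult_eq[rotated]) simp
  ultimately have "degree (minimal_poly A) = Suc (degree ?q)" by simp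
  then have "degree ?q < degree (minimal_poly A)" by linarith
  then obtain t where t: "poly_mat ?q A *v t \<noteq> 0"
    using ex_vector_mult_neq_0[OF poly_mat_neq_0[OF \<open>?q \<noteq> 0\<close>]] by blast
  \<comment> \<open>A Jordan chain: v = (A - z) u is nonzero by minimality of the degree, and (A -
    z) v = 0.\<close>
  define u v where "u = poly_mat q A *v t" and "v = poly_mat ?q A *v t"
  have v_eq: "A *v u = z *s u + v"
    unfolding v_def poly_mat_mult poly_mat_linear
    by (simp add: u_def matrix_vector_mult_diff_rdistrib mat_vector_mult flip: matrix_vector_mul_assoc)
  have "poly_mat [:- z, 1:] A *v v = 0"
    unfolding v_def by (simp only: matrix_vector_mul_assoc flip: poly_mat_mult \<open>minimal_poly A = [:- z, 1:] * ?q\<close>) simp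
  then have Av: "A *v v = z *s v"
    by (simp add: poly_mat_linear matrix_vector_mult_diff_rdistrib mat_vector_mult)
  have "v \<noteq> 0" using t by (simp add: v_def)
  \<comment> \<open>Subtracting a multiple of the eigenvector v makes u' orthogonal to v and
    preserves (A - z) u' = v.\<close>
  define k where "k = hinner v u / of_real ((norm v)\<^sup>2)"
  define u' where "u' = u - k *s v"
  have Au': "A *v u' = z *s u' + v"
    unfolding u'_def by (simp add: matrix_vector_mult_diff_distrib vector_scale_commute Av v_eq
        vec_eq_iff algebra_simps)
  have vu': "hinner v u' = 0"
    using \<open>v \<noteq> 0\<close> by (simp add: u'_def hinner_simps k_def hinner_self)
  have u'v: "hinner u' v = 0" using cnj_hinner[of v u'] vu' by simp
  have "u' \<noteq> 0" using Au' \<open>v \<noteq> 0\<close> by auto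
  define c where "c = norm v / norm u'"
  have "c > 0" using \<open>u' \<noteq> 0\<close> \<open>v \<noteq> 0\<close> by (simp add: c_def)
  have "w \<in> numerical_range A" if w: "w \<in> ball z (c / 2)" for w
  proof -
    define \<zeta> where "\<zeta> = (w - z) / of_real c"
    have \<zeta>: "2 * cmod \<zeta> \<le> 1"
      using w \<open>c > 0\<close> by (simp add: \<zeta>_def norm_divide dist_norm norm_minus_commute field_simps)
    \<comment> \<open>A unit vector with component cos \<theta> along v and \<omega> sin \<theta>
      along u' has the form value z + c \<omega> sin \<theta> cos \<theta>. The product sin \<theta>
      cos \<theta> is half of sin (2 \<theta>) and reaches 1/2, which explains the radius c /
      2.\<close>
    define \<theta> where "\<theta> = arcsin (2 * cmod \<zeta>) / 2"
    have sc: "sin \<theta> * cos \<theta> = cmod \<zeta>"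
    proof -
      have "sin (2 * \<theta>) = 2 * cmod \<zeta>"
        unfolding \<theta>_def using \<zeta> by (simp, intro sin_arcsin) (auto intro: order_trans[of _ 0])
      then show ?thesis by (simp add: sin_double)
    qed
    define \<omega> where "\<omega> = cis (Arg \<zeta>)"
    have \<omega>: "of_real (cmod \<zeta>) * \<omega> = \<zeta>" using rcis_cmod_Arg[of \<zeta>] by (simp add: \<omega>_def rcis_def)
    have \<omega>1: "cnj \<omega> * \<omega> = 1" by (simp add: \<omega>_def cis_cnj cis_mult)
    define x1 x2 where "x1 = complex_of_real (cos \<theta> / norm v)" and "x2 = of_real (sin \<theta> / norm u') * \<omega>"
    define x where "x = x1 *s v + x2 *s u'"
    have nz: "of_real (norm v) \<noteq> (0 :: complex)" "of_real (norm u') \<noteq> (0 :: complex)"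
      using \<open>u' \<noteq> 0\<close> \<open>v \<noteq> 0\<close> by auto
    have "hinner x x = cnj x1 * x1 * of_real ((norm v)\<^sup>2) + cnj x2 * x2 * of_real ((norm u')\<^sup>2)"
      by (simp add: x_def hinner_simps vu' u'v) (simp add: hinner_self)
    also have "\<dots> = of_real ((cos \<theta>)\<^sup>2) + of_real ((sin \<theta>)\<^sup>2) * (cnj \<omega> * \<omega>)"
      using nz by (simp add: x1_def x2_def field_simps power2_eq_square)
    also have "\<dots> = 1" unfolding \<omega>1 mult_1_right of_real_add[symmetric] by simp
    finally have hx1: "hinner x x = 1" .
    then have "(norm x)\<^sup>2 = 1" unfolding hinner_self by (metis of_real_eq_1_iff)
    then have "norm x = 1" using power2_eq_imp_eq[of "norm x" 1] by simp
    have Ax: "A *v x = z *s x + x2 *s v"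
      by (simp add: x_def matrix_vector_right_distrib vector_scale_commute Av Au' vec_eq_iff algebra_simps)
    have "quad_form A x = z * hinner x x + x2 * hinner x v"
      by (simp add: quad_form_hinner Ax hinner_add_right hinner_scale_right)
    also have "hinner x v = cnj x1 * of_real ((norm v)\<^sup>2)"
      by (simp add: x_def hinner_simps u'v hinner_self)
    also have "x2 * (cnj x1 * of_real ((norm v)\<^sup>2)) = of_real (sin \<theta> * cos \<theta>) * \<omega> * of_real c"
      using nz by (simp add: x1_def x2_def c_def field_simps power2_eq_square)
    also have "\<dots> = \<zeta> * of_real c" unfolding sc by (simp add: \<omega>)
    also have "\<dots> = w - z" using \<open>c > 0\<close> by (simp add: \<zeta>_def)
    finally have "quad_form A x = w" by (simp add: hx1)
    then show ?thesis using \<open>norm x = 1\<close> by (auto simp: numerical_range_def)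
  qed
  then have "ball z (c / 2) \<subseteq> numerical_range A" by blast
  then show ?thesis
    using \<open>c > 0\<close> by (intro interiorI[of "ball z (c / 2)"]) auto
qed

section \<open>Matrix functions as limits of matrix polynomials\<close>

lemma higher_deriv_poly: "(deriv ^^ j) (poly p) = poly ((pderiv ^^ j) (p :: complex poly))"
proof (induction j)
  case (Suc j)
  show ?case
  proof
    fix z
    show "(deriv ^^ Suc j) (poly p) z = poly ((pderiv ^^ Suc j) p) z"
      by (simp add: Suc DERIV_imp_deriv[OF poly_DERIV])
  qed
qed simp

lemma poly_mat_tendsto_matrix_fun:
  assumes "uniform_limit (numerical_range A) (\<lambda>s. poly (p s)) f sequentially"
  shows "(\<lambda>s. mat_norm (poly_mat (p s) A - matrix_fun f A)) \<longlonglongrightarrow> 0"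
proof -
  let ?h = "hermite_poly f A" and ?W = "numerical_range A"
  have "(\<lambda>s. poly ((pderiv ^^ j) (p s - ?h)) z) \<longlonglongrightarrow> 0"
    if z: "z \<in> mat_spectrum A" "j < eigenvalue_index A z" for z j
  proof -
    have h: "poly ((pderiv ^^ j) ?h) z = (deriv ^^ j) f z"
      using hermite_poly_interpolates[of f A] z by (simp add: interpolates_on_spectrum_def)
    have "(\<lambda>s. poly ((pderiv ^^ j) (p s)) z) \<longlonglongrightarrow> (deriv ^^ j) f z"
    proof (cases "j = 0")
      case True
      have "z \<in> ?W" using z mat_spectrum_subset_numerical_range by blast
      then show ?thesis using tendsto_uniform_limitI[OF assms] True by simp
    next
      case False
      then have "eigenvalue_index A z \<ge> 2" using z by simp
      then have int: "z \<in> interior ?W" by (rule multiple_index_imp_interior)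
      \<comment> \<open>On the interior the uniform limit f is holomorphic, and by Weierstrass the
        convergence passes to all derivatives.\<close>
      have "(\<lambda>s. (deriv ^^ j) (poly (p s)) z) \<longlonglongrightarrow> (deriv ^^ j) f z"
      proof (rule higher_deriv_complex_uniform_limit)
        show "uniform_limit (interior ?W) (\<lambda>s. poly (p s)) f sequentially"
          using assms interior_subset by (rule uniform_limit_on_subset)
        show "\<forall>\<^sub>F n in sequentially. poly (p n) holomorphic_on interior ?W"
          by (intro always_eventually allI) (auto intro!: holomorphic_intros)
      qed (use int in auto)
      then show ?thesis by (simp add: higher_deriv_poly)
    qed
    from tendsto_diff[OF this tendsto_const[of "poly ((pderiv ^^ j) ?h) z"]]
    show ?thesis by (simp add: higher_pderiv_diff h)
  qed
  from poly_mat_tendsto_zero[OF this]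
  show ?thesis by (simp add: poly_mat_diff matrix_fun_def)
qed

section \<open>Uniform approximation by polynomials\<close>

lemma mult_divide_succ_le: "0 \<le> t \<Longrightarrow> 0 \<le> e \<Longrightarrow> t * (e / (t + 1)) \<le> (e :: real)"
  by (simp add: pos_divide_le_eq algebra_simps)

lemma poly_mat_const: "poly_mat [:c:] A = mat c"
  by (simp add: poly_mat_pCons)

text \<open>Outside the disc around l the denominator has modulus at least \<delta>; inside, the
  maximum modulus principle transfers the bound from the circle.\<close>

lemma divided_difference_bound:
  fixes p :: "complex poly"
  assumes "cball l \<delta> \<subseteq> \<Omega>" "\<delta> > 0" and b: "\<And>z. z \<in> \<Omega> \<Longrightarrow> cmod (poly p z) \<le> b" and "z \<in> \<Omega>"
  shows "cmod (poly (synthetic_div p l) z) \<le> 2 * b / \<delta>"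
proof -
  let ?t = "synthetic_div p l"
  have t: "(w - l) * poly ?t w = poly p w - poly p l" for w
    using arg_cong[OF synthetic_div_correct'[of l p], of "\<lambda>q. poly q w"] by (simp add: algebra_simps)
  have l: "l \<in> \<Omega>" using assms by auto
  have far: "cmod (poly ?t w) \<le> 2 * b / \<delta>" if "w \<in> \<Omega>" "\<delta> \<le> cmod (w - l)" for w
  proof -
    have "\<delta> * cmod (poly ?t w) \<le> cmod (w - l) * cmod (poly ?t w)"
      using that by (intro mult_right_mono) auto
    also have "\<dots> = cmod (poly p w - poly p l)" by (simp flip: norm_mult t)
    also have "\<dots> \<le> 2 * b" using norm_triangle_ineq4[of "poly p w" "poly p l"] b[OF that(1)] b[OF l] by simp
    finally show ?thesis using \<open>\<delta> > 0\<close> by (simp add: field_simps)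
  qed
  show ?thesis
  proof (cases "\<delta> \<le> cmod (z - l)")
    case True
    then show ?thesis using far assms by blast
  next
    case False
    show ?thesis
    proof (rule maximum_modulus_frontier[of "poly ?t" "cball l \<delta>"])
      fix w assume "w \<in> frontier (cball l \<delta>)"
      then have "dist l w = \<delta>" using \<open>\<delta> > 0\<close> by (simp add: frontier_cball)
      then show "cmod (poly ?t w) \<le> 2 * b / \<delta>"
        using assms(1) by (intro far) (auto simp: dist_norm norm_minus_commute)
    qed (use False in \<open>auto intro!: holomorphic_intros continuous_intros simp: dist_norm norm_minus_commute\<close>)
  qed
qed

text \<open>By Newton interpolation at the points of \<open>ls\<close>.\<close>

lemma poly_mat_bound_of_annihilating_list:
  assumes "\<delta> > 0" "\<And>l. l \<in> set ls \<Longrightarrow> cball l \<delta> \<subseteq> \<Omega>"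
  shows "\<exists>C\<ge>0. \<forall>p b x. (\<forall>z\<in>\<Omega>. cmod (poly p z) \<le> b) \<longrightarrow>
    poly_mat (\<Prod>l\<leftarrow>ls. [:- l, 1:]) A *v x = 0 \<longrightarrow> norm (poly_mat p A *v x) \<le> C * b * norm x"
  using assms(2)
proof (induction ls)
  case Nil
  \<comment> \<open>The empty product gives the identity matrix, so x = 0 is the only vector to
    consider.\<close>
  show ?case by (intro exI[of _ 0]) simp
next
  case (Cons l ls)
  then obtain C where C: "C \<ge> 0" "\<And>p b x. (\<forall>z\<in>\<Omega>. cmod (poly p z) \<le> b) \<Longrightarrow>
    poly_mat (\<Prod>l\<leftarrow>ls. [:- l, 1:]) A *v x = 0 \<Longrightarrow> norm (poly_mat p A *v x) \<le> C * b * norm x"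
    by (metis list.set_intros(2))
  have l: "cball l \<delta> \<subseteq> \<Omega>" using Cons.prems by simp
  then have lin: "l \<in> \<Omega>" using \<open>\<delta> > 0\<close> by auto
  let ?B = "poly_mat [:- l, 1:] A"
  \<comment> \<open>One Newton step writes p as t (z - l) + p(l). The quotient t is bounded by 2 b /
    \<delta> on \<Omega>, and the vector \<open>?B *v x\<close> is annihilated by the remaining
    factors.\<close>
  define C' where "C' = 1 + C * (2 / \<delta>) * mat_norm ?B"
  have "norm (poly_mat p A *v x) \<le> C' * b * norm x"
    if b: "\<forall>z\<in>\<Omega>. cmod (poly p z) \<le> b"
      and ann: "poly_mat (\<Prod>l\<leftarrow>l # ls. [:- l, 1:]) A *v x = 0" for p b x
  proof -
    have b0: "b \<ge> 0" using b lin norm_ge_zero order_trans by blast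
    let ?t = "synthetic_div p l"
    have p: "p = ?t * [:- l, 1:] + [:poly p l:]" using synthetic_div_correct'[of l p] by (simp add: mult.commute)
    have "poly_mat (\<Prod>l\<leftarrow>ls. [:- l, 1:]) A *v (?B *v x) = 0"
      using ann by (simp only: matrix_vector_mul_assoc flip: poly_mat_mult) (simp only: list.map prod_list.Cons mult.commute)
    then have "norm (poly_mat ?t A *v (?B *v x)) \<le> C * (2 * b / \<delta>) * norm (?B *v x)"
      using divided_difference_bound[OF l \<open>\<delta> > 0\<close>] b by (intro C(2)) auto
    also have "\<dots> \<le> C * (2 * b / \<delta>) * (mat_norm ?B * norm x)"
      using C(1) b0 \<open>\<delta> > 0\<close> by (intro mult_left_mono mat_norm_bound) auto
    finally have 1: "norm (poly_mat ?t A *v (?B *v x)) \<le> C * (2 * b / \<delta>) * (mat_norm ?B * norm x)" .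
    have "poly_mat p A = poly_mat ?t A ** ?B + mat (poly p l)"
      using arg_cong[OF p, of "\<lambda>q. poly_mat q A"]
      by (simp only: poly_mat_add poly_mat_mult poly_mat_const)
    then have "poly_mat p A *v x = poly_mat ?t A *v (?B *v x) + poly p l *s x"
      by (simp only: matrix_vector_mult_add_rdistrib matrix_vector_mul_assoc mat_vector_mult)
    then have "norm (poly_mat p A *v x) \<le> C * (2 * b / \<delta>) * (mat_norm ?B * norm x) + b * norm x"
      using norm_triangle_ineq[of "poly_mat ?t A *v (?B *v x)" "poly p l *s x"] 1 b lin
        mult_right_mono[of "cmod (poly p l)" b "norm x"] by (simp add: norm_scale)
    then show ?thesis by (simp add: C'_def algebra_simps)
  qed
  moreover have "C' \<ge> 0" using C(1) \<open>\<delta> > 0\<close> by (simp add: C'_def)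
  ultimately show ?case by blast
qed

lemma prod_linear_powers_list:
  assumes "finite S"
  shows "\<exists>ls. set ls \<subseteq> S \<and> (\<Prod>l\<leftarrow>ls. [:- l, 1:]) = (\<Prod>z\<in>S. [:- z, 1 :: complex:] ^ n z)"
  using assms
proof (induction S rule: finite_induct)
  case (insert z S)
  then obtain ls where "set ls \<subseteq> S" "(\<Prod>l\<leftarrow>ls. [:- l, 1:]) = (\<Prod>z\<in>S. [:- z, 1:] ^ n z)" by blast
  then show ?case using insert.hyps
    by (intro exI[of _ "replicate (n z) z @ ls"]) (auto simp: prod_list_replicate simp del: mult_pCons_left)
qed simp

text \<open>An a priori constant of no particular size, which makes the supremum K in the
  Crouzeix--Palencia argument finite. The discs around the eigenvalues are what requires a
  neighbourhood of the numerical range.\<close>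

lemma ex_poly_mat_bound:
  assumes "\<delta> > 0" "\<And>z. z \<in> mat_spectrum A \<Longrightarrow> cball z \<delta> \<subseteq> \<Omega>"
  shows "\<exists>C\<ge>0. \<forall>p b. (\<forall>z\<in>\<Omega>. cmod (poly p z) \<le> b) \<longrightarrow> mat_norm (poly_mat p A) \<le> C * b"
proof -
  obtain ls where ls: "set ls \<subseteq> mat_spectrum A" "(\<Prod>l\<leftarrow>ls. [:- l, 1:]) = minimal_poly A"
    using prod_linear_powers_list[OF finite_mat_spectrum, of A "eigenvalue_index A"]
    unfolding minimal_poly_decompose by blast
  then obtain C where C: "C \<ge> 0" "\<And>p b x. (\<forall>z\<in>\<Omega>. cmod (poly p z) \<le> b) \<Longrightarrow>
    poly_mat (\<Prod>l\<leftarrow>ls. [:- l, 1:]) A *v x = 0 \<Longrightarrow> norm (poly_mat p A *v x) \<le> C * b * norm x"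
    using poly_mat_bound_of_annihilating_list[of \<delta> ls \<Omega> A] assms by blast
  then have "mat_norm (poly_mat p A) \<le> C * b" if "\<forall>z\<in>\<Omega>. cmod (poly p z) \<le> b" for p b
    using that by (intro mat_norm_le) (simp add: ls(2))
  then show ?thesis using C(1) by blast
qed

text \<open>\<open>M\<close> is a value \<open>h(A)\<close>; this functional calculus covers all uniform limits \<open>h\<close> of polynomials.\<close>

definition poly_approx :: "complex set \<Rightarrow> complex^'n^'n \<Rightarrow> (complex \<Rightarrow> complex) \<Rightarrow> complex^'n^'n \<Rightarrow> bool" where
  "poly_approx \<Omega> A h M \<longleftrightarrow>
     (\<forall>e>0. \<exists>p. (\<forall>z\<in>\<Omega>. cmod (h z - poly p z) \<le> e) \<and> mat_norm (M - poly_mat p A) \<le> e)"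

lemma poly_approx_poly: "poly_approx \<Omega> A (poly p) (poly_mat p A)"
  unfolding poly_approx_def by (intro allI impI exI[of _ p]) simp

lemma poly_approx_add:
  assumes "poly_approx \<Omega> A h M" "poly_approx \<Omega> A k N"
  shows "poly_approx \<Omega> A (\<lambda>z. h z + k z) (M + N)"
  unfolding poly_approx_def
proof (intro allI impI)
  fix e :: real assume "e > 0"
  then have "e / 2 > 0" by simp
  then obtain p q where p: "\<forall>z\<in>\<Omega>. cmod (h z - poly p z) \<le> e / 2" "mat_norm (M - poly_mat p A) \<le> e / 2"
    and q: "\<forall>z\<in>\<Omega>. cmod (k z - poly q z) \<le> e / 2" "mat_norm (N - poly_mat q A) \<le> e / 2"
    using assms unfolding poly_approx_def by meson
  have "cmod (h z + k z - poly (p + q) z) \<le> e" if "z \<in> \<Omega>" for z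
    using norm_triangle_ineq[of "h z - poly p z" "k z - poly q z"] p(1) q(1) that
    by (fastforce simp: algebra_simps)
  moreover have "mat_norm (M + N - poly_mat (p + q) A) \<le> e"
    using mat_norm_add[of "M - poly_mat p A" "N - poly_mat q A"] p(2) q(2)
    by (simp add: poly_mat_add algebra_simps)
  ultimately show "\<exists>p. (\<forall>z\<in>\<Omega>. cmod (h z + k z - poly p z) \<le> e) \<and> mat_norm (M + N - poly_mat p A) \<le> e"
    by blast
qed

lemma poly_approx_scale:
  assumes "poly_approx \<Omega> A h M"
  shows "poly_approx \<Omega> A (\<lambda>z. c * h z) (mat c ** M)"
  unfolding poly_approx_def
proof (intro allI impI)
  fix e :: real assume e: "e > 0"
  then have "e / (cmod c + 1) > 0" by (simp add: add_nonneg_pos)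
  then obtain p where p: "\<forall>z\<in>\<Omega>. cmod (h z - poly p z) \<le> e / (cmod c + 1)"
    "mat_norm (M - poly_mat p A) \<le> e / (cmod c + 1)"
    using assms unfolding poly_approx_def by meson
  have le: "cmod c * t \<le> e" if "t \<le> e / (cmod c + 1)" for t
  proof -
    have "cmod c * t \<le> cmod c * (e / (cmod c + 1))" using that by (intro mult_left_mono) auto
    also have "\<dots> \<le> e" using e by (intro mult_divide_succ_le) auto
    finally show ?thesis .
  qed
  have "cmod (c * h z - poly (smult c p) z) \<le> e" if "z \<in> \<Omega>" for z
    using le[of "cmod (h z - poly p z)"] p(1) that by (simp flip: norm_mult right_diff_distrib)
  moreover have "mat_norm (mat c ** M - poly_mat (smult c p) A) \<le> e"
    using mat_norm_scale_le[of c "M - poly_mat p A"] le[OF p(2)]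
    by (simp add: poly_mat_smult matrix_diff_ldistrib)
  ultimately show "\<exists>p. (\<forall>z\<in>\<Omega>. cmod (c * h z - poly p z) \<le> e) \<and> mat_norm (mat c ** M - poly_mat p A) \<le> e"
    by blast
qed

lemma poly_approx_diff:
  assumes "poly_approx \<Omega> A h M" "poly_approx \<Omega> A k N"
  shows "poly_approx \<Omega> A (\<lambda>z. h z - k z) (M - N)"
proof -
  have "mat (- 1) ** N = - N" by (simp add: vec_eq_iff scaled_matrix_nth)
  then show ?thesis
    using poly_approx_add[OF assms(1) poly_approx_scale[OF assms(2), of "- 1"]] by simp
qed

lemma poly_approx_sum:
  assumes "\<And>i. i \<in> I \<Longrightarrow> poly_approx \<Omega> A (h i) (M i)"
  shows "poly_approx \<Omega> A (\<lambda>z. \<Sum>i\<in>I. h i z) (\<Sum>i\<in>I. M i)"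
  using assms
proof (induction I rule: infinite_finite_induct)
  case (insert i I)
  then show ?case by (simp add: poly_approx_add)
qed (use poly_approx_poly[of \<Omega> A 0] in \<open>simp_all add: poly_0[abs_def]\<close>)

text \<open>The outer factors are polynomials already, so only the middle one is approximated. This
  identifies the product X G X of the Crouzeix--Palencia step as the value at A of f g f.\<close>

lemma poly_approx_sandwich:
  assumes "poly_approx \<Omega> A h M" and f: "\<And>z. z \<in> \<Omega> \<Longrightarrow> cmod (poly f z) \<le> 1"
  shows "poly_approx \<Omega> A (\<lambda>z. poly f z * h z * poly f z) (poly_mat f A ** M ** poly_mat f A)"
  unfolding poly_approx_def
proof (intro allI impI)
  fix e :: real assume e: "e > 0"
  define X where "X = poly_mat f A"
  define c where "c = (mat_norm X)\<^sup>2 + 1"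
  have c: "c \<ge> 1" by (simp add: c_def)
  then have "e / c > 0" using e by simp
  then obtain p where p: "\<forall>z\<in>\<Omega>. cmod (h z - poly p z) \<le> e / c" "mat_norm (M - poly_mat p A) \<le> e / c"
    using assms(1) unfolding poly_approx_def by meson
  have "cmod (poly f z * h z * poly f z - poly (f * p * f) z) \<le> e" if z: "z \<in> \<Omega>" for z
  proof -
    have "cmod (poly f z * h z * poly f z - poly (f * p * f) z) = cmod (poly f z) * cmod (h z - poly p z) * cmod (poly f z)"
      by (simp add: algebra_simps flip: norm_mult)
    also have "\<dots> \<le> 1 * (e / c) * 1"
      using f[OF z] p(1) z e c by (intro mult_mono) auto
    also have "\<dots> \<le> e" using c e by (simp add: field_simps)
    finally show ?thesis .
  qed
  moreover have "mat_norm (X ** M ** X - poly_mat (f * p * f) A) \<le> e"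
  proof -
    have "X ** M ** X - poly_mat (f * p * f) A = X ** (M - poly_mat p A) ** X"
      by (simp add: X_def poly_mat_mult matrix_diff_ldistrib matrix_diff_rdistrib)
    then have "mat_norm (X ** M ** X - poly_mat (f * p * f) A) \<le> mat_norm X * mat_norm (M - poly_mat p A) * mat_norm X"
      by (simp only:) (rule order_trans[OF mat_norm_mult], intro mult_right_mono mat_norm_mult mat_norm_nonneg)
    also have "\<dots> \<le> mat_norm X * (e / c) * mat_norm X"
      using p(2) by (intro mult_right_mono mult_left_mono) auto
    also have "\<dots> = (mat_norm X)\<^sup>2 * (e / ((mat_norm X)\<^sup>2 + 1))" by (simp add: c_def power2_eq_square)
    also have "\<dots> \<le> e" using e by (intro mult_divide_succ_le) auto
    finally show ?thesis .
  qed
  ultimately show "\<exists>p. (\<forall>z\<in>\<Omega>. cmod (poly f z * h z * poly f z - poly p z) \<le> e) \<and>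
      mat_norm (poly_mat f A ** M ** poly_mat f A - poly_mat p A) \<le> e"
    unfolding X_def by blast
qed

lemma poly_approx_bound:
  assumes K: "K \<ge> 0" "\<And>p b. (\<forall>z\<in>\<Omega>. cmod (poly p z) \<le> b) \<Longrightarrow> mat_norm (poly_mat p A) \<le> K * b"
    and h: "poly_approx \<Omega> A h M" "\<And>z. z \<in> \<Omega> \<Longrightarrow> cmod (h z) \<le> c"
  shows "mat_norm M \<le> K * c"
proof (rule field_le_epsilon)
  fix e :: real assume e: "e > 0"
  \<comment> \<open>The error d enters twice: with the factor K through the values on \<Omega>, and
    once more as the distance of the matrices.\<close>
  define d where "d = e / (K + 1)"
  have "d > 0" using e K by (simp add: d_def)
  then obtain p where p: "\<forall>z\<in>\<Omega>. cmod (h z - poly p z) \<le> d" "mat_norm (M - poly_mat p A) \<le> d"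
    using h(1) unfolding poly_approx_def by meson
  have "cmod (poly p z) \<le> c + d" if "z \<in> \<Omega>" for z
    using p(1) h(2)[OF that] that norm_triangle_sub[of "poly p z" "h z"] norm_minus_commute[of "h z" "poly p z"]
    by fastforce
  then have "mat_norm (poly_mat p A) \<le> K * (c + d)" by (intro K(2)) auto
  then have "mat_norm M \<le> K * c + (K + 1) * d"
    using mat_norm_diff[of M "poly_mat p A"] p(2) by (simp add: algebra_simps)
  also have "(K + 1) * d = e" using K by (simp add: d_def)
  finally show "mat_norm M \<le> K * c + e" .
qed

text \<open>A disc of large radius with \<open>\<sigma>\<close> on its boundary contains the bounded part \<open>\<Omega>\<close> of the
  half-plane; in it \<open>1/(\<sigma> - z)\<close> is a geometric series.\<close>

lemma poly_approx_resolvent: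
  assumes K: "K \<ge> 0" "\<And>p b. (\<forall>z\<in>\<Omega>. cmod (poly p z) \<le> b) \<Longrightarrow> mat_norm (poly_mat p A) \<le> K * b"
    and u: "cmod u = 1" and \<eta>: "\<eta> > 0" "\<And>z. z \<in> \<Omega> \<Longrightarrow> \<eta> \<le> Re (cnj u * (\<sigma> - z))"
    and D: "\<And>z. z \<in> \<Omega> \<Longrightarrow> cmod (\<sigma> - z) \<le> D"
    and R: "R ** (mat \<sigma> - A) = mat 1"
  shows "poly_approx \<Omega> A (\<lambda>z. 1 / (\<sigma> - z)) R"
  unfolding poly_approx_def
proof (intro allI impI)
  fix e :: real assume e: "e > 0"
  \<comment> \<open>The bound \<open>\<eta> \<le> D'\<close> keeps the radicand of
    \<open>\<kappa>\<close> nonnegative even if \<Omega> is empty.\<close>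
  define D' where "D' = max D \<eta>"
  have D': "D' > 0" "D' \<ge> \<eta>" "\<And>z. z \<in> \<Omega> \<Longrightarrow> cmod (\<sigma> - z) \<le> D'" using D \<eta>(1) by (auto simp: D'_def max.coboundedI1)
  \<comment> \<open>The disc has centre \<sigma> - \<rho> u and radius \<rho>; \<open>v\<close>
    below is its normalised coordinate, equal to 1 at \<sigma>. On \<Omega> the square of its
    modulus is at most 1 - 2 \<eta> / \<rho> + D'^2 / \<rho>^2, and this \<rho> minimises that
    bound.\<close>
  define \<rho> where "\<rho> = D'\<^sup>2 / \<eta>"
  have \<rho>: "\<rho> > 0" using D' \<eta> by (simp add: \<rho>_def)
  define \<kappa> where "\<kappa> = sqrt (1 - \<eta>\<^sup>2 / D'\<^sup>2)"
  have \<kappa>: "0 \<le> \<kappa>" "\<kappa> < 1"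
    using \<eta>(1) D' by (simp_all add: \<kappa>_def power_mono)
  define v where "v = [:1 - cnj u * \<sigma> / of_real \<rho>, cnj u / of_real \<rho>:]"
  have v: "poly v z = 1 - cnj u * (\<sigma> - z) / of_real \<rho>" for z
    by (simp add: v_def algebra_simps diff_divide_distrib)
  have v_le: "cmod (poly v z) \<le> \<kappa>" if z: "z \<in> \<Omega>" for z
  proof -
    define y where "y = cnj u * (\<sigma> - z)"
    have y: "cmod y \<le> D'" "Re y \<ge> \<eta>" using D'(3)[OF z] \<eta>(2)[OF z] u by (simp_all add: y_def norm_mult)
    have "(cmod (poly v z))\<^sup>2 = (1 - Re y / \<rho>)\<^sup>2 + (Im y / \<rho>)\<^sup>2"
      unfolding v y_def[symmetric] by (simp add: cmod_power2)
    also have "\<dots> = 1 - 2 * Re y / \<rho> + (cmod y)\<^sup>2 / \<rho>\<^sup>2"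
      unfolding cmod_power2 by (simp add: power2_eq_square algebra_simps add_divide_distrib)
    also have "\<dots> \<le> 1 - 2 * \<eta> / \<rho> + D'\<^sup>2 / \<rho>\<^sup>2"
      using y \<rho> by (intro add_mono diff_left_mono divide_right_mono power_mono) auto
    also have "\<dots> = 1 - \<eta>\<^sup>2 / D'\<^sup>2"
      using \<eta>(1) D'(1) by (simp add: \<rho>_def power2_eq_square field_simps)
    finally show ?thesis unfolding \<kappa>_def by (rule real_le_rsqrt)
  qed
  define e' where "e' = min (e * \<eta>) (e / (mat_norm R * K + 1))"
  have e': "e' > 0" using e \<eta>(1) K(1) by (auto simp: e'_def intro!: divide_pos_pos add_nonneg_pos)
  obtain N where N: "\<kappa> ^ N < e'" using real_arch_pow_inv[OF e' \<kappa>(2)] by blast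
  \<comment> \<open>Because v is 1 at \<sigma>, dividing by z - \<sigma> leaves a polynomial s. Its
    negative is a partial sum of the geometric series for 1/(\<sigma> - z), with remainder v^N /
    (\<sigma> - z).\<close>
  have "poly (1 - v ^ N) \<sigma> = 0" by (simp add: v)
  then obtain s where s: "1 - v ^ N = [:- \<sigma>, 1:] * s" unfolding poly_eq_0_iff_dvd by (rule dvdE)
  have vN: "cmod (poly (v ^ N) z) \<le> e'" if "z \<in> \<Omega>" for z
    using power_mono[OF v_le[OF that], of N] N by (simp add: norm_power)
  have "cmod (1 / (\<sigma> - z) - poly (- s) z) \<le> e" if z: "z \<in> \<Omega>" for z
  proof -
    have "\<eta> \<le> cmod (cnj u * (\<sigma> - z))" using \<eta>(2)[OF z] complex_Re_le_cmod order_trans by blast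
    then have nz: "\<eta> \<le> cmod (\<sigma> - z)" using u by (simp add: norm_mult)
    have "1 - poly (v ^ N) z = (z - \<sigma>) * poly s z"
      using arg_cong[OF s, of "\<lambda>q. poly q z"] by (simp add: algebra_simps)
    then have "poly (v ^ N) z = 1 + (\<sigma> - z) * poly s z" by (simp add: algebra_simps)
    moreover have "\<sigma> - z \<noteq> 0" using nz \<eta>(1) by auto
    ultimately have "1 / (\<sigma> - z) - poly (- s) z = poly (v ^ N) z / (\<sigma> - z)"
      by (simp add: add_divide_distrib)
    then have "cmod (1 / (\<sigma> - z) - poly (- s) z) \<le> e' / \<eta>"
      using vN[OF z] nz \<eta>(1) e' by (simp add: norm_divide frac_le)
    also have "\<dots> \<le> e" using \<eta>(1) by (simp add: e'_def field_simps)
    finally show ?thesis .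
  qed
  moreover have "mat_norm (R - poly_mat (- s) A) \<le> e"
  proof -
    have "mat 1 - poly_mat (v ^ N) A = (A - mat \<sigma>) ** poly_mat s A"
      using arg_cong[OF s, of "\<lambda>q. poly_mat q A"] by (simp only: poly_mat_diff poly_mat_mult poly_mat_linear poly_mat_1)
    then have "poly_mat (v ^ N) A = mat 1 + (mat \<sigma> - A) ** poly_mat s A"
      by (simp add: matrix_diff_rdistrib algebra_simps)
    then have "R ** poly_mat (v ^ N) A = R + poly_mat s A"
      using R by (simp add: matrix_add_ldistrib matrix_mul_assoc)
    then have "mat_norm (R - poly_mat (- s) A) \<le> mat_norm R * mat_norm (poly_mat (v ^ N) A)"
      using mat_norm_mult[of R "poly_mat (v ^ N) A"] by (simp add: poly_mat_minus)
    also have "\<dots> \<le> mat_norm R * (K * e')"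
      using vN by (intro mult_left_mono K(2)) auto
    also have "\<dots> \<le> (mat_norm R * K + 1) * e'" using e' by (simp add: algebra_simps)
    also have "\<dots> \<le> (mat_norm R * K + 1) * (e / (mat_norm R * K + 1))"
      using K(1) by (intro mult_left_mono) (auto simp: e'_def)
    also have "\<dots> = e"
    proof -
      have "mat_norm R * K + 1 > 0" using K(1) by (simp add: add_nonneg_pos)
      then show ?thesis by simp
    qed
    finally show ?thesis .
  qed
  ultimately show "\<exists>p. (\<forall>z\<in>\<Omega>. cmod (1 / (\<sigma> - z) - poly p z) \<le> e) \<and> mat_norm (R - poly_mat p A) \<le> e"
    by blast
qed

section \<open>A discretized contour\<close>

lemma segment_point:
  assumes "0 \<le> t" "t \<le> 1"
  shows "a + of_real t * (b - a) \<in> closed_segment a (b :: complex)"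
  unfolding in_segment using assms
  by (intro exI[of _ t]) (simp add: scaleR_conv_of_real left_diff_distrib right_diff_distrib)

text \<open>On each of the M pieces the mean value inequality is applied to G minus the linear
  function of slope F at the left node. The error is quadratic in the step length, so the sum over
  all pieces is of order 1/M.\<close>

lemma riemann_sum_segment:
  fixes F G :: "complex \<Rightarrow> complex"
  assumes deriv: "\<And>s. s \<in> closed_segment a b \<Longrightarrow> (G has_field_derivative F s) (at s)"
    and lip: "\<And>s t. s \<in> closed_segment a b \<Longrightarrow> t \<in> closed_segment a b \<Longrightarrow> cmod (F s - F t) \<le> L * cmod (s - t)"
    and M: "M > 0" and L: "L \<ge> 0"
  shows "cmod ((\<Sum>j<M. F (a + of_real (real j / real M) * (b - a)) * ((b - a) / of_nat M)) - (G b - G a))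
    \<le> L * (cmod (b - a))\<^sup>2 / real M"
proof -
  define x where "x j = a + of_real (real j / real M) * (b - a)" for j
  have x_seg: "x j \<in> closed_segment a b" if "j \<le> M" for j
    unfolding x_def by (rule segment_point) (use that M in auto)
  have step: "x (Suc j) - x j = (b - a) / of_nat M" for j
  proof -
    have "x (Suc j) - x j = of_real (real (Suc j) / real M - real j / real M) * (b - a)"
      by (simp only: x_def of_real_diff left_diff_distrib) simp
    also have "real (Suc j) / real M - real j / real M = 1 / real M"
      unfolding diff_divide_distrib[symmetric] by simp
    finally show ?thesis by simp
  qed
  have piece: "cmod (F (x j) * ((b - a) / of_nat M) - (G (x (Suc j)) - G (x j))) \<le> L * (cmod (b - a) / real M)\<^sup>2"
    if j: "j < M" for j
  proof -
    let ?S = "closed_segment (x j) (x (Suc j))"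
    have sub: "?S \<subseteq> closed_segment a b"
      using x_seg[of j] x_seg[of "Suc j"] j by (simp add: subset_closed_segment)
    have len: "cmod (x (Suc j) - x j) = cmod (b - a) / real M"
      unfolding step by (simp add: norm_divide)
    have "cmod ((G (x (Suc j)) - F (x j) * x (Suc j)) - (G (x j) - F (x j) * x j))
        \<le> (L * (cmod (b - a) / real M)) * cmod (x (Suc j) - x j)"
    proof (rule field_differentiable_bound[where S = ?S and f' = "\<lambda>t. F t - F (x j)"])
      fix t assume t: "t \<in> ?S"
      show "((\<lambda>t. G t - F (x j) * t) has_field_derivative F t - F (x j)) (at t within ?S)"
        by (intro DERIV_diff has_field_derivative_at_within[OF deriv] DERIV_cmult_Id) (use t sub in auto)
      have "cmod (F t - F (x j)) \<le> L * cmod (t - x j)"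
        using t sub j by (intro lip x_seg) auto
      also have "\<dots> \<le> L * (cmod (b - a) / real M)"
        using segment_bound1[OF t] L unfolding len by (rule mult_left_mono)
      finally show "cmod (F t - F (x j)) \<le> L * (cmod (b - a) / real M)" .
    qed auto
    moreover have "(G (x (Suc j)) - F (x j) * x (Suc j)) - (G (x j) - F (x j) * x j)
        = - (F (x j) * ((b - a) / of_nat M) - (G (x (Suc j)) - G (x j)))"
      unfolding step[of j, symmetric] by (simp add: algebra_simps)
    ultimately show ?thesis
      unfolding len by (simp only: norm_minus_cancel power2_eq_square mult.assoc)
  qed
  have "x M = b" "x 0 = a" using M by (simp_all add: x_def)
  then have "G b - G a = (\<Sum>j<M. G (x (Suc j)) - G (x j))"
    by (simp add: sum_lessThan_telescope[of "\<lambda>j. G (x j)"])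
  then have "(\<Sum>j<M. F (x j) * ((b - a) / of_nat M)) - (G b - G a)
      = (\<Sum>j<M. F (x j) * ((b - a) / of_nat M) - (G (x (Suc j)) - G (x j)))"
    by (simp only: sum_subtractf)
  also have "cmod \<dots> \<le> (\<Sum>j<M. L * (cmod (b - a) / real M)\<^sup>2)"
    by (rule order_trans[OF norm_sum sum_mono]) (rule piece, simp)
  also have "\<dots> = L * (cmod (b - a))\<^sup>2 / real M"
    using M by (simp add: power2_eq_square)
  finally show ?thesis by (simp add: x_def)
qed

text \<open>The argument of u is below pi/2 in modulus, so a further turn by at most pi/2 does not
  reach the cut. Hence the logarithms belonging to neighbouring edges differ by exactly i \<alpha>
  at their common vertex.\<close>

lemma Ln_cis_mult:
  assumes "Re u > 0" "0 \<le> \<alpha>" "\<alpha> \<le> pi / 2"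
  shows "Ln (cis \<alpha> * u) = \<i> * of_real \<alpha> + Ln u"
proof -
  have u: "u \<noteq> 0" using assms(1) by auto
  then have "\<bar>Im (Ln u)\<bar> < pi / 2" by (rule Re_Ln_pos_lt[THEN iffD2, OF _ assms(1)])
  then have "Ln (exp (\<i> * of_real \<alpha> + Ln u)) = \<i> * of_real \<alpha> + Ln u"
    using assms by (intro Ln_exp) auto
  then show ?thesis using u by (simp add: exp_add cis_conv_exp)
qed

text \<open>The chord controls the loss when a vertex is measured in the preceding direction, the
  tangent the tilt of an edge against its ideal direction; N > 4 keeps the angle below pi/2.\<close>

lemma ex_contour_angle:
  assumes "D > 0" "\<epsilon> > 0"
  obtains N :: nat where "N > 4" "D * cmod (cis (2 * pi / real N) - 1) \<le> \<epsilon>" "D * tan (2 * pi / real N) \<le> \<epsilon>"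
proof -
  have lim: "(\<lambda>N. 2 * pi / real N) \<longlonglongrightarrow> 0" by (intro lim_const_over_n)
  have "isCont (\<lambda>x. D * cmod (cis x - 1)) 0" unfolding cis_conv_exp by (intro continuous_intros)
  from isCont_tendsto_compose[OF this lim]
  have 1: "(\<lambda>N. D * cmod (cis (2 * pi / real N) - 1)) \<longlonglongrightarrow> 0" by simp
  have "isCont (\<lambda>x. D * tan x) 0" by (intro continuous_intros) simp_all
  from isCont_tendsto_compose[OF this lim]
  have 2: "(\<lambda>N. D * tan (2 * pi / real N)) \<longlonglongrightarrow> 0" by simp
  have "\<forall>\<^sub>F N in sequentially. N > 4 \<and> D * cmod (cis (2 * pi / real N) - 1) < \<epsilon> \<and> D * tan (2 * pi / real N) < \<epsilon>"
    using eventually_gt_at_top[of 4] order_tendstoD(2)[OF 1 assms(2)] order_tendstoD(2)[OF 2 assms(2)]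
    by eventually_elim simp
  then obtain N where "N > 4 \<and> D * cmod (cis (2 * pi / real N) - 1) < \<epsilon> \<and> D * tan (2 * pi / real N) < \<epsilon>"
    using eventually_sequentially by auto
  then show thesis using that by fastforce
qed

lemma poly_lipschitz_on_compact_convex:
  fixes f :: "complex poly"
  assumes "compact W" "convex W"
  obtains L where "L \<ge> 0" "\<And>s t. s \<in> W \<Longrightarrow> t \<in> W \<Longrightarrow> cmod (poly f s - poly f t) \<le> L * cmod (s - t)"
proof -
  have "bounded (poly (pderiv f) ` W)"
    using assms by (intro compact_imp_bounded compact_continuous_image continuous_intros)
  then obtain L where L: "L > 0" "\<And>s. s \<in> W \<Longrightarrow> cmod (poly (pderiv f) s) \<le> L"
    unfolding bounded_pos by auto
  then have "cmod (poly f s - poly f t) \<le> L * cmod (s - t)" if "s \<in> W" "t \<in> W" for s t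
    using that assms by (intro field_differentiable_bound[where S = W and f' = "poly (pderiv f)"])
      (auto intro: DERIV_subset[OF poly_DERIV])
  then show thesis using that L(1) by (meson less_imp_le)
qed

text \<open>The polygon has the vertices \<open>p k\<close>, where \<open>p k\<close> maximizes the linear functional of
  direction \<open>2 \<pi> k / N\<close> on \<open>W\<close>.  Along the \<open>k\<close>th edge, the branch of the logarithm with cut
  opposite to this direction is a primitive, and the increments telescope to \<open>2 \<pi> \<i>\<close>.\<close>

locale support_polygon =
  fixes W \<Omega> :: "complex set" and \<epsilon> D :: real and N :: nat and p :: "nat \<Rightarrow> complex"
  assumes W: "compact W" "convex W"
    and \<epsilon>: "\<epsilon> > 0" and inside: "\<And>z. z \<in> \<Omega> \<Longrightarrow> cball z \<epsilon> \<subseteq> W"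
    and D: "D > 0" "\<And>s t. s \<in> W \<Longrightarrow> t \<in> W \<Longrightarrow> cmod (s - t) \<le> D"
    and N: "N > 4" "D * cmod (cis (2 * pi / real N) - 1) \<le> \<epsilon> / 2" "D * tan (2 * pi / real N) \<le> \<epsilon> / 2"
    and p_in: "\<And>k. p k \<in> W"
    and p_max: "\<And>k w. w \<in> W \<Longrightarrow> Re (cnj (cis (2 * pi * real k / real N)) * w) \<le> Re (cnj (cis (2 * pi * real k / real N)) * p k)"
    and p_closed: "p N = p 0"
begin

abbreviation \<alpha> where "\<alpha> \<equiv> 2 * pi / real N"

definition u :: "nat \<Rightarrow> complex" where "u k = cis (2 * pi * real k / real N)"

lemma u_Suc: "u (Suc k) = cis \<alpha> * u k"
  by (simp add: u_def cis_mult add_divide_distrib algebra_simps)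

lemma norm_u [simp]: "cmod (u k) = 1"
  by (simp add: u_def)

lemma cnj_u_mult_u: "cnj (u k) * u k = 1"
  by (simp add: u_def cis_cnj cis_mult)

lemma p_max': "w \<in> W \<Longrightarrow> Re (cnj (u k) * w) \<le> Re (cnj (u k) * p k)"
  unfolding u_def by (rule p_max)

lemma \<Omega>_W: "z \<in> \<Omega> \<Longrightarrow> z \<in> W"
  using inside[of z] \<epsilon> by auto

lemma Re_vertex:
  assumes "z \<in> \<Omega>"
  shows "\<epsilon> \<le> Re (cnj (u k) * (p k - z))"
proof -
  have "z + of_real \<epsilon> * u k \<in> W"
    using inside[OF assms] \<epsilon> by (auto simp: dist_norm norm_mult)
  from p_max'[OF this, of k] have "Re (cnj (u k) * z + of_real \<epsilon> * (cnj (u k) * u k)) \<le> Re (cnj (u k) * p k)"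
    by (simp add: algebra_simps)
  then show ?thesis unfolding cnj_u_mult_u by (simp add: algebra_simps)
qed

text \<open>The next vertex has distance at least \<epsilon> in its own direction; turning that
  direction back by \<alpha> costs at most the chord times D, which is half of \<epsilon>.\<close>

lemma Re_next_vertex:
  assumes "z \<in> \<Omega>"
  shows "\<epsilon> / 2 \<le> Re (cnj (u k) * (p (Suc k) - z))"
proof -
  let ?v = "p (Suc k) - z"
  have "cmod ((cnj (u (Suc k)) - cnj (u k)) * ?v) = cmod (cis \<alpha> - 1) * cmod ?v"
  proof -
    have "cmod (cnj (u (Suc k)) - cnj (u k)) = cmod (u (Suc k) - u k)"
      by (simp flip: complex_cnj_diff)
    also have "u (Suc k) - u k = (cis \<alpha> - 1) * u k" by (simp add: u_Suc algebra_simps)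
    finally show ?thesis by (simp add: norm_mult)
  qed
  also have "\<dots> \<le> cmod (cis \<alpha> - 1) * D"
    using assms by (intro mult_left_mono D(2) p_in \<Omega>_W) auto
  also have "\<dots> \<le> \<epsilon> / 2" using N(2) by (simp add: mult.commute)
  finally have "Re ((cnj (u (Suc k)) - cnj (u k)) * ?v) \<le> \<epsilon> / 2"
    using complex_Re_le_cmod order_trans by blast
  moreover have "\<epsilon> \<le> Re (cnj (u (Suc k)) * ?v)" by (rule Re_vertex[OF assms])
  ultimately show ?thesis unfolding left_diff_distrib minus_complex.sel by linarith
qed

lemma edge_in_W: "s \<in> closed_segment (p k) (p (Suc k)) \<Longrightarrow> s \<in> W"
  using closed_segment_subset[OF p_in p_in W(2)] by blast

lemma Re_edge:
  assumes "z \<in> \<Omega>" "s \<in> closed_segment (p k) (p (Suc k))"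
  shows "\<epsilon> / 2 \<le> Re (cnj (u k) * (s - z))"
proof -
  obtain t where t: "0 \<le> t" "t \<le> 1" "s = (1 - t) *\<^sub>R p k + t *\<^sub>R p (Suc k)"
    using assms(2) by (auto simp: in_segment)
  have "cnj (u k) * (s - z) = (1 - t) *\<^sub>R (cnj (u k) * (p k - z)) + t *\<^sub>R (cnj (u k) * (p (Suc k) - z))"
    unfolding t(3) by (simp add: scaleR_conv_of_real algebra_simps)
  then have "Re (cnj (u k) * (s - z)) = (1 - t) * Re (cnj (u k) * (p k - z)) + t * Re (cnj (u k) * (p (Suc k) - z))"
    by (simp only: plus_complex.sel scaleR_complex.sel)
  moreover have "\<epsilon> / 2 \<le> Re (cnj (u k) * (p k - z))" using Re_vertex[OF assms(1), of k] \<epsilon> by linarith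
  ultimately show ?thesis
    using segment_bound_lemma[of "\<epsilon> / 2", OF _ Re_next_vertex[OF assms(1)] t(1,2)] by simp
qed

lemma norm_edge:
  assumes "z \<in> \<Omega>" "s \<in> closed_segment (p k) (p (Suc k))"
  shows "\<epsilon> / 2 \<le> cmod (s - z)"
proof -
  have "\<epsilon> / 2 \<le> cmod (cnj (u k) * (s - z))"
    using Re_edge[OF assms] complex_Re_le_cmod order_trans by blast
  then show ?thesis by (simp add: norm_mult)
qed

text \<open>The edge points nearly in the direction \<open>\<i> u k\<close>, and \<open>s - z\<close> has a component of at least
  \<open>\<epsilon> / 2\<close> in the direction \<open>u k\<close>.\<close>

lemma kernel_nonneg:
  assumes "z \<in> \<Omega>" "s \<in> closed_segment (p k) (p (Suc k))"
  shows "0 \<le> Re (- \<i> * (p (Suc k) - p k) * cnj (s - z))"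
proof -
  define \<tau> where "\<tau> = p (Suc k) - p k"
  define v where "v = cnj (u k) * (- \<i> * \<tau>)"
  define y where "y = cnj (u k) * (s - z)"
  have \<alpha>: "0 < \<alpha>" "\<alpha> < pi / 2" using N(1) by (simp_all add: field_simps)
  have c: "cos \<alpha> > 0" and s: "sin \<alpha> > 0" using \<alpha> by (auto intro!: cos_gt_zero sin_gt_zero)
  \<comment> \<open>Maximality of \<open>p k\<close> and \<open>p (Suc k)\<close> in their
    respective directions confines \<open>v\<close> to the sector of arguments between 0 and
    \<alpha>; argument 0 would mean an edge exactly in the direction i u k.\<close>
  have "Re (cnj (u k) * \<tau>) \<le> 0"
    using p_max'[OF p_in, of k "Suc k"] by (simp only: \<tau>_def right_diff_distrib minus_complex.sel)
  then have Im_v: "Im v \<ge> 0" by (simp add: v_def algebra_simps)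
  have "0 \<le> Re (cnj (u (Suc k)) * \<tau>)"
    using p_max'[OF p_in, of "Suc k" k] by (simp only: \<tau>_def right_diff_distrib minus_complex.sel)
  also have "cnj (u (Suc k)) * \<tau> = cnj (cis \<alpha>) * (\<i> * v)"
  proof -
    have "\<i> * v = cnj (u k) * \<tau>" by (simp add: complex_eq_iff v_def algebra_simps)
    then show ?thesis by (simp add: u_Suc)
  qed
  also have "Re \<dots> = sin \<alpha> * Re v - cos \<alpha> * Im v" by simp
  finally have *: "cos \<alpha> * Im v \<le> sin \<alpha> * Re v" by simp
  then have "0 \<le> sin \<alpha> * Re v" using c Im_v by (meson mult_nonneg_nonneg less_imp_le order_trans)
  then have Re_v: "Re v \<ge> 0" using s by (simp add: zero_le_mult_iff)
  have Im_le: "Im v \<le> tan \<alpha> * Re v" using * c by (simp add: tan_def field_simps)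
  have y: "\<epsilon> / 2 \<le> Re y" unfolding y_def by (rule Re_edge[OF assms])
  have "\<bar>Im y\<bar> \<le> cmod y" by (rule abs_Im_le_cmod)
  also have "cmod y = cmod (s - z)" by (simp add: y_def norm_mult)
  also have "\<dots> \<le> D" using assms by (intro D(2) edge_in_W \<Omega>_W)
  finally have "Im v * Im y \<ge> - (Im v * D)"
    using Im_v mult_left_mono[of "- D" "Im y" "Im v"] by simp
  moreover have "Im v * D \<le> Re v * (\<epsilon> / 2)"
  proof -
    have "Im v * D \<le> tan \<alpha> * Re v * D" using Im_le D(1) by (intro mult_right_mono) auto
    also have "\<dots> = Re v * (D * tan \<alpha>)" by simp
    also have "\<dots> \<le> Re v * (\<epsilon> / 2)" by (rule mult_left_mono[OF N(3) Re_v])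
    finally show ?thesis .
  qed
  moreover have "Re v * (\<epsilon> / 2) \<le> Re v * Re y" by (rule mult_left_mono[OF y Re_v])
  ultimately have "0 \<le> Re v * Re y + Im v * Im y" by linarith
  also have "\<dots> = Re (v * cnj y)" by simp
  also have "v * cnj y = (cnj (u k) * u k) * (- \<i> * \<tau> * cnj (s - z))"
    by (simp add: v_def y_def)
  finally show ?thesis unfolding cnj_u_mult_u by (simp add: \<tau>_def)
qed

text \<open>Each change of branch at a vertex contributes i \<alpha>, and N \<alpha> = 2 pi. The
  remaining differences cancel, since vertices and directions both close up after N steps.\<close>

lemma telescoping_logarithms:
  assumes "z \<in> \<Omega>"
  shows "(\<Sum>k<N. Ln (cnj (u k) * (p (Suc k) - z)) - Ln (cnj (u k) * (p k - z))) = 2 * of_real pi * \<i>"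
proof -
  define l where "l k = Ln (cnj (u k) * (p k - z))" for k
  have "Ln (cnj (u k) * (p (Suc k) - z)) = \<i> * of_real \<alpha> + l (Suc k)" for k
  proof -
    have "cnj (u k) = cis \<alpha> * cnj (u (Suc k))"
    proof -
      have "cis \<alpha> * cnj (u (Suc k)) = (cis \<alpha> * cnj (cis \<alpha>)) * cnj (u k)" by (simp add: u_Suc)
      also have "cis \<alpha> * cnj (cis \<alpha>) = 1" by (simp add: cis_cnj cis_mult)
      finally show ?thesis by simp
    qed
    then have eq: "cnj (u k) * (p (Suc k) - z) = cis \<alpha> * (cnj (u (Suc k)) * (p (Suc k) - z))"
      by (simp only: mult.assoc)
    show ?thesis
      unfolding eq l_def
    proof (rule Ln_cis_mult)
      show "0 < Re (cnj (u (Suc k)) * (p (Suc k) - z))" using Re_vertex[OF assms, of "Suc k"] \<epsilon> by linarith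
    qed (use N(1) in \<open>simp_all add: field_simps\<close>)
  qed
  then have "(\<Sum>k<N. Ln (cnj (u k) * (p (Suc k) - z)) - Ln (cnj (u k) * (p k - z)))
      = (\<Sum>k<N. \<i> * of_real \<alpha> + (l (Suc k) - l k))"
    by (simp add: l_def algebra_simps)
  also have "\<dots> = of_nat N * (\<i> * of_real \<alpha>) + (l N - l 0)"
    by (simp only: sum.distrib sum_lessThan_telescope sum_constant card_lessThan)
  also have "l N = l 0" using N(1) by (simp add: l_def p_closed u_def)
  finally show ?thesis using N(1) by simp
qed

text \<open>One M0 serves every z: the edges keep the distance \<epsilon> / 2 from \<Omega>, so all
  integrands share the Lipschitz constant \<open>L'\<close>, and each of the N edges has an error of
  order 1/M.\<close>

lemma riemann_sums:
  fixes f :: "complex poly"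
  assumes "\<eta> > 0"
  shows "\<exists>M0. \<forall>M\<ge>M0. M > 0 \<longrightarrow> (\<forall>z\<in>\<Omega>. cmod ((\<Sum>k<N. \<Sum>j<M.
      poly f (p k + of_real (real j / real M) * (p (Suc k) - p k))
        / (p k + of_real (real j / real M) * (p (Suc k) - p k) - z)
        * ((p (Suc k) - p k) / of_nat M)) - 2 * of_real pi * \<i> * poly f z) \<le> \<eta>)"
proof -
  obtain L where L: "L \<ge> 0" "\<And>s t. s \<in> W \<Longrightarrow> t \<in> W \<Longrightarrow> cmod (poly f s - poly f t) \<le> L * cmod (s - t)"
    using poly_lipschitz_on_compact_convex[OF W] by blast
  have "bounded (poly f ` W)"
    using W(1) by (intro compact_imp_bounded compact_continuous_image continuous_intros)
  then obtain B where B: "B > 0" "\<And>s. s \<in> W \<Longrightarrow> cmod (poly f s) \<le> B"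
    unfolding bounded_pos by auto
  define e where "e = \<epsilon> / 2"
  have e: "e > 0" using \<epsilon> by (simp add: e_def)
  define L' where "L' = L / e + B / (e * e)"
  have L': "L' \<ge> 0" using L(1) B(1) e by (simp add: L'_def)
  have lip: "cmod (poly f s / (s - z) - poly f t / (t - z)) \<le> L' * cmod (s - t)"
    if z: "z \<in> \<Omega>" and s: "s \<in> closed_segment (p k) (p (Suc k))"
      and t: "t \<in> closed_segment (p k) (p (Suc k))" for z s t k
  proof -
    have ns: "e \<le> cmod (s - z)" and nt: "e \<le> cmod (t - z)"
      using norm_edge[OF z s] norm_edge[OF z t] by (simp_all add: e_def)
    then have nz: "s - z \<noteq> 0" "t - z \<noteq> 0" using e by auto
    have "poly f s / (s - z) - poly f t / (t - z)
        = (poly f s - poly f t) / (s - z) + poly f t * (t - s) / ((s - z) * (t - z))"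
      using nz by (simp add: divide_simps) (simp add: algebra_simps)
    also have "cmod \<dots> \<le> L * cmod (s - t) / e + B * cmod (s - t) / (e * e)"
    proof (rule order_trans[OF norm_triangle_ineq add_mono])
      show "cmod ((poly f s - poly f t) / (s - z)) \<le> L * cmod (s - t) / e"
        unfolding norm_divide using L edge_in_W[OF s] edge_in_W[OF t] ns e by (intro frac_le) auto
      have "cmod (t - s) = cmod (s - t)" by (rule norm_minus_commute)
      then show "cmod (poly f t * (t - s) / ((s - z) * (t - z))) \<le> B * cmod (s - t) / (e * e)"
        unfolding norm_divide norm_mult using B edge_in_W[OF t] ns nt e
        by (intro frac_le mult_mono) auto
    qed
    also have "\<dots> = L' * cmod (s - t)" by (simp add: L'_def algebra_simps)
    finally show ?thesis .
  qed
  define E where "E = real N * (L' * D\<^sup>2)"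
  have E: "E \<ge> 0" using L' by (simp add: E_def)
  obtain M0 :: nat where M0: "E / \<eta> \<le> real M0" using real_arch_simple by blast
  show ?thesis
  proof (intro exI[of _ M0] allI impI ballI)
    fix M z assume M: "M0 \<le> M" "M > 0" and z: "z \<in> \<Omega>"
    \<comment> \<open>The integrand is split into the polynomial \<open>?t\<close>, whose entire
      primitive P contributes nothing around the closed polygon, and f(z)/(s - z), whose primitive
      along each edge is a logarithm.\<close>
    let ?t = "synthetic_div f z"
    have t: "poly f s = (s - z) * poly ?t s + poly f z" for s
      using arg_cong[OF synthetic_div_correct'[of z f], of "\<lambda>q. poly q s"] by (simp add: algebra_simps)
    have "poly ?t holomorphic_on UNIV" by (intro holomorphic_intros)
    from holomorphic_convex_primitive'[OF convex_UNIV open_UNIV this]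
    obtain P where P: "\<And>s. (P has_field_derivative poly ?t s) (at s)" by auto
    define G where "G k s = poly f z * Ln (cnj (u k) * (s - z)) + P s" for k s
    define S where "S k = (\<Sum>j<M. poly f (p k + of_real (real j / real M) * (p (Suc k) - p k))
        / (p k + of_real (real j / real M) * (p (Suc k) - p k) - z) * ((p (Suc k) - p k) / of_nat M))" for k
    have "cmod (S k - (G k (p (Suc k)) - G k (p k))) \<le> L' * D\<^sup>2 / real M" for k
    proof -
      have "cmod (S k - (G k (p (Suc k)) - G k (p k))) \<le> L' * (cmod (p (Suc k) - p k))\<^sup>2 / real M"
        unfolding S_def
      proof (rule riemann_sum_segment[where F = "\<lambda>s. poly f s / (s - z)"])
        fix s assume s: "s \<in> closed_segment (p k) (p (Suc k))"
        have "0 < Re (cnj (u k) * (s - z))" using Re_edge[OF z s] \<epsilon> by linarith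
        then have nonpos: "cnj (u k) * (s - z) \<notin> \<real>\<^sub>\<le>\<^sub>0" by (auto simp only: complex_nonpos_Reals_iff)
        have nz: "s - z \<noteq> 0" "cnj (u k) \<noteq> 0" using nonpos by auto
        have "((\<lambda>s. Ln (cnj (u k) * (s - z))) has_field_derivative inverse (cnj (u k) * (s - z)) * cnj (u k)) (at s)"
          by (rule DERIV_chain2[where f = Ln and g = "\<lambda>s. cnj (u k) * (s - z)", OF has_field_derivative_Ln[OF nonpos]]) (auto intro!: derivative_eq_intros)
        from DERIV_add[OF DERIV_cmult[OF this, of "poly f z"] P[of s]]
        have "(G k has_field_derivative poly f z * (inverse (cnj (u k) * (s - z)) * cnj (u k)) + poly ?t s) (at s)"
          by (simp only: G_def[abs_def])
        moreover have "poly f z * (inverse (cnj (u k) * (s - z)) * cnj (u k)) + poly ?t s = poly f s / (s - z)"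
          using nz unfolding t[of s] by (simp add: field_simps)
        ultimately show "(G k has_field_derivative poly f s / (s - z)) (at s)" by simp
      qed (use lip[OF z] M L' in auto)
      also have "\<dots> \<le> L' * D\<^sup>2 / real M"
        using L' D p_in by (intro divide_right_mono mult_left_mono power_mono) auto
      finally show ?thesis .
    qed
    moreover have "(\<Sum>k<N. G k (p (Suc k)) - G k (p k)) = 2 * of_real pi * \<i> * poly f z"
    proof -
      have "(\<Sum>k<N. G k (p (Suc k)) - G k (p k))
          = poly f z * (\<Sum>k<N. Ln (cnj (u k) * (p (Suc k) - z)) - Ln (cnj (u k) * (p k - z)))
            + (\<Sum>k<N. P (p (Suc k)) - P (p k))"
        unfolding sum_distrib_left sum.distrib[symmetric]
        by (intro sum.cong refl) (simp only: G_def algebra_simps)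
      also have "(\<Sum>k<N. P (p (Suc k)) - P (p k)) = 0"
        by (simp only: sum_lessThan_telescope[of "\<lambda>k. P (p k)"] p_closed diff_self)
      finally show ?thesis unfolding telescoping_logarithms[OF z] by simp
    qed
    ultimately have "cmod ((\<Sum>k<N. S k) - 2 * of_real pi * \<i> * poly f z) \<le> (\<Sum>k<N. L' * D\<^sup>2 / real M)"
      by (metis (no_types, lifting) sum_norm_le sum_subtractf)
    also have "\<dots> = E / real M" by (simp add: E_def)
    also have "\<dots> \<le> \<eta>"
    proof -
      have "E / \<eta> \<le> real M" using M0 M by linarith
      then show ?thesis using assms M by (simp add: field_simps)
    qed
    finally show "cmod ((\<Sum>k<N. \<Sum>j<M.
      poly f (p k + of_real (real j / real M) * (p (Suc k) - p k))
        / (p k + of_real (real j / real M) * (p (Suc k) - p k) - z)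
        * ((p (Suc k) - p k) / of_nat M)) - 2 * of_real pi * \<i> * poly f z) \<le> \<eta>"
      by (simp only: S_def)
  qed
qed

end

section \<open>Quadrature nodes and weights on the support polygon\<close>

lemma ex_support_points:
  fixes W :: "complex set"
  assumes "compact W" "W \<noteq> {}"
  obtains sel where "\<And>v. sel v \<in> W" "\<And>v w. w \<in> W \<Longrightarrow> Re (cnj v * w) \<le> Re (cnj v * sel v)"
proof -
  have "\<exists>x\<in>W. \<forall>w\<in>W. Re (cnj v * w) \<le> Re (cnj v * x)" for v
    by (rule continuous_attains_sup[OF assms]) (intro continuous_intros)
  then show thesis using that by metis
qed

text \<open>The quadrature nodes \<open>\<sigma> i\<close> and weights \<open>\<tau> i\<close> of a discretized Cauchy integral.\<close>

lemma ex_discrete_contour: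
  fixes f :: "complex poly"
  assumes W: "compact W" "convex W" and \<epsilon>: "\<epsilon> > 0"
    and inside': "\<forall>z\<in>\<Omega>. cball z \<epsilon> \<subseteq> W" and "\<Omega> \<noteq> {}" and \<eta>: "\<eta> > 0"
  shows "\<exists>(I :: (nat \<times> nat) set) \<sigma> \<tau> v. finite I \<and>
    (\<forall>i\<in>I. \<sigma> i \<in> W) \<and> (\<forall>i\<in>I. cmod (v i) = 1) \<and>
    (\<forall>i\<in>I. \<forall>z\<in>\<Omega>. \<epsilon> / 2 \<le> Re (cnj (v i) * (\<sigma> i - z))) \<and>
    (\<forall>i\<in>I. \<forall>z\<in>\<Omega>. 0 \<le> Re (- \<i> * \<tau> i * cnj (\<sigma> i - z))) \<and>
    (\<forall>z\<in>\<Omega>. cmod ((\<Sum>i\<in>I. \<tau> i / (\<sigma> i - z)) - 2 * of_real pi * \<i>) \<le> \<eta>) \<and>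
    (\<forall>z\<in>\<Omega>. cmod ((\<Sum>i\<in>I. poly f (\<sigma> i) * \<tau> i / (\<sigma> i - z)) - 2 * of_real pi * \<i> * poly f z) \<le> \<eta>)"
proof -
  note inside = bspec[OF inside']
  obtain z0 where z0: "z0 \<in> \<Omega>" using \<open>\<Omega> \<noteq> {}\<close> by blast
  then have ne: "W \<noteq> {}" using inside[OF z0] \<epsilon> by auto
  define D where "D = diameter W + 1"
  have D: "D > 0" using diameter_ge_0[OF compact_imp_bounded[OF W(1)]] by (simp add: D_def)
  have diam: "cmod (s - t) \<le> D" if "s \<in> W" "t \<in> W" for s t
    using diameter_bounded_bound[OF compact_imp_bounded[OF W(1)] that] by (simp add: D_def dist_norm)
  have "\<epsilon> / 2 > 0" using \<epsilon> by simp
  then obtain N :: nat where N: "N > 4" "D * cmod (cis (2 * pi / real N) - 1) \<le> \<epsilon> / 2"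
    "D * tan (2 * pi / real N) \<le> \<epsilon> / 2"
    using ex_contour_angle[OF D] by blast
  obtain sel where sel: "\<And>v. sel v \<in> W" "\<And>v w. w \<in> W \<Longrightarrow> Re (cnj v * w) \<le> Re (cnj v * sel v)"
    using ex_support_points[OF W(1) ne] by blast
  define p where "p k = sel (cis (2 * pi * real k / real N))" for k
  have p: "p k \<in> W" "p N = p 0" for k
    using N(1) sel(1) by (simp_all add: p_def)
  have p_max: "Re (cnj (cis (2 * pi * real k / real N)) * w) \<le> Re (cnj (cis (2 * pi * real k / real N)) * p k)"
    if "w \<in> W" for k w
    unfolding p_def using that by (rule sel(2))
  interpret support_polygon W \<Omega> \<epsilon> D N p
    by (rule support_polygon.intro[OF W \<epsilon> inside D diam N p(1) p_max p(2)])
  obtain M1 where M1: "\<And>M z. M \<ge> M1 \<Longrightarrow> M > 0 \<Longrightarrow> z \<in> \<Omega> \<Longrightarrow> cmod ((\<Sum>k<N. \<Sum>j<M.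
      poly 1 (p k + of_real (real j / real M) * (p (Suc k) - p k))
        / (p k + of_real (real j / real M) * (p (Suc k) - p k) - z)
        * ((p (Suc k) - p k) / of_nat M)) - 2 * of_real pi * \<i> * poly 1 z) \<le> \<eta>"
    using riemann_sums[OF \<eta>, of 1] by blast
  obtain M2 where M2: "\<And>M z. M \<ge> M2 \<Longrightarrow> M > 0 \<Longrightarrow> z \<in> \<Omega> \<Longrightarrow> cmod ((\<Sum>k<N. \<Sum>j<M.
      poly f (p k + of_real (real j / real M) * (p (Suc k) - p k))
        / (p k + of_real (real j / real M) * (p (Suc k) - p k) - z)
        * ((p (Suc k) - p k) / of_nat M)) - 2 * of_real pi * \<i> * poly f z) \<le> \<eta>"
    using riemann_sums[OF \<eta>, of f] by blast
  \<comment> \<open>A common subdivision for the integrands belonging to 1 and to f; the summand 1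
    makes it positive.\<close>
  define M where "M = M1 + M2 + 1"
  have M: "M \<ge> M1" "M \<ge> M2" "M > 0" by (simp_all add: M_def)
  define I where "I = {..<N} \<times> {..<M}"
  define \<sigma> where "\<sigma> = (\<lambda>(k, j). p k + of_real (real j / real M) * (p (Suc k) - p k))"
  define \<tau> where "\<tau> = (\<lambda>(k, j :: nat). (p (Suc k) - p k) / of_nat M)"
  have seg: "\<sigma> (k, j) \<in> closed_segment (p k) (p (Suc k))" if "(k, j) \<in> I" for k j
    unfolding \<sigma>_def prod.case by (rule segment_point) (use that in \<open>auto simp: I_def\<close>)
  have sums: "(\<Sum>i\<in>I. poly g (\<sigma> i) * \<tau> i / (\<sigma> i - z)) = (\<Sum>k<N. \<Sum>j<M.
      poly g (p k + of_real (real j / real M) * (p (Suc k) - p k))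
        / (p k + of_real (real j / real M) * (p (Suc k) - p k) - z)
        * ((p (Suc k) - p k) / of_nat M))" for g z
    unfolding I_def sum.cartesian_product by (intro sum.cong) (auto simp: \<sigma>_def \<tau>_def)
  show ?thesis
  proof (rule exI[of _ I], rule exI[of _ \<sigma>], rule exI[of _ \<tau>],
      rule exI[of _ "\<lambda>i. u (fst i)"], intro conjI ballI)
    show "finite I" by (simp add: I_def)
    fix z assume z: "z \<in> \<Omega>"
    show "cmod ((\<Sum>i\<in>I. \<tau> i / (\<sigma> i - z)) - 2 * of_real pi * \<i>) \<le> \<eta>"
      using M1[OF M(1,3) z] unfolding sums[symmetric] by simp
    show "cmod ((\<Sum>i\<in>I. poly f (\<sigma> i) * \<tau> i / (\<sigma> i - z)) - 2 * of_real pi * \<i> * poly f z) \<le> \<eta>"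
      using M2[OF M(2,3) z] unfolding sums[symmetric] .
  next
    fix i assume "i \<in> I"
    then obtain k j where i: "i = (k, j)" "(k, j) \<in> I" by (cases i) auto
    show "\<sigma> i \<in> W" unfolding i(1) by (rule edge_in_W[OF seg[OF i(2)]])
    show "cmod (u (fst i)) = 1" by simp
    fix z assume z: "z \<in> \<Omega>"
    show "\<epsilon> / 2 \<le> Re (cnj (u (fst i)) * (\<sigma> i - z))"
      unfolding i(1) fst_conv by (rule Re_edge[OF z seg[OF i(2)]])
    have "- \<i> * \<tau> i * cnj (\<sigma> i - z) = of_real (1 / real M) * (- \<i> * (p (Suc k) - p k) * cnj (\<sigma> (k, j) - z))"
      by (simp add: i(1) \<tau>_def)
    then have "Re (- \<i> * \<tau> i * cnj (\<sigma> i - z)) = 1 / real M * Re (- \<i> * (p (Suc k) - p k) * cnj (\<sigma> (k, j) - z))"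
      by (simp only: Re_complex_of_real times_complex.sel Im_complex_of_real mult_zero_left diff_zero)
    then show "0 \<le> Re (- \<i> * \<tau> i * cnj (\<sigma> i - z))"
      using kernel_nonneg[OF z seg[OF i(2)]] by simp
  qed
qed

section \<open>A spectral constant for the numerical range\<close>

lemma ex_resolvent:
  fixes A :: "complex^'n^'n"
  assumes "\<sigma> \<notin> mat_spectrum A"
  obtains R where "R ** (mat \<sigma> - A) = mat 1" "(mat \<sigma> - A) ** R = mat 1"
proof -
  have "x = 0" if "(mat \<sigma> - A) *v x = 0" for x
  proof (rule ccontr)
    assume "x \<noteq> 0"
    moreover have "A *v x = \<sigma> *s x"
      using that by (simp add: matrix_vector_mult_diff_rdistrib mat_vector_mult)
    ultimately show False using assms by (auto simp: mat_spectrum_def)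
  qed
  then obtain R where "R ** (mat \<sigma> - A) = mat 1" using matrix_left_invertible_ker by metis
  then show thesis using that matrix_left_right_inverse by metis
qed

text \<open>The sum of \<Omega> and a small closed disc is again compact and convex. Uniform
  continuity is used on the fixed set \<open>N 1\<close>, which contains \<open>N \<epsilon>\<close>
  because \<epsilon> is at most 1.\<close>

lemma ex_convex_neighbourhood:
  fixes f :: "complex poly"
  assumes \<Omega>: "compact \<Omega>" "convex \<Omega>" and b': "\<forall>z\<in>\<Omega>. cmod (poly f z) \<le> b" and \<eta>: "\<eta> > 0"
  shows "\<exists>W \<epsilon>. compact W \<and> convex W \<and> 0 < \<epsilon> \<and> (\<forall>z\<in>\<Omega>. cball z \<epsilon> \<subseteq> W) \<and>
    (\<forall>z\<in>W. cmod (poly f z) \<le> b + \<eta>)"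
proof -
  note b = bspec[OF b']
  define N where "N r = (\<Union>x\<in>\<Omega>. \<Union>y\<in>cball 0 r. {x + y})" for r :: real
  have N: "compact (N r)" "convex (N r)" for r
    unfolding N_def by (intro compact_sums' \<Omega> compact_cball convex_sums convex_cball)+
  have "uniformly_continuous_on (N 1) (poly f)"
    by (intro compact_uniformly_continuous N continuous_intros)
  then obtain \<delta> where \<delta>: "\<delta> > 0"
    "\<And>x y. x \<in> N 1 \<Longrightarrow> y \<in> N 1 \<Longrightarrow> dist y x < \<delta> \<Longrightarrow> dist (poly f y) (poly f x) < \<eta>"
    using \<eta> unfolding uniformly_continuous_on_def by metis
  define \<epsilon> where "\<epsilon> = min 1 (\<delta> / 2)"
  have \<epsilon>: "\<epsilon> > 0" "\<epsilon> \<le> 1" "\<epsilon> < \<delta>" using \<delta>(1) by (auto simp: \<epsilon>_def)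
  have "cball z \<epsilon> \<subseteq> N \<epsilon>" if "z \<in> \<Omega>" for z
  proof
    fix w assume "w \<in> cball z \<epsilon>"
    then show "w \<in> N \<epsilon>" unfolding N_def using that
      by (intro UN_I[of z] UN_I[of "w - z"]) (auto simp: dist_norm norm_minus_commute)
  qed
  moreover have "cmod (poly f w) \<le> b + \<eta>" if w: "w \<in> N \<epsilon>" for w
  proof -
    obtain x y where xy: "x \<in> \<Omega>" "cmod y \<le> \<epsilon>" "w = x + y" using w unfolding N_def UN_iff singleton_iff by (metis mem_cball_0)
    have "x \<in> N 1" unfolding N_def using xy by (intro UN_I[of x] UN_I[of 0]) auto
    moreover have "w \<in> N 1" unfolding N_def using xy \<epsilon> by (intro UN_I[of x] UN_I[of y]) auto
    moreover have "dist w x < \<delta>" using xy \<epsilon> by (simp add: dist_norm)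
    ultimately have "dist (poly f w) (poly f x) < \<eta>" by (intro \<delta>(2))
    then show ?thesis using b[OF xy(1)] norm_triangle_sub[of "poly f w" "poly f x"] by (simp add: dist_norm)
  qed
  ultimately show ?thesis using N \<epsilon>(1) by (intro exI[of _ "N \<epsilon>"] exI[of _ \<epsilon>]) blast
qed

section \<open>Positivity of the Cauchy kernel and of sums of forms\<close>

lemma divide_two_pi_i: "\<tau> / (2 * of_real pi * \<i>) = of_real (inverse (2 * pi)) * (- \<i> * \<tau>)"
proof -
  have "(2 * of_real pi * \<i>) * (of_real (inverse (2 * pi)) * - \<i>)
      = of_real (2 * pi * inverse (2 * pi)) * (\<i> * - \<i>)"
    unfolding of_real_mult of_real_numeral by (simp only: mult_ac)
  also have "\<dots> = 1" by simp
  finally have "inverse (2 * of_real pi * \<i>) = of_real (inverse (2 * pi)) * - \<i>"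
    by (rule inverse_unique)
  then show ?thesis by (simp only: divide_inverse mult_ac)
qed

text \<open>Reduces the sign of the real part of the Cauchy kernel to that of
  \<open>- \<i> * \<tau> * cnj w\<close>, the quantity that the polygon controls.\<close>

lemma cauchy_kernel_eq:
  "\<tau> / (2 * of_real pi * \<i>) * (1 / w)
    = of_real (1 / (2 * pi * (cmod w)\<^sup>2)) * (- \<i> * \<tau> * cnj w)"
proof -
  have 1: "1 / w = cnj w * of_real (inverse ((cmod w)\<^sup>2))"
    unfolding complex_div_cnj[of 1 w] by (simp add: divide_inverse)
  have 3: "complex_of_real (1 / (2 * pi * (cmod w)\<^sup>2)) = of_real (inverse (2 * pi)) * of_real (inverse ((cmod w)\<^sup>2))"
    by (simp only: divide_inverse inverse_mult_distrib mult_1_left of_real_mult)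
  show ?thesis unfolding 1 3 divide_two_pi_i by (simp only: mult_ac)
qed

text \<open>Cauchy--Schwarz for each positive form, in the additive version with the mean of the two
  diagonal values: it can be summed over i, and the diagonal values of the total are bounded by its
  norm.\<close>

lemma norm_sum_positive_forms_le:
  fixes P :: "'i \<Rightarrow> complex^'n^'n"
  assumes P: "\<And>i x. i \<in> I \<Longrightarrow> 0 \<le> Re (hinner x (P i *v x))"
    and herm: "\<And>i. i \<in> I \<Longrightarrow> conj_transpose (P i) = P i"
    and c: "\<And>i. i \<in> I \<Longrightarrow> cmod (c i) \<le> b" and b: "b \<ge> 0"
  shows "mat_norm (\<Sum>i\<in>I. mat (c i) ** P i) \<le> b * mat_norm (\<Sum>i\<in>I. P i)"
proof (cases "finite I")
  case False
  then show ?thesis using b by simp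
next
  case True
  have mv: "(\<Sum>i\<in>I. Q i) *v x = (\<Sum>i\<in>I. Q i *v x)" for Q :: "'i \<Rightarrow> complex^'n^'n" and x
    using True by (induction I rule: finite_induct) (simp_all add: matrix_vector_mult_add_rdistrib)
  have cs: "cmod (hinner y (P i *v x)) \<le> (Re (hinner x (P i *v x)) + Re (hinner y (P i *v y))) / 2"
    if i: "i \<in> I" for i x y
  proof -
    define h where "h = hinner y (P i *v x)"
    have hc: "hinner x (P i *v y) = cnj h"
      unfolding h_def cnj_hinner using herm[OF i] conj_transpose_hinner[of "P i" x y] by simp
    \<comment> \<open>Aligning the phase of y makes positivity at \<open>x - w *s y\<close> bound
      the modulus of \<open>h\<close>, and not merely its real part.\<close>
    define w where "w = (if h = 0 then 1 else h / of_real (cmod h))"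
    have w: "cnj w * w = 1" "cnj w * h = of_real (cmod h)"
    proof -
      have "cmod w = 1" by (simp add: w_def norm_divide)
      then show "cnj w * w = 1" using complex_norm_square[of w] by (simp add: mult.commute)
      show "cnj w * h = of_real (cmod h)"
        using complex_norm_square[of h] by (simp add: w_def power2_eq_square field_simps)
    qed
    have w': "w * cnj h = of_real (cmod h)" using arg_cong[OF w(2), of cnj] by simp
    have "0 \<le> Re (hinner (x - w *s y) (P i *v (x - w *s y)))" by (rule P[OF i])
    also have "hinner (x - w *s y) (P i *v (x - w *s y))
        = hinner x (P i *v x) - w * cnj h - cnj w * h + (cnj w * w) * hinner y (P i *v y)"
      by (simp add: matrix_vector_mult_diff_distrib vector_scale_commute hinner_simps hc h_def[symmetric] algebra_simps)
    finally show ?thesis unfolding w w' h_def[symmetric] by simp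
  qed
  show ?thesis
  proof (rule mat_norm_le_hinner)
    fix x y :: "complex^'n" assume xy: "norm x = 1" "norm y = 1"
    let ?S = "\<Sum>i\<in>I. P i"
    have Re_le: "Re (hinner z (?S *v z)) \<le> mat_norm ?S" if "norm z = 1" for z
      using norm_quad_form_le[of ?S z] that complex_Re_le_cmod[of "hinner z (?S *v z)"]
      by (simp add: quad_form_hinner)
    have "cmod (hinner y ((\<Sum>i\<in>I. mat (c i) ** P i) *v x)) = cmod (\<Sum>i\<in>I. c i * hinner y (P i *v x))"
      by (simp add: mv hinner_sum_right scaled_matrix_vector_mult hinner_scale_right)
    also have "\<dots> \<le> (\<Sum>i\<in>I. b * ((Re (hinner x (P i *v x)) + Re (hinner y (P i *v y))) / 2))"
      by (rule order_trans[OF norm_sum]) (unfold norm_mult, intro sum_mono mult_mono c cs b; simp)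
    also have "\<dots> = b * ((Re (hinner x (?S *v x)) + Re (hinner y (?S *v y))) / 2)"
      by (simp add: mv hinner_sum_right Re_sum sum.distrib add_divide_distrib flip: sum_distrib_left sum_divide_distrib)
    also have "\<dots> \<le> b * mat_norm ?S"
      using b Re_le[OF xy(1)] Re_le[OF xy(2)] by (intro mult_left_mono) auto
    finally show "cmod (hinner y ((\<Sum>i\<in>I. mat (c i) ** P i) *v x)) \<le> b * mat_norm ?S" .
  qed
qed

text \<open>One step of the Crouzeix--Palencia argument.  With \<open>X = f(A)\<close> and the values \<open>G\<close> at \<open>A\<close> of
  the Cauchy transform \<open>g\<close> of \<open>cnj f\<close>, the matrix \<open>X + G\<^sup>H\<close> is an integral of \<open>f\<close> against a
  positive operator measure of mass 2, and \<open>\<bar>g\<bar> \<le> 3\<close> because \<open>g + cnj f\<close> is an integral of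
  \<open>cnj f\<close> against a positive measure of mass 2.\<close>

lemma crouzeix_palencia_step:
  fixes A :: "complex^'n^'n" and f :: "complex poly"
  assumes \<Omega>: "compact \<Omega>" "convex \<Omega>" "numerical_range A \<subseteq> \<Omega>"
    and K: "K \<ge> 0" "\<And>p b. (\<forall>z\<in>\<Omega>. cmod (poly p z) \<le> b) \<Longrightarrow> mat_norm (poly_mat p A) \<le> K * b"
    and f': "\<forall>z\<in>\<Omega>. cmod (poly f z) \<le> 1"
    and \<eta>: "\<eta> > 0"
  shows "mat_norm (poly_mat f A) ^ 4 \<le>
    mat_norm (poly_mat f A) ^ 3 * (K * \<eta> + (1 + \<eta>) * (2 + 2 * (K * \<eta>)))
      + mat_norm (poly_mat f A) * (K * ((1 + \<eta>) + 2 * (1 + \<eta>)\<^sup>2))"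
proof -
  note f = bspec[OF f']
  have ne: "\<Omega> \<noteq> {}" using \<Omega>(3) numerical_range_nonempty[of A] by auto
  from ex_convex_neighbourhood[OF \<Omega>(1,2) f' \<eta>]
  obtain W \<epsilon> where W: "compact W" "convex W" "\<epsilon> > 0" "\<forall>z\<in>\<Omega>. cball z \<epsilon> \<subseteq> W"
    and fW': "\<forall>z\<in>W. cmod (poly f z) \<le> 1 + \<eta>" by (elim exE conjE) (rule that)
  note fW = bspec[OF fW']
  from ex_discrete_contour[OF W(1-4) ne \<eta>, of f]
  obtain I :: "(nat \<times> nat) set" and \<sigma> \<tau> v where I: "finite I"
    and \<sigma>W': "\<forall>i\<in>I. \<sigma> i \<in> W" and v': "\<forall>i\<in>I. cmod (v i) = 1"
    and half_plane': "\<forall>i\<in>I. \<forall>z\<in>\<Omega>. \<epsilon> / 2 \<le> Re (cnj (v i) * (\<sigma> i - z))"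
    and pos': "\<forall>i\<in>I. \<forall>z\<in>\<Omega>. 0 \<le> Re (- \<i> * \<tau> i * cnj (\<sigma> i - z))"
    and sum1': "\<forall>z\<in>\<Omega>. cmod ((\<Sum>i\<in>I. \<tau> i / (\<sigma> i - z)) - 2 * of_real pi * \<i>) \<le> \<eta>"
    and sumf': "\<forall>z\<in>\<Omega>. cmod ((\<Sum>i\<in>I. poly f (\<sigma> i) * \<tau> i / (\<sigma> i - z)) - 2 * of_real pi * \<i> * poly f z) \<le> \<eta>"
    by (elim exE conjE) (rule that)
  note \<sigma>W = bspec[OF \<sigma>W'] and v = bspec[OF v'] and half_plane = bspec[OF bspec[OF half_plane']]
    and pos = bspec[OF bspec[OF pos']] and sum1 = bspec[OF sum1'] and sumf = bspec[OF sumf']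
  define a where "a i = \<tau> i / (2 * of_real pi * \<i>)" for i
  have nz: "\<sigma> i - z \<noteq> 0" if "i \<in> I" "z \<in> \<Omega>" for i z
    using half_plane[OF that] W(3) by auto
  have "\<exists>R. R ** (mat (\<sigma> i) - A) = mat 1 \<and> (mat (\<sigma> i) - A) ** R = mat 1" if "i \<in> I" for i
  proof -
    have "\<sigma> i \<notin> mat_spectrum A"
      using nz[OF that] mat_spectrum_subset_numerical_range[of A] \<Omega>(3) by force
    then show ?thesis using ex_resolvent by metis
  qed
  then obtain R where R: "\<And>i. i \<in> I \<Longrightarrow> R i ** (mat (\<sigma> i) - A) = mat 1"
    "\<And>i. i \<in> I \<Longrightarrow> (mat (\<sigma> i) - A) ** R i = mat 1" by metis
  have approx_R: "poly_approx \<Omega> A (\<lambda>z. 1 / (\<sigma> i - z)) (R i)" if i: "i \<in> I" for i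
  proof -
    obtain B where B: "\<And>z. z \<in> \<Omega> \<Longrightarrow> cmod z \<le> B"
      using compact_imp_bounded[OF \<Omega>(1)] by (auto simp: bounded_iff)
    show ?thesis
    proof (rule poly_approx_resolvent[OF K(1) K(2) v[OF i] _ half_plane[OF i] _ R(1)[OF i]])
      show "\<epsilon> / 2 > 0" using W(3) by simp
      show "cmod (\<sigma> i - z) \<le> cmod (\<sigma> i) + B" if "z \<in> \<Omega>" for z
        using norm_triangle_ineq4[of "\<sigma> i" z] B[OF that] by simp
    qed
  qed
  have approx_sum: "poly_approx \<Omega> A (\<lambda>z. \<Sum>i\<in>I. c i * (1 / (\<sigma> i - z))) (\<Sum>i\<in>I. mat (c i) ** R i)" for c
    by (intro poly_approx_sum poly_approx_scale approx_R)
  define X where "X = poly_mat f A"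
  \<comment> \<open>\<open>S\<close> and \<open>F\<close> are the discretised Cauchy integrals of 1
    and f, hence close to the identity and to X. \<open>G\<close> is by definition the value at A of
    the discretised transform g and is not compared with any limit.\<close>
  define S where "S = (\<Sum>i\<in>I. mat (a i) ** R i)"
  define F where "F = (\<Sum>i\<in>I. mat (poly f (\<sigma> i) * a i) ** R i)"
  define G where "G = (\<Sum>i\<in>I. mat (cnj (poly f (\<sigma> i)) * a i) ** R i)"
  define s where "s z = (\<Sum>i\<in>I. a i * (1 / (\<sigma> i - z)))" for z
  define h where "h z = (\<Sum>i\<in>I. (poly f (\<sigma> i) * a i) * (1 / (\<sigma> i - z)))" for z
  define g where "g z = (\<Sum>i\<in>I. (cnj (poly f (\<sigma> i)) * a i) * (1 / (\<sigma> i - z)))" for z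
  have pi2: "1 \<le> 2 * pi" using pi_gt3 by simp
  have scale: "cmod (y / (2 * of_real pi * \<i>) - x) \<le> \<eta>" if "cmod (y - 2 * of_real pi * \<i> * x) \<le> \<eta>" for x y
  proof -
    have "y / (2 * of_real pi * \<i>) - x = (y - 2 * of_real pi * \<i> * x) / (2 * of_real pi * \<i>)"
      by (simp add: diff_divide_distrib)
    then have "cmod (y / (2 * of_real pi * \<i>) - x) = cmod (y - 2 * of_real pi * \<i> * x) / (2 * pi)"
      by (simp add: norm_divide norm_mult)
    also have "\<dots> \<le> \<eta> / 1" using that \<eta> pi2 by (intro frac_le) auto
    finally show ?thesis by simp
  qed
  have s1: "cmod (s z - 1) \<le> \<eta>" if "z \<in> \<Omega>" for z
  proof -
    have "s z = (\<Sum>i\<in>I. \<tau> i / (\<sigma> i - z)) / (2 * of_real pi * \<i>)"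
      unfolding s_def sum_divide_distrib by (simp add: a_def mult.commute)
    then show ?thesis using scale[of "\<Sum>i\<in>I. \<tau> i / (\<sigma> i - z)" 1] sum1[OF that] by simp
  qed
  have hf: "cmod (h z - poly f z) \<le> \<eta>" if "z \<in> \<Omega>" for z
  proof -
    have "h z = (\<Sum>i\<in>I. poly f (\<sigma> i) * \<tau> i / (\<sigma> i - z)) / (2 * of_real pi * \<i>)"
      unfolding h_def sum_divide_distrib by (simp add: a_def mult.commute)
    then show ?thesis using scale[OF sumf[OF that]] by simp
  qed
  have SI: "mat_norm (S - mat 1) \<le> K * \<eta>"
  proof (rule poly_approx_bound[OF K])
    show "poly_approx \<Omega> A (\<lambda>z. s z - poly 1 z) (S - mat 1)"
      using poly_approx_diff[OF approx_sum[of a] poly_approx_poly[of \<Omega> A 1]] by (simp add: s_def S_def)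
    show "cmod (s z - poly 1 z) \<le> \<eta>" if "z \<in> \<Omega>" for z using s1[OF that] by simp
  qed auto
  have FX: "mat_norm (F - X) \<le> K * \<eta>"
  proof (rule poly_approx_bound[OF K])
    show "poly_approx \<Omega> A (\<lambda>z. h z - poly f z) (F - X)"
      using poly_approx_diff[OF approx_sum[of "\<lambda>i. poly f (\<sigma> i) * a i"] poly_approx_poly[of \<Omega> A f]]
      by (simp add: h_def F_def X_def)
  qed (use hf in auto)
  have Re_a: "0 \<le> Re (a i * (1 / (\<sigma> i - z)))" if "i \<in> I" "z \<in> \<Omega>" for i z
  proof -
    have "a i * (1 / (\<sigma> i - z)) = of_real (1 / (2 * pi * (cmod (\<sigma> i - z))\<^sup>2)) * (- \<i> * \<tau> i * cnj (\<sigma> i - z))"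
      unfolding a_def by (rule cauchy_kernel_eq)
    then have "Re (a i * (1 / (\<sigma> i - z))) = 1 / (2 * pi * (cmod (\<sigma> i - z))\<^sup>2) * Re (- \<i> * \<tau> i * cnj (\<sigma> i - z))"
      by (simp only: Re_complex_of_real times_complex.sel(1)[of "of_real _"] Im_complex_of_real mult_zero_left diff_zero)
    also have "\<dots> \<ge> 0" using pos[OF that] by (rule mult_nonneg_nonneg[rotated]) simp
    finally show ?thesis .
  qed
  have g_le: "cmod (g z) \<le> (1 + \<eta>) + 2 * (1 + \<eta>)\<^sup>2" if z: "z \<in> \<Omega>" for z
  proof -
    define r where "r i = Re (a i * (1 / (\<sigma> i - z)))" for i
    \<comment> \<open>Adding cnj h replaces each kernel by twice its real part. These weights are
      nonnegative, and their total 2 Re (s z) is nearly 2.\<close>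
    have "g z + cnj (h z) = (\<Sum>i\<in>I. cnj (poly f (\<sigma> i)) * of_real (2 * r i))"
      unfolding g_def h_def cnj_sum sum.distrib[symmetric]
    proof (rule sum.cong[OF refl])
      fix i
      let ?w = "a i * (1 / (\<sigma> i - z))"
      have "?w + cnj ?w = of_real (2 * r i)" unfolding r_def by (rule complex_add_cnj)
      moreover have "cnj (poly f (\<sigma> i)) * a i * (1 / (\<sigma> i - z)) + cnj (poly f (\<sigma> i) * a i * (1 / (\<sigma> i - z)))
        = cnj (poly f (\<sigma> i)) * (?w + cnj ?w)" by (simp add: algebra_simps)
      ultimately show "cnj (poly f (\<sigma> i)) * a i * (1 / (\<sigma> i - z)) + cnj (poly f (\<sigma> i) * a i * (1 / (\<sigma> i - z)))
        = cnj (poly f (\<sigma> i)) * of_real (2 * r i)" by simp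
    qed
    also have "cmod \<dots> \<le> (\<Sum>i\<in>I. (1 + \<eta>) * (2 * r i))"
    proof (rule order_trans[OF norm_sum], rule sum_mono)
      fix i assume i: "i \<in> I"
      have "r i \<ge> 0" unfolding r_def by (rule Re_a[OF i z])
      then show "cmod (cnj (poly f (\<sigma> i)) * of_real (2 * r i)) \<le> (1 + \<eta>) * (2 * r i)"
        using fW[OF \<sigma>W[OF i]] by (simp add: norm_mult mult_right_mono)
    qed
    also have "\<dots> = 2 * (1 + \<eta>) * Re (s z)"
      by (simp add: s_def r_def Re_sum sum_distrib_left algebra_simps)
    also have "\<dots> \<le> 2 * (1 + \<eta>) * (1 + \<eta>)"
    proof (rule mult_left_mono)
      have "Re (s z - 1) \<le> \<eta>" using s1[OF z] complex_Re_le_cmod order_trans by blast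
      then show "Re (s z) \<le> 1 + \<eta>" by simp
    qed (use \<eta> in simp)
    finally have "cmod (g z + cnj (h z)) \<le> 2 * (1 + \<eta>)\<^sup>2" by (simp only: power2_eq_square mult.assoc)
    moreover have "cmod (h z) \<le> 1 + \<eta>"
      using hf[OF z] f[OF z] norm_triangle_sub[of "h z" "poly f z"] by linarith
    moreover have "cmod (g z) \<le> cmod (g z + cnj (h z)) + cmod (cnj (h z))"
      using norm_triangle_ineq4[of "g z + cnj (h z)" "cnj (h z)"] by simp
    ultimately show ?thesis by simp
  qed
  have XGX: "mat_norm (X ** G ** X) \<le> K * ((1 + \<eta>) + 2 * (1 + \<eta>)\<^sup>2)"
  proof (rule poly_approx_bound[OF K])
    show "poly_approx \<Omega> A (\<lambda>z. poly f z * g z * poly f z) (X ** G ** X)"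
      unfolding X_def G_def g_def[abs_def] by (rule poly_approx_sandwich[OF approx_sum f])
    show "cmod (poly f z * g z * poly f z) \<le> (1 + \<eta>) + 2 * (1 + \<eta>)\<^sup>2" if z: "z \<in> \<Omega>" for z
    proof -
      have "cmod (poly f z * g z * poly f z) \<le> 1 * cmod (g z) * 1"
        unfolding norm_mult using f[OF z] by (intro mult_mono) auto
      then show ?thesis using g_le[OF z] by simp
    qed
  qed auto
  define P where "P i = mat (a i) ** R i + conj_transpose (mat (a i) ** R i)" for i
  have P_pos: "0 \<le> Re (hinner x (P i *v x))" if i: "i \<in> I" for i x
  proof -
    \<comment> \<open>Writing x as (\<sigma> - A) y turns the form of the resolvent into |y|^2 cnj
      (\<sigma> - w) with w in the numerical range, so positivity of the scalar kernel on \<Omega>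
      suffices.\<close>
    define y where "y = R i *v x"
    have x: "x = (mat (\<sigma> i) - A) *v y"
      by (simp add: y_def matrix_vector_mul_assoc R(2)[OF i])
    have "hinner x (P i *v x) = hinner x ((mat (a i) ** R i) *v x) + cnj (hinner x ((mat (a i) ** R i) *v x))"
      by (simp add: P_def matrix_vector_mult_add_rdistrib hinner_add_right cnj_hinner conj_transpose_hinner'[symmetric])
    then have "Re (hinner x (P i *v x)) = 2 * Re (hinner x ((mat (a i) ** R i) *v x))" by simp
    also have "hinner x ((mat (a i) ** R i) *v x) = a i * hinner x y"
      by (simp add: scaled_matrix_vector_mult hinner_scale_right y_def)
    also have "0 \<le> 2 * Re (a i * hinner x y)"
    proof (cases "y = 0")
      case False
      define w where "w = quad_form A y / of_real ((norm y)\<^sup>2)"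
      have w: "w \<in> \<Omega>" using quad_form_mem_numerical_range[OF False, of A] \<Omega>(3) by (auto simp: w_def)
      have "hinner x y = cnj (hinner y x)" by (simp add: cnj_hinner)
      also have "hinner y x = of_real ((norm y)\<^sup>2) * (\<sigma> i - w)"
        using False by (simp add: x matrix_vector_mult_diff_rdistrib mat_vector_mult hinner_simps
            hinner_self w_def quad_form_hinner algebra_simps)
      finally have "a i * hinner x y = of_real ((norm y)\<^sup>2 / (2 * pi)) * (- \<i> * \<tau> i * cnj (\<sigma> i - w))"
        unfolding a_def divide_two_pi_i divide_inverse[of "(norm y)\<^sup>2"] of_real_mult
          complex_cnj_mult complex_cnj_complex_of_real by (simp only: mult_ac)
      then have "Re (a i * hinner x y) = (norm y)\<^sup>2 / (2 * pi) * Re (- \<i> * \<tau> i * cnj (\<sigma> i - w))"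
        by (simp only: Re_complex_of_real times_complex.sel(1)[of "of_real _"] Im_complex_of_real mult_zero_left diff_zero)
      moreover have "\<dots> \<ge> 0" using pos[OF i w] by (rule mult_nonneg_nonneg[rotated]) simp
      ultimately show ?thesis by simp
    qed simp
    finally show ?thesis .
  qed
  have sumP: "(\<Sum>i\<in>I. P i) = S + conj_transpose S"
    by (simp add: P_def S_def sum.distrib conj_transpose_sum)
  have "mat_norm S \<le> 1 + K * \<eta>"
  proof -
    have "mat_norm (mat 1 :: complex^'n^'n) \<le> 1" by (rule mat_norm_le) simp
    then show ?thesis using mat_norm_diff[of S "mat 1"] SI by simp
  qed
  then have normP: "mat_norm (\<Sum>i\<in>I. P i) \<le> 2 + 2 * (K * \<eta>)"
    using mat_norm_add[of S "conj_transpose S"] by (simp add: sumP mat_norm_conj_transpose)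
  have FG: "F + conj_transpose G = (\<Sum>i\<in>I. mat (poly f (\<sigma> i)) ** P i)"
    unfolding F_def G_def conj_transpose_sum sum.distrib[symmetric]
  proof (rule sum.cong[OF refl])
    fix i
    have "conj_transpose (mat (cnj (poly f (\<sigma> i)) * a i) ** R i)
        = conj_transpose (mat (a i) ** R i) ** mat (poly f (\<sigma> i))"
      unfolding mat_mult matrix_mul_assoc[symmetric] by (simp add: conj_transpose_mult conj_transpose_mat)
    then show "mat (poly f (\<sigma> i) * a i) ** R i + conj_transpose (mat (cnj (poly f (\<sigma> i)) * a i) ** R i)
        = mat (poly f (\<sigma> i)) ** P i"
      unfolding P_def mat_mult by (simp only: matrix_add_ldistrib matrix_mul_assoc mat_scale_commute[of "conj_transpose _"])
  qed
  have "mat_norm (F + conj_transpose G) \<le> (1 + \<eta>) * mat_norm (\<Sum>i\<in>I. P i)"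
    unfolding FG
    by (rule norm_sum_positive_forms_le)
      (use P_pos fW \<sigma>W \<eta> in \<open>auto simp: P_def conj_transpose_add add.commute\<close>)
  also have "\<dots> \<le> (1 + \<eta>) * (2 + 2 * (K * \<eta>))" using normP \<eta> by (intro mult_left_mono) auto
  finally have "mat_norm (X + conj_transpose G) \<le> K * \<eta> + (1 + \<eta>) * (2 + 2 * (K * \<eta>))"
    using mat_norm_add[of "X - F" "F + conj_transpose G"] FX mat_norm_minus[of X F] by simp
  then have XG: "mat_norm (conj_transpose X + G) \<le> K * \<eta> + (1 + \<eta>) * (2 + 2 * (K * \<eta>))"
    using mat_norm_conj_transpose[of "X + conj_transpose G"] by (simp add: conj_transpose_add)
  define x where "x = mat_norm X"
  define Y where "Y = conj_transpose X"
  have x0: "x \<ge> 0" by (simp add: x_def)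
  have Yx: "mat_norm Y = x" by (simp add: Y_def x_def mat_norm_conj_transpose)
  have "x\<^sup>2 \<le> mat_norm (X ** Y)"
    using mat_norm_square_le[of Y] by (simp add: Yx) (simp add: Y_def)
  then have "(x\<^sup>2)\<^sup>2 \<le> (mat_norm (X ** Y))\<^sup>2" by (rule power_mono) simp
  also have "\<dots> \<le> mat_norm (X ** Y ** (X ** Y))"
    using mat_norm_square_le[of "X ** Y"] by (simp add: Y_def conj_transpose_mult)
  \<comment> \<open>The term with Y + G costs about 2 x^3. In the other term K applies to
    \<open>X ** G ** X\<close> as a whole, the value at A of f g f, and only the factor x from Y
    remains.\<close>
  also have "X ** Y ** (X ** Y) = X ** (Y + G) ** (X ** Y) - X ** G ** X ** Y"
    by (simp add: matrix_add_ldistrib matrix_add_rdistrib matrix_mul_assoc)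
  also have "mat_norm \<dots> \<le> mat_norm (X ** (Y + G) ** (X ** Y)) + mat_norm (X ** G ** X ** Y)"
    using mat_norm_add[of "X ** (Y + G) ** (X ** Y)" "- (X ** G ** X ** Y)"] mat_norm_minus[of 0 "X ** G ** X ** Y"] by simp
  also have "mat_norm (X ** (Y + G) ** (X ** Y)) \<le> x ^ 3 * (K * \<eta> + (1 + \<eta>) * (2 + 2 * (K * \<eta>)))"
  proof -
    have "mat_norm (X ** (Y + G) ** (X ** Y)) \<le> (x * mat_norm (Y + G)) * (x * x)"
      by (rule order_trans[OF mat_norm_mult mult_mono])
        (use mat_norm_mult[of X "Y + G"] mat_norm_mult[of X Y] Yx x0 in \<open>simp_all add: x_def\<close>)
    also have "\<dots> = x ^ 3 * mat_norm (Y + G)" by (simp add: power3_eq_cube)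
    also have "\<dots> \<le> x ^ 3 * (K * \<eta> + (1 + \<eta>) * (2 + 2 * (K * \<eta>)))"
      using XG x0 by (intro mult_left_mono) (simp_all add: Y_def)
    finally show ?thesis .
  qed
  also have "mat_norm (X ** G ** X ** Y) \<le> x * (K * ((1 + \<eta>) + 2 * (1 + \<eta>)\<^sup>2))"
  proof -
    have "mat_norm (X ** G ** X ** Y) \<le> mat_norm (X ** G ** X) * x"
      using mat_norm_mult[of "X ** G ** X" Y] by (simp add: Yx)
    also have "\<dots> \<le> (K * ((1 + \<eta>) + 2 * (1 + \<eta>)\<^sup>2)) * x" using XGX x0 by (rule mult_right_mono)
    finally show ?thesis by (simp add: mult.commute)
  qed
  finally show ?thesis by (simp add: x_def X_def flip: power_mult)
qed

lemma mat_norm_poly_mat_le_on_neighbourhood: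
  fixes A :: "complex^'n^'n"
  assumes \<Omega>: "compact \<Omega>" "convex \<Omega>" and \<delta>: "\<delta> > 0" "\<forall>z\<in>numerical_range A. cball z \<delta> \<subseteq> \<Omega>"
    and b: "\<forall>z\<in>\<Omega>. cmod (poly p z) \<le> b"
  shows "mat_norm (poly_mat p A) \<le> 3 * b"
proof -
  have sub: "numerical_range A \<subseteq> \<Omega>" using \<delta> by force
  then have ne: "\<Omega> \<noteq> {}" using numerical_range_nonempty[of A] by auto
  obtain C where C: "C \<ge> 0" "\<And>p b. (\<forall>z\<in>\<Omega>. cmod (poly p z) \<le> b) \<Longrightarrow> mat_norm (poly_mat p A) \<le> C * b"
    using ex_poly_mat_bound[OF \<delta>(1), of A \<Omega>] \<delta>(2) mat_spectrum_subset_numerical_range[of A] by blast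
  define T where "T = {mat_norm (poly_mat p A) | p. \<forall>z\<in>\<Omega>. cmod (poly p z) \<le> 1}"
  define K where "K = Sup T"
  have bdd: "bdd_above T"
    by (rule bdd_aboveI[of _ "C * 1"]) (use C(2)[of _ 1] in \<open>auto simp: T_def\<close>)
  have T_le: "x \<le> K" if "x \<in> T" for x unfolding K_def by (rule cSup_upper[OF that bdd])
  have "mat_norm (poly_mat 0 A) \<in> T" unfolding T_def by (intro CollectI exI[of _ 0]) simp
  then have K0: "K \<ge> 0" and T_ne: "T \<noteq> {}" using T_le by auto
  have K: "mat_norm (poly_mat p A) \<le> K * b" if b: "\<forall>z\<in>\<Omega>. cmod (poly p z) \<le> b" for p b
  proof (cases "b > 0")
    case True
    have "mat_norm (poly_mat (smult (of_real (1 / b)) p) A) \<in> T"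
      unfolding T_def using b True by (intro CollectI exI[of _ "smult (of_real (1 / b)) p"])
        (simp add: norm_mult norm_divide)
    then have le: "mat_norm (poly_mat (smult (of_real (1 / b)) p) A) \<le> K" by (rule T_le)
    have "p = smult (of_real b) (smult (of_real (1 / b)) p)" using True by simp
    then have "poly_mat p A = mat (of_real b) ** poly_mat (smult (of_real (1 / b)) p) A"
      by (metis poly_mat_smult)
    then have "mat_norm (poly_mat p A) \<le> b * mat_norm (poly_mat (smult (of_real (1 / b)) p) A)"
      using mat_norm_scale_le[of "of_real b" "poly_mat (smult (of_real (1 / b)) p) A"] True by simp
    also have "\<dots> \<le> b * K" using le True by (intro mult_left_mono) auto
    finally show ?thesis by (simp add: mult.commute)
  next
    \<comment> \<open>Rescaling is impossible here, but b = 0 because \<Omega> is nonempty, and the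
      a priori constant C gives the norm 0.\<close>
    case False
    obtain z where "z \<in> \<Omega>" using ne by blast
    then have "0 \<le> b" using b norm_ge_zero order_trans by blast
    then have "b = 0" using False by simp
    then show ?thesis using C(2)[OF b] by simp
  qed
  have step: "x ^ 4 \<le> 2 * x ^ 3 + 3 * K * x" if xT: "x \<in> T" for x
  proof -
    obtain f where f: "x = mat_norm (poly_mat f A)" "\<forall>z\<in>\<Omega>. cmod (poly f z) \<le> 1"
      using xT unfolding T_def by blast
    define r where "r \<eta> = x ^ 3 * (K * \<eta> + (1 + \<eta>) * (2 + 2 * (K * \<eta>))) + x * (K * ((1 + \<eta>) + 2 * (1 + \<eta>)\<^sup>2))" for \<eta>
    have "x ^ 4 \<le> r \<eta>" if "\<eta> > 0" for \<eta>
      unfolding r_def f(1) by (rule crouzeix_palencia_step[OF \<Omega> sub K0 K f(2) that])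
    then have "\<forall>\<^sub>F \<eta> in at_right 0. x ^ 4 \<le> r \<eta>"
      by (auto simp: eventually_at_right_less[THEN eventually_mono])
    moreover have "(r \<longlongrightarrow> r 0) (at_right 0)"
      unfolding r_def by (intro tendsto_intros)
    ultimately have "x ^ 4 \<le> r 0" by (intro tendsto_lowerbound) auto
    then show ?thesis by (simp add: r_def algebra_simps)
  qed
  have "K \<le> 3"
  proof (rule ccontr)
    assume "\<not> K \<le> 3"
    \<comment> \<open>The supremum need not be attained, so x is chosen above the midpoint m of 3
      and K. Then K = 2 m - 3, and x^2 (x - 2) is at least 3 m (m - 2) = 3 K + 3 (m - 3)(m - 1),
      against \<open>step\<close>.\<close>
    define m where "m = (K + 3) / 2"
    have m: "3 < m" "m < K" using \<open>\<not> K \<le> 3\<close> by (simp_all add: m_def)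
    obtain x where x: "x \<in> T" "m < x"
      using m(2) less_cSup_iff[OF T_ne bdd] unfolding K_def by blast
    have x3: "x > 3" using x m by simp
    have "x * (x ^ 2 * (x - 2)) \<le> x * (3 * K)"
      using step[OF x(1)] by (simp add: power2_eq_square power3_eq_cube power4_eq_xxxx algebra_simps)
    then have 1: "x ^ 2 * (x - 2) \<le> 3 * K" using x3 by simp
    have "3 * m * (m - 2) \<le> x ^ 2 * (x - 2)"
      unfolding power2_eq_square using x3 x m by (intro mult_mono) auto
    moreover have "3 * m * (m - 2) > 3 * K"
    proof -
      have "m * (m - 2) - K = (m - 3) * (m - 1)" by (simp add: m_def field_simps)
      moreover have "(m - 3) * (m - 1) > 0" using m by (intro mult_pos_pos) auto
      ultimately show ?thesis by (simp add: algebra_simps)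
    qed
    ultimately show False using 1 by simp
  qed
  moreover have "0 \<le> b"
    using b ne norm_ge_zero order_trans by blast
  ultimately show ?thesis using K[OF b] mult_right_mono[of K 3 b] by linarith
qed

lemma mat_norm_poly_mat_le:
  assumes b: "\<forall>z\<in>numerical_range A. cmod (poly p z) \<le> b"
  shows "mat_norm (poly_mat p A) \<le> 3 * b"
proof (rule field_le_epsilon)
  fix e :: real assume "e > 0"
  then have e: "e / 3 > 0" by simp
  from ex_convex_neighbourhood[OF compact_numerical_range convex_numerical_range b e]
  obtain W \<epsilon> where W: "compact W" "convex W" "\<epsilon> > 0" "\<forall>z\<in>numerical_range A. cball z \<epsilon> \<subseteq> W"
    "\<forall>z\<in>W. cmod (poly p z) \<le> b + e / 3" by (elim exE conjE) (rule that)
  have "mat_norm (poly_mat p A) \<le> 3 * (b + e / 3)"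
    by (rule mat_norm_poly_mat_le_on_neighbourhood[OF W])
  then show "mat_norm (poly_mat p A) \<le> 3 * b + e" by simp
qed

section \<open>The error of the trace estimator\<close>

lemma norm_probing_error_poly_mat_le:
  fixes A :: "complex^'n^'n"
  assumes b: "\<And>z. z \<in> numerical_range A \<Longrightarrow> cmod (poly p z) \<le> b"
    and col: "range col \<subseteq> {1..m}"
  shows "cmod (trace (poly_mat p A) - probing_trace col m (poly_mat p A))
    \<le> 2 * (if normal_matrix A then 1 else 1 + sqrt 2) * real CARD('n) * b"
proof -
  let ?E = "poly_mat p A" and ?k = "if normal_matrix A then 1 else (3 :: real)"
  have b0: "b \<ge> 0" using numerical_range_nonempty[of A] b norm_ge_zero order_trans by blast
  have spec: "cmod (poly p z) \<le> b" if "z \<in> mat_spectrum A" for z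
    using that b mat_spectrum_subset_numerical_range[of A] by blast
  have "mat_norm ?E \<le> ?k * b"
    using mat_norm_poly_mat_normal_le[of A p b] spec mat_norm_poly_mat_le[of A p b] b by auto
  from order_trans[OF norm_probing_trace_le[OF col] mult_right_mono[OF this]]
  have "cmod (probing_trace col m ?E) \<le> ?k * b * real CARD('n)" by simp
  moreover have "cmod (trace ?E) \<le> real CARD('n) * b"
    using spec b0 by (rule norm_trace_poly_mat_le)
  ultimately have "cmod (trace ?E - probing_trace col m ?E) \<le> (1 + ?k) * (real CARD('n) * b)"
    using norm_triangle_ineq4[of "trace ?E" "probing_trace col m ?E"] by (simp add: algebra_simps)
  also have "\<dots> \<le> 2 * (if normal_matrix A then 1 else 1 + sqrt 2) * (real CARD('n) * b)"
  proof (rule mult_right_mono)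
    have "1 \<le> sqrt (2 :: real)" by simp
    then show "1 + ?k \<le> 2 * (if normal_matrix A then 1 else 1 + sqrt 2)" by (cases "normal_matrix A") auto
  qed (use b0 in simp)
  finally show ?thesis by (simp add: mult.assoc)
qed

text \<open>An infimum yields a polynomial only up to the slack c' - c; every application sends the
  slack to 0.\<close>

lemma ex_near_best_approximation:
  assumes "best_approx_error f W s \<le> ereal c" "c < c'"
  shows "\<exists>p. degree p \<le> s \<and> (\<forall>z\<in>W. cmod (f z - poly p z) \<le> c')"
proof -
  have "best_approx_error f W s < ereal c'" using assms by (metis ereal_less(2) le_less_trans less_ereal.simps(1))
  then obtain p where p: "degree p \<le> s" "(SUP z\<in>W. ereal (cmod (f z - poly p z))) < ereal c'"
    unfolding best_approx_error_def INF_less_iff by auto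
  have "cmod (f z - poly p z) \<le> c'" if "z \<in> W" for z
  proof -
    have "ereal (cmod (f z - poly p z)) \<le> (SUP z\<in>W. ereal (cmod (f z - poly p z)))"
      by (rule SUP_upper[OF that])
    also have "\<dots> < ereal c'" by (rule p(2))
    finally show ?thesis by simp
  qed
  then show ?thesis using p(1) by blast
qed

theorem theorem4p4:
  fixes A :: "complex^'n^'n"
    and f :: "complex \<Rightarrow> complex"
    and W :: "complex set"
    and C q \<epsilon> K :: real
    and d m :: nat
    and col :: "'n \<Rightarrow> nat"
  assumes "defined_on_spectrum f A"
    and "compact W"
    and "numerical_range A \<subseteq> W"
    and "C > 0"
    and "0 \<le> q" and "q < 1"
    and "\<And>s. best_approx_error f W s \<le> ereal (C * q ^ s)"
    and "d > 0"
    and "distance_coloring d A m col"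
    and "\<epsilon> = C * q ^ d"
    and "K = (if normal_matrix A then 1 else 1 + sqrt 2)"
  shows "cmod (trace (matrix_fun f A) - probing_trace col m (matrix_fun f A))
           \<le> 2 * K * real CARD('n) * \<epsilon>"
proof -
  note W = assms(3) and best = assms(7) and col = assms(9)
  have range: "range col \<subseteq> {1..m}" using col by (simp add: distance_coloring_def)
  define c where "c = 2 * K * real CARD('n)"
  have c: "c > 0" unfolding c_def assms(11) by (simp add: add_pos_pos)
  define err where "err M = trace M - probing_trace col m M" for M :: "complex^'n^'n"
  have err_diff: "err (M - N) = err M - err N" for M N
    by (simp add: err_def trace_def sum_subtractf probing_trace_diff)
  \<comment> \<open>This crude bound is enough for the difference
    \<open>poly_mat (p s) A - matrix_fun f A\<close>, whose norm tends to 0.\<close>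
  have err_le: "cmod (err M) \<le> 2 * real CARD('n) * mat_norm M" for M
  proof -
    have "cmod (trace M) \<le> (\<Sum>i\<in>(UNIV :: 'n set). mat_norm M)"
      unfolding trace_def by (rule order_trans[OF norm_sum sum_mono]) (rule norm_entry_le)
    then show ?thesis
      using norm_probing_trace_le[OF range, of M] norm_triangle_ineq4[of "trace M" "probing_trace col m M"]
      by (simp add: err_def algebra_simps)
  qed
  \<comment> \<open>The added inverse is a slack that is positive for every s and vanishes in the
    limit.\<close>
  have "\<forall>s. \<exists>p. degree p \<le> s \<and> (\<forall>z\<in>W. cmod (f z - poly p z) \<le> C * q ^ s + inverse (real (Suc s)))"
    using ex_near_best_approximation[OF best] by simp
  then obtain p where p: "\<And>s z. z \<in> W \<Longrightarrow> cmod (f z - poly (p s) z) \<le> C * q ^ s + inverse (real (Suc s))"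
    by metis
  define \<beta> where "\<beta> s = C * q ^ s + inverse (real (Suc s))" for s
  have \<beta>: "\<beta> \<longlonglongrightarrow> 0"
    unfolding \<beta>_def
    by (rule tendsto_add_zero[OF tendsto_mult_right_zero[OF LIMSEQ_power_zero] LIMSEQ_inverse_real_of_nat])
      (use assms(5,6) in simp)
  have p_le: "cmod (f z - poly (p s) z) \<le> \<beta> s" if "z \<in> numerical_range A" for z s
    using p that W unfolding \<beta>_def by blast
  have "uniform_limit (numerical_range A) (\<lambda>s. poly (p s)) f sequentially"
  proof (rule uniform_limitI)
    fix e :: real assume "e > 0"
    from order_tendstoD(2)[OF \<beta> this]
    show "\<forall>\<^sub>F s in sequentially. \<forall>z\<in>numerical_range A. dist (poly (p s) z) (f z) < e"
    proof eventually_elim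
      case (elim s)
      then show ?case using p_le[of _ s] by (auto simp: dist_norm norm_minus_commute intro: le_less_trans)
    qed
  qed
  then have lim: "(\<lambda>s. mat_norm (poly_mat (p s) A - matrix_fun f A)) \<longlonglongrightarrow> 0"
    by (rule poly_mat_tendsto_matrix_fun)
  have bound: "cmod (err (matrix_fun f A)) \<le> c * (\<epsilon> + \<gamma>)" if \<gamma>: "\<gamma> > 0" for \<gamma>
  proof -
    obtain r where r: "degree r \<le> d" "\<forall>z\<in>W. cmod (f z - poly r z) \<le> \<epsilon> + \<gamma>"
      using ex_near_best_approximation[OF best, of d "\<epsilon> + \<gamma>"] \<gamma> assms(10) by auto
    have err_r: "err (poly_mat r A) = 0"
      by (simp add: err_def probing_trace_poly_mat[OF col r(1)])
    have le: "cmod (err (matrix_fun f A)) \<le> c * (\<epsilon> + \<gamma> + \<beta> s)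
        + 2 * real CARD('n) * mat_norm (poly_mat (p s) A - matrix_fun f A)" for s
    proof -
      \<comment> \<open>\<open>p s - r\<close> stands in for f - r, to which the estimate for
        polynomials does not apply directly. By \<open>err_r\<close> the estimator is exact for r,
        so the bound passes to \<open>p s\<close> itself.\<close>
      have "cmod (poly (p s - r) z) \<le> \<epsilon> + \<gamma> + \<beta> s" if z: "z \<in> numerical_range A" for z
        using norm_triangle_ineq4[of "f z - poly r z" "f z - poly (p s) z"] r(2) p_le[OF z, of s] z W
        by fastforce
      then have "cmod (err (poly_mat (p s - r) A)) \<le> c * (\<epsilon> + \<gamma> + \<beta> s)"
        unfolding err_def c_def assms(11) by (rule norm_probing_error_poly_mat_le[OF _ range])
      then have "cmod (err (poly_mat (p s) A)) \<le> c * (\<epsilon> + \<gamma> + \<beta> s)"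
        by (simp add: poly_mat_diff err_diff err_r)
      moreover have "err (matrix_fun f A) = err (poly_mat (p s) A) - err (poly_mat (p s) A - matrix_fun f A)"
        by (simp add: err_diff)
      ultimately show ?thesis
        using norm_triangle_ineq4[of "err (poly_mat (p s) A)" "err (poly_mat (p s) A - matrix_fun f A)"]
          err_le[of "poly_mat (p s) A - matrix_fun f A"] by simp
    qed
    have "(\<lambda>s. c * (\<epsilon> + \<gamma> + \<beta> s) + 2 * real CARD('n) * mat_norm (poly_mat (p s) A - matrix_fun f A))
        \<longlonglongrightarrow> c * (\<epsilon> + \<gamma> + 0) + 2 * real CARD('n) * 0"
      by (intro tendsto_intros lim \<beta>)
    from LIMSEQ_le_const[OF this] le
    have "cmod (err (matrix_fun f A)) \<le> c * (\<epsilon> + \<gamma> + 0) + 2 * real CARD('n) * 0" by blast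
    then show ?thesis by simp
  qed
  have "cmod (err (matrix_fun f A)) \<le> c * \<epsilon>"
  proof (rule field_le_epsilon)
    fix e :: real assume "e > 0"
    then have "cmod (err (matrix_fun f A)) \<le> c * (\<epsilon> + e / c)" using c by (intro bound) simp
    also have "\<dots> = c * \<epsilon> + e" using c by (simp add: distrib_left)
    finally show "cmod (err (matrix_fun f A)) \<le> c * \<epsilon> + e" .
  qed
  then show ?thesis by (simp add: err_def c_def)
qed

end
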